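(* For any configuration $\mathcal{H}$ of size $h$ and any $s,k\in\mathbb{N}$ there are $r,m_0,N\in\mathbb{N}$ such that the following holds. If $m\ge m_0$, $n\ge N\log m$, and for $j\in[h]$ we have $R_j\subset[n]$ with $|R_j|\le k$ and $(r,m^{-k})$-uncapturable families $\mathcal{A}_j\subset[m]^{[n]\setminus R_j}$, then, writing $T=\bigcup_{j}R_j$, there are $x^j\in\mathcal{A}_j$ ($j\in[h]$) such that $y^j=x^j_{[n]\setminus T}$, $j\in[h]$, realise $\mathcal{H}$.
   Context: $\mu$ is the uniform probability measure on $[m]^I$. A dictator in $[m]^I$ is $\{x:x_i=a\}$ ($i\in I$, $a\in[m]$); $\mathcal{G}\subset[m]^I$ is $(r,\varepsilon)$-uncapturable if for every set of at most $r$ dictators with union $U$ we have $\mu(\mathcal{G}\setminus U)>\varepsilon$. An $\ell$-configuration is a multiset $\mathcal{H}=\{e_1,\dots,e_h\}$ of $\ell$-element edges on a finite vertex set partitioned into $U_1,\dots,U_\ell$, each edge having exactly one vertex in each part; $h=|\mathcal{H}|$ is its size. Vectors $y^1,\dots,y^h\in[m]^{I}$ realise $\mathcal{H}$ if there is an injection $\Phi:[\ell]\to I$ such that for all distinct $j,j'\in[h]$ and $i\in I$: $y^j_i=y^{j'}_i$ exactly when $i=\Phi(k)$ for some $k\in[\ell]$ with $e_j\cap e_{j'}\cap U_k\ne\emptyset$. *)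

theory Defs
  imports Complex_Main "HOL-Library.FuncSet"
begin

definition cube :: "nat \<Rightarrow> nat set \<Rightarrow> (nat \<Rightarrow> nat) set" where
  "cube m I = PiE I (\<lambda>_. {1..m})"

definition mu :: "nat \<Rightarrow> nat set \<Rightarrow> (nat \<Rightarrow> nat) set \<Rightarrow> real" where
  "mu m I G = real (card (G \<inter> cube m I)) / real (card (cube m I))"

definition dictator :: "nat \<Rightarrow> nat set \<Rightarrow> nat \<Rightarrow> nat \<Rightarrow> (nat \<Rightarrow> nat) set" where
  "dictator m I i a = {x \<in> cube m I. x i = a}"

definition uncapturable ::
  "nat \<Rightarrow> nat set \<Rightarrow> nat \<Rightarrow> real \<Rightarrow> (nat \<Rightarrow> nat) set \<Rightarrow> bool" where
  "uncapturable m I r \<epsilon> G \<longleftrightarrow> G \<subseteq> cube m I \<and>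
     (\<forall>D. D \<subseteq> I \<times> {1..m} \<longrightarrow> card D \<le> r \<longrightarrow>
        mu m I (G - (\<Union>(i,a)\<in>D. dictator m I i a)) > \<epsilon>)"

text \<open>An l-configuration with h edges: vertex set V partitioned into
  parts U 0, ..., U (l-1); edges E 0, ..., E (h-1) (a multiset, given as an
  indexed family), each having exactly one vertex in each part.\<close>
definition is_configuration ::
  "'v set \<Rightarrow> nat \<Rightarrow> (nat \<Rightarrow> 'v set) \<Rightarrow> nat \<Rightarrow> (nat \<Rightarrow> 'v set) \<Rightarrow> bool" where
  "is_configuration V l U h E \<longleftrightarrow> finite V \<and>
     (\<Union>k<l. U k) = V \<and> (\<forall>k<l. U k \<noteq> {}) \<and>
     (\<forall>k<l. \<forall>k'<l. k \<noteq> k' \<longrightarrow> U k \<inter> U k' = {}) \<and>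
     (\<forall>j<h. E j \<subseteq> V \<and> (\<forall>k<l. card (E j \<inter> U k) = 1))"

definition realises ::
  "nat \<Rightarrow> nat set \<Rightarrow> nat \<Rightarrow> (nat \<Rightarrow> 'v set) \<Rightarrow> nat \<Rightarrow> (nat \<Rightarrow> 'v set)
     \<Rightarrow> (nat \<Rightarrow> (nat \<Rightarrow> nat)) \<Rightarrow> bool" where
  "realises m I l U h E y \<longleftrightarrow> (\<forall>j<h. y j \<in> cube m I) \<and>
     (\<exists>\<Phi>. inj_on \<Phi> {..<l} \<and> \<Phi> ` {..<l} \<subseteq> I \<and>
        (\<forall>j<h. \<forall>j'<h. j \<noteq> j' \<longrightarrow> (\<forall>i\<in>I.
           y j i = y j' i \<longleftrightarrow> (\<exists>k<l. i = \<Phi> k \<and> E j \<inter> E j' \<inter> U k \<noteq> {}))))"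

end

theory Submission
  imports Defs
begin

text \<open>
  First pass from each \<open>A\<^sub>j\<close> to a restriction in which fixing further coordinates raises the density by
  little; removing few dictators keeps the fixed parts of different restrictions, and everything that
  could meet them, in disagreement. Since \<open>n \<ge> N log m\<close> and the densities are at least \<open>m\<^bsup>-O(1)\<^esup>\<close>,
  most coordinates are nearly uniform on each family, so the \<open>l\<close> coordinates of \<open>\<Phi>\<close> and the values on
  them can be planted one after the other at bounded cost.

  It remains to find vectors that disagree on all other coordinates. Colour every pair \<open>(i, a)\<close>
  randomly and independently in small groups, and ask that the \<open>j\<close>-th vector uses only pairs of colour
  \<open>j\<close>. By induction on the dimension, a family of density \<open>\<mu>\<close> contains a vector of a given colour with
  probability at least \<open>\<mu>\<^bsup>O(1 / log m)\<^esup>\<close>, which is a constant when \<open>\<mu> \<ge> m\<^bsup>-O(1)\<^esup>\<close>. This event is monotone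
  in a bias parameter, so at some bias its total influence is bounded, and by a Friedgut-type
  argument it is nearly determined by boundedly many groups \<open>J\<close>. Removing the dictators of \<open>J\<close> leaves a
  family that still has a vector of that colour with constant probability, whatever happens in \<open>J\<close>;
  hence the probability is in fact close to one, and a union bound over the \<open>h\<close> colours applies.
\<close>

subsection \<open>Averaging and noise operators on product spaces\<close>

text \<open>The dimension \<open>n\<close> is not bounded in terms of \<open>m\<close>. If every
  letter were coloured independently, then for large \<open>n\<close> some coordinate would have no
  letter of a given colour, and nothing could be hit. Groups that are never entirely closed avoid
  this: the induction on the dimension needs probability at least
  \<open>(j / m) powr \<alpha>\<close> of opening one of the \<open>j\<close> best letters, and at
  \<open>j = m\<close> this has to be 1. The price is that a group is one variable with many values,
  so the bias sits in an extra bit, and the derivative in that bias has to control the influence of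
  the whole variable. With \<open>D = 4 * h\<close> and \<alpha> = 2 ln D / ln m, a density m^(-k)
  becomes the probability D^(-2k). This is free of \<open>m\<close> but too small for a union bound.
  It is lifted because it holds conditionally on every small set of groups. The restrictions use the
  exponent 1 - \<gamma> with \<gamma> = 1 / (2 (l + 1)): after \<open>l\<close> coordinates are
  planted, each further dictator still has relative density of order m^(-1/2), so boundedly many can
  be removed.\<close>

definition avg :: "'w set \<Rightarrow> ('w \<Rightarrow> real) \<Rightarrow> 'g \<Rightarrow> (('g \<Rightarrow> 'w) \<Rightarrow> real) \<Rightarrow> ('g \<Rightarrow> 'w) \<Rightarrow> real" where
  "avg W w g F = (\<lambda>\<omega>. \<Sum>v\<in>W. w v * F (\<omega>(g := v)))"

definition noise1 :: "'w set \<Rightarrow> ('w \<Rightarrow> real) \<Rightarrow> real \<Rightarrow> 'g \<Rightarrow> (('g \<Rightarrow> 'w) \<Rightarrow> real) \<Rightarrow> ('g \<Rightarrow> 'w) \<Rightarrow> real" where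
  "noise1 W w r g F = (\<lambda>\<omega>. r * F \<omega> + (1 - r) * avg W w g F \<omega>)"

text \<open>At \<open>r = 0\<close> this is the expectation over the coordinates in
  \<open>G\<close>, conditional on all others; for \<open>r\<close> between 0 and 1 it is the usual
  noise operator. One set of laws thus covers means, conditional means and noise. The fold is
  meaningful because the operators \<open>noise1\<close> commute.\<close>

definition noise :: "'w set \<Rightarrow> ('w \<Rightarrow> real) \<Rightarrow> real \<Rightarrow> 'g set \<Rightarrow> (('g \<Rightarrow> 'w) \<Rightarrow> real) \<Rightarrow> ('g \<Rightarrow> 'w) \<Rightarrow> real" where
  "noise W w r G F = Finite_Set.fold (noise1 W w r) F G"

text \<open>Negative weights are allowed because the bias \<open>t\<close> of \<open>cw\<close> is
  later differentiated at arbitrary real points, also outside the unit interval.\<close>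

locale signed_weights =
  fixes W :: "'w set" and w :: "'w \<Rightarrow> real"
  assumes sum_w: "sum w W = 1"
begin

lemma avg_linear: "avg W w g (\<lambda>\<omega>. a * F \<omega> + b * H \<omega>) = (\<lambda>\<omega>. a * avg W w g F \<omega> + b * avg W w g H \<omega>)"
  unfolding avg_def by (simp add: sum.distrib sum_distrib_left algebra_simps)

lemma avg_mult_indep:
  assumes "\<And>\<omega> v. c (\<omega>(g := v)) = c \<omega>"
  shows "avg W w g (\<lambda>\<omega>. c \<omega> * F \<omega>) = (\<lambda>\<omega>. c \<omega> * avg W w g F \<omega>)"
  unfolding avg_def using assms by (simp add: sum_distrib_left algebra_simps)

lemma avg_upd: "avg W w g F (\<omega>(g := v)) = avg W w g F \<omega>"
  by (simp add: avg_def)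

lemma avg_const: "avg W w g (\<lambda>_. c) = (\<lambda>_. c)"
  unfolding avg_def by (simp flip: sum_distrib_right add: sum_w)

lemma avg_avg: "avg W w g (avg W w g F) = avg W w g F"
  using avg_mult_indep[of "avg W w g F" g "\<lambda>_. 1"] by (simp add: avg_upd avg_const)

lemma avg_commute: "avg W w g (avg W w g' F) = avg W w g' (avg W w g F)"
proof (cases "g = g'")
  case False
  show ?thesis
  proof
    fix \<omega>
    have "(\<Sum>v\<in>W. \<Sum>u\<in>W. w v * (w u * F (\<omega>(g := v, g' := u)))) = (\<Sum>u\<in>W. \<Sum>v\<in>W. w v * (w u * F (\<omega>(g := v, g' := u))))"
      by (rule sum.swap)
    also have "\<dots> = (\<Sum>u\<in>W. \<Sum>v\<in>W. w u * (w v * F (\<omega>(g' := u, g := v))))"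
      by (intro sum.cong refl) (simp only: fun_upd_twist[OF False] mult.left_commute)
    finally show "avg W w g (avg W w g' F) \<omega> = avg W w g' (avg W w g F) \<omega>"
      unfolding avg_def by (simp only: sum_distrib_left)
  qed
qed simp

lemma noise1_linear:
  "noise1 W w r g (\<lambda>\<omega>. a * F \<omega> + b * H \<omega>) = (\<lambda>\<omega>. a * noise1 W w r g F \<omega> + b * noise1 W w r g H \<omega>)"
  unfolding noise1_def avg_linear by (simp add: algebra_simps)

lemma noise1_commute: "noise1 W w r g (noise1 W w s g' F) = noise1 W w s g' (noise1 W w r g F)"
proof -
  have "noise1 W w r g (noise1 W w s g' F) =
    (\<lambda>\<omega>. r * (s * F \<omega> + (1 - s) * avg W w g' F \<omega>) + (1 - r) * (s * avg W w g F \<omega> + (1 - s) * avg W w g (avg W w g' F) \<omega>))"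
    for r s g g' unfolding noise1_def avg_linear by simp
  then show ?thesis by (simp add: avg_commute[of g g'] algebra_simps)
qed

lemma noise1_noise1: "noise1 W w r g (noise1 W w s g F) = noise1 W w (r * s) g F"
  unfolding noise1_def avg_linear avg_avg by (simp add: algebra_simps)

lemma noise1_0: "noise1 W w 0 g F = avg W w g F"
  by (simp add: noise1_def)

sublocale noise: comp_fun_commute "noise1 W w r" for r
  by unfold_locales (auto simp: noise1_commute)

lemma noise_empty [simp]: "noise W w r {} F = F"
  by (simp add: noise_def)

lemma noise_insert:
  assumes "finite G" "g \<notin> G"
  shows "noise W w r (insert g G) F = noise1 W w r g (noise W w r G F)"
  unfolding noise_def using assms by simp

lemma noise_noise1: "finite G \<Longrightarrow> noise W w r G (noise1 W w s g F) = noise1 W w s g (noise W w r G F)"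
  by (induction G rule: finite_induct) (simp_all add: noise_insert noise1_commute)

lemma noise_insert':
  assumes "finite G" "g \<notin> G"
  shows "noise W w r (insert g G) F = noise W w r G (noise1 W w r g F)"
  using assms by (simp add: noise_insert noise_noise1)

lemma noise_linear:
  "finite G \<Longrightarrow> noise W w r G (\<lambda>\<omega>. a * F \<omega> + b * H \<omega>) = (\<lambda>\<omega>. a * noise W w r G F \<omega> + b * noise W w r G H \<omega>)"
  by (induction G rule: finite_induct) (simp_all add: noise_insert noise1_linear)

lemma noise_const: "finite G \<Longrightarrow> noise W w r G (\<lambda>_. c) = (\<lambda>_. c)"
  by (induction G rule: finite_induct) (simp_all add: noise_insert noise1_def avg_const algebra_simps)

lemma noise_commute:
  "finite G \<Longrightarrow> finite G' \<Longrightarrow> noise W w r G (noise W w s G' F) = noise W w s G' (noise W w r G F)"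
  by (induction G rule: finite_induct) (simp_all add: noise_insert noise_noise1)

lemma noise_noise: "finite G \<Longrightarrow> noise W w r G (noise W w s G F) = noise W w (r * s) G F"
  by (induction G rule: finite_induct) (simp_all add: noise_insert noise_noise1 noise1_noise1 mult.commute)

lemma noise_Un:
  "finite G \<Longrightarrow> finite G' \<Longrightarrow> G \<inter> G' = {} \<Longrightarrow> noise W w r (G \<union> G') F = noise W w r G (noise W w r G' F)"
  by (induction G rule: finite_induct) (simp_all add: noise_insert)

lemma noise_mult_indep:
  assumes "finite G" "\<And>\<omega> g v. g \<in> G \<Longrightarrow> c (\<omega>(g := v)) = c \<omega>"
  shows "noise W w r G (\<lambda>\<omega>. c \<omega> * F \<omega>) = (\<lambda>\<omega>. c \<omega> * noise W w r G F \<omega>)"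
  using assms
proof (induction G rule: finite_induct)
  case (insert g G)
  then have "noise W w r (insert g G) (\<lambda>\<omega>. c \<omega> * F \<omega>) = noise1 W w r g (\<lambda>\<omega>. c \<omega> * noise W w r G F \<omega>)"
    by (simp add: noise_insert)
  also have "\<dots> = (\<lambda>\<omega>. c \<omega> * noise1 W w r g (noise W w r G F) \<omega>)"
    unfolding noise1_def using avg_mult_indep[of c g "noise W w r G F"] insert.prems
    by (simp add: algebra_simps)
  finally show ?case using insert by (simp add: noise_insert)
qed simp

lemma noise_indep:
  assumes "finite G" "\<And>\<omega> g v. g \<in> G \<Longrightarrow> c (\<omega>(g := v)) = c \<omega>"
  shows "noise W w r G c = c"
  using noise_mult_indep[where F = "\<lambda>_. 1", OF assms] by (simp add: noise_const assms(1))

lemma noise_upd: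
  assumes "finite G" "g \<notin> G"
  shows "noise W w r G F (\<omega>(g := v)) = noise W w r G (\<lambda>\<omega>. F (\<omega>(g := v))) \<omega>"
  using assms
proof (induction G arbitrary: \<omega> rule: finite_induct)
  case (insert g' G)
  define F' where "F' = (\<lambda>\<omega>. F (\<omega>(g := v)))"
  have "\<omega>(g := v, g' := u) = \<omega>(g' := u, g := v)" for u
    using insert.prems by (intro fun_upd_twist) auto
  moreover have "noise W w r G F (\<omega>(g := v)) = noise W w r G F' \<omega>" for \<omega>
    unfolding F'_def using insert.IH insert.prems by blast
  ultimately have "noise W w r (insert g' G) F (\<omega>(g := v)) = noise W w r (insert g' G) F' \<omega>"
    by (simp only: noise_insert[OF insert(1,2)] noise1_def avg_def)
  then show ?case unfolding F'_def .
qed simp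

text \<open>Composition multiplies the rates and \<open>0 * s = 0\<close>, so an expectation over
  \<open>G\<close> does not see noise applied inside \<open>G\<close>.\<close>

lemma noise_absorb:
  assumes "finite G" "G' \<subseteq> G"
  shows "noise W w 0 G (noise W w s G' F) = noise W w 0 G F"
proof -
  have fin: "finite G'" using assms finite_subset by blast
  moreover have "(G - G') \<union> G' = G" using assms by auto
  ultimately have *: "noise W w 0 G H = noise W w 0 (G - G') (noise W w 0 G' H)" for H
    using noise_Un[of "G - G'" G' 0 H] assms by (simp add: Int_commute)
  show ?thesis
    unfolding *[of "noise W w s G' F"] *[of F] using fin by (simp add: noise_noise)
qed

lemma noise_prod:
  assumes "finite G"
  shows "noise W w 0 G (\<lambda>\<omega>. \<Prod>g\<in>G. \<phi> g (\<omega> g)) \<omega> = (\<Prod>g\<in>G. \<Sum>v\<in>W. w v * (\<phi> g v :: real))"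
  using assms
proof (induction G arbitrary: \<omega> rule: finite_induct)
  case (insert g G)
  have "noise W w 0 (insert g G) (\<lambda>\<omega>. \<Prod>g\<in>insert g G. \<phi> g (\<omega> g)) \<omega> =
     noise1 W w 0 g (noise W w 0 G (\<lambda>\<omega>. \<phi> g (\<omega> g) * (\<Prod>g\<in>G. \<phi> g (\<omega> g)))) \<omega>"
    using insert by (simp add: noise_insert)
  also have "noise W w 0 G (\<lambda>\<omega>. \<phi> g (\<omega> g) * (\<Prod>g\<in>G. \<phi> g (\<omega> g))) =
     (\<lambda>\<omega>. \<phi> g (\<omega> g) * (\<Prod>g\<in>G. \<Sum>v\<in>W. w v * \<phi> g v))"
    using insert by (subst noise_mult_indep) auto
  also have "noise1 W w 0 g \<dots> \<omega> = (\<Prod>g\<in>insert g G. \<Sum>v\<in>W. w v * \<phi> g v)"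
    using insert(1,2) by (simp add: noise1_0 avg_def sum_distrib_right algebra_simps)
  finally show ?case .
qed simp

lemma ex_linear:
  assumes "finite G"
  shows "noise W w 0 G (\<lambda>\<omega>. F \<omega> + H \<omega>) \<omega> = noise W w 0 G F \<omega> + noise W w 0 G H \<omega>"
    "noise W w 0 G (\<lambda>\<omega>. F \<omega> - H \<omega>) \<omega> = noise W w 0 G F \<omega> - noise W w 0 G H \<omega>"
    "noise W w 0 G (\<lambda>\<omega>. a * F \<omega>) \<omega> = a * noise W w 0 G F \<omega>"
  using noise_linear[OF assms, of 0 1 F 1 H] noise_linear[OF assms, of 0 1 F "-1" H]
    noise_linear[OF assms, of 0 a F 0 H] by simp_all

lemma ex_sum:
  assumes "finite G"
  shows "noise W w 0 G (\<lambda>\<omega>. \<Sum>a\<in>S. F a \<omega>) \<omega> = (\<Sum>a\<in>S. noise W w 0 G (F a) \<omega>)"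
proof (cases "finite S")
  case True
  then show ?thesis
    by (induction S rule: finite_induct) (simp_all add: noise_const assms ex_linear(1))
next
  case False
  then show ?thesis by (simp add: noise_const assms)
qed

end

section \<open>Nonnegative weights: Cauchy-Schwarz, self-adjointness and energy\<close>

locale fin_weights = signed_weights W w for W :: "'w set" and w :: "'w \<Rightarrow> real" +
  assumes finite_W: "finite W" and w_nonneg: "\<And>v. v \<in> W \<Longrightarrow> 0 \<le> w v"
begin

lemma avg_mono:
  assumes "\<And>v. v \<in> W \<Longrightarrow> F (\<omega>(g := v)) \<le> H (\<omega>(g := v))"
  shows "avg W w g F \<omega> \<le> avg W w g H \<omega>"
  unfolding avg_def by (intro sum_mono mult_left_mono assms w_nonneg) auto

lemma noise_mono:
  assumes "finite G" "0 \<le> r" "r \<le> 1" "\<And>\<omega>. F \<omega> \<le> H \<omega>"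
  shows "noise W w r G F \<omega> \<le> noise W w r G H \<omega>"
  using assms
proof (induction G arbitrary: \<omega> rule: finite_induct)
  case (insert g G)
  then show ?case
    by (simp add: noise_insert noise1_def) (intro add_mono mult_left_mono avg_mono; auto)
qed simp

lemma ex_mono: "finite G \<Longrightarrow> (\<And>\<omega>. F \<omega> \<le> H \<omega>) \<Longrightarrow> noise W w 0 G F \<omega> \<le> noise W w 0 G H \<omega>"
  by (rule noise_mono) auto

lemma ex_nonneg: "finite G \<Longrightarrow> (\<And>\<omega>. 0 \<le> F \<omega>) \<Longrightarrow> 0 \<le> noise W w 0 G F \<omega>"
  using ex_mono[of G "\<lambda>_. 0" F] by (simp add: noise_const)

lemma ex_cauchy_schwarz:
  assumes G: "finite G"
  shows "(noise W w 0 G (\<lambda>\<omega>. F \<omega> * H \<omega>) \<omega>)\<^sup>2 \<le> noise W w 0 G (\<lambda>\<omega>. (F \<omega>)\<^sup>2) \<omega> * noise W w 0 G (\<lambda>\<omega>. (H \<omega>)\<^sup>2) \<omega>"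
proof -
  let ?L = "\<lambda>F. noise W w 0 G F \<omega>"
  define x y c where xyc: "x = ?L (\<lambda>\<omega>. (F \<omega>)\<^sup>2)" "y = ?L (\<lambda>\<omega>. (H \<omega>)\<^sup>2)" "c = ?L (\<lambda>\<omega>. F \<omega> * H \<omega>)"
  have nonneg: "0 \<le> y - 2 * s * c + s\<^sup>2 * x" for s
  proof -
    have "0 \<le> ?L (\<lambda>\<omega>. (H \<omega> - s * F \<omega>)\<^sup>2)" by (rule ex_nonneg[OF G]) simp
    also have "(\<lambda>\<omega>. (H \<omega> - s * F \<omega>)\<^sup>2) = (\<lambda>\<omega>. ((H \<omega>)\<^sup>2 - (2 * s) * (F \<omega> * H \<omega>)) + s\<^sup>2 * (F \<omega>)\<^sup>2)"
      by (simp add: power2_eq_square algebra_simps)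
    finally show ?thesis by (simp add: ex_linear G xyc)
  qed
  have x0: "0 \<le> x" unfolding xyc by (rule ex_nonneg[OF G]) simp
  have "c\<^sup>2 \<le> x * y"
  proof (cases "x = 0")
    case True
    have "c = 0"
    proof (rule ccontr)
      assume "c \<noteq> 0"
      \<comment> \<open>For \<open>x = 0\<close> this choice of \<open>s\<close> turns the
        right-hand side of \<open>nonneg\<close> into -1.\<close>
      with nonneg[of "(y + 1) / (2 * c)"] True show False by simp
    qed
    then show ?thesis using True by simp
  next
    case False
    have "0 \<le> x * (y - 2 * (c / x) * c + (c / x)\<^sup>2 * x)"
      by (rule mult_nonneg_nonneg[OF x0 nonneg])
    also have "\<dots> = x * y - c\<^sup>2" using False by (simp add: field_simps power2_eq_square)
    finally show ?thesis by simp
  qed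
  then show ?thesis by (simp add: xyc)
qed

lemma ex_self_adjoint1:
  assumes "finite G" "g \<in> G"
  shows "noise W w 0 G (\<lambda>\<omega>. F \<omega> * noise1 W w s g H \<omega>) = noise W w 0 G (\<lambda>\<omega>. noise1 W w s g F \<omega> * H \<omega>)"
proof -
  have *: "noise W w 0 G (\<lambda>\<omega>. F \<omega> * avg W w g H \<omega>) = noise W w 0 G (\<lambda>\<omega>. avg W w g F \<omega> * avg W w g H \<omega>)" for F H
  proof -
    have "noise W w 0 G (\<lambda>\<omega>. F \<omega> * avg W w g H \<omega>) = noise W w 0 G (avg W w g (\<lambda>\<omega>. avg W w g H \<omega> * F \<omega>))"
      using noise_absorb[OF assms(1), of "{g}" 0] assms(2)
      by (simp add: noise_insert noise1_0 mult.commute)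
    also have "avg W w g (\<lambda>\<omega>. avg W w g H \<omega> * F \<omega>) = (\<lambda>\<omega>. avg W w g H \<omega> * avg W w g F \<omega>)"
      by (rule avg_mult_indep) (rule avg_upd)
    finally show ?thesis by (simp add: mult.commute)
  qed
  have "(\<lambda>\<omega>. F \<omega> * noise1 W w s g H \<omega>) = (\<lambda>\<omega>. s * (F \<omega> * H \<omega>) + (1 - s) * (F \<omega> * avg W w g H \<omega>))"
    "(\<lambda>\<omega>. noise1 W w s g F \<omega> * H \<omega>) = (\<lambda>\<omega>. s * (F \<omega> * H \<omega>) + (1 - s) * (H \<omega> * avg W w g F \<omega>))"
    by (simp_all add: noise1_def algebra_simps)
  then show ?thesis using *[of F H] *[of H F] by (simp add: noise_linear assms(1) mult.commute)
qed

lemma ex_self_adjoint: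
  assumes "finite G" "G' \<subseteq> G"
  shows "noise W w 0 G (\<lambda>\<omega>. F \<omega> * noise W w s G' H \<omega>) = noise W w 0 G (\<lambda>\<omega>. noise W w s G' F \<omega> * H \<omega>)"
proof -
  have "finite G'" using assms finite_subset by blast
  then show ?thesis using assms(2)
  proof (induction G' arbitrary: F H rule: finite_induct)
    case (insert g G')
    then show ?case by (simp add: noise_insert ex_self_adjoint1 assms(1)) (simp flip: noise_noise1)
  qed simp
qed

definition deviation :: "'g \<Rightarrow> (('g \<Rightarrow> 'w) \<Rightarrow> real) \<Rightarrow> ('g \<Rightarrow> 'w) \<Rightarrow> real" where
  "deviation g F = (\<lambda>\<omega>. F \<omega> - avg W w g F \<omega>)"

lemma noise_deviation:
  assumes "finite G"
  shows "noise W w r G (deviation g F) = deviation g (noise W w r G F)"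
proof -
  have *: "deviation g F = (\<lambda>\<omega>. 1 * F \<omega> + (-1) * noise1 W w 0 g F \<omega>)" for F
    by (simp add: deviation_def noise1_0)
  show ?thesis unfolding * using assms by (simp only: noise_linear noise_noise1)
qed

text \<open>Pythagoras: \<open>avg W w g F\<close> and \<open>deviation g F\<close> are orthogonal,
  and \<open>noise1\<close> keeps the former while multiplying the latter by
  \<open>s\<close>.\<close>

lemma noise1_energy:
  assumes "finite G" "g \<in> G"
  shows "noise W w 0 G (\<lambda>\<omega>. (F \<omega>)\<^sup>2) \<omega> - noise W w 0 G (\<lambda>\<omega>. (noise1 W w s g F \<omega>)\<^sup>2) \<omega>
    = (1 - s\<^sup>2) * noise W w 0 G (\<lambda>\<omega>. (deviation g F \<omega>)\<^sup>2) \<omega>"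
proof -
  let ?A = "avg W w g F" and ?D = "deviation g F" and ?L = "\<lambda>F. noise W w 0 G F \<omega>"
  have "noise1 W w 0 g ?D = (\<lambda>_. 0)"
    using noise1_linear[of 0 g 1 F "-1" ?A] by (simp add: noise1_0 deviation_def avg_avg)
  then have orth: "?L (\<lambda>\<omega>. ?A \<omega> * ?D \<omega>) = 0"
    using ex_self_adjoint1[OF assms, of ?D 0 F] by (simp add: noise1_0 noise_const assms mult.commute)
  have *: "?L (\<lambda>\<omega>. (?A \<omega> + c * ?D \<omega>)\<^sup>2) = ?L (\<lambda>\<omega>. (?A \<omega>)\<^sup>2) + c\<^sup>2 * ?L (\<lambda>\<omega>. (?D \<omega>)\<^sup>2)" for c
  proof -
    have "(\<lambda>\<omega>. (?A \<omega> + c * ?D \<omega>)\<^sup>2) = (\<lambda>\<omega>. ((?A \<omega>)\<^sup>2 + (2 * c) * (?A \<omega> * ?D \<omega>)) + c\<^sup>2 * (?D \<omega>)\<^sup>2)"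
      by (simp add: power2_eq_square algebra_simps)
    then show ?thesis using orth by (simp add: ex_linear assms(1))
  qed
  have "F = (\<lambda>\<omega>. ?A \<omega> + 1 * ?D \<omega>)" "noise1 W w s g F = (\<lambda>\<omega>. ?A \<omega> + s * ?D \<omega>)"
    by (simp_all add: deviation_def noise1_def algebra_simps)
  then have "?L (\<lambda>\<omega>. (F \<omega>)\<^sup>2) = ?L (\<lambda>\<omega>. (?A \<omega> + 1 * ?D \<omega>)\<^sup>2)"
    "?L (\<lambda>\<omega>. (noise1 W w s g F \<omega>)\<^sup>2) = ?L (\<lambda>\<omega>. (?A \<omega> + s * ?D \<omega>)\<^sup>2)" by metis+
  then show ?thesis unfolding * by (simp add: algebra_simps)
qed

lemma noise1_contraction:
  assumes "finite G" "g \<in> G" "0 \<le> s" "s \<le> 1"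
  shows "noise W w 0 G (\<lambda>\<omega>. (noise1 W w s g F \<omega>)\<^sup>2) \<omega> \<le> noise W w 0 G (\<lambda>\<omega>. (F \<omega>)\<^sup>2) \<omega>"
proof -
  have "0 \<le> (1 - s\<^sup>2) * noise W w 0 G (\<lambda>\<omega>. (deviation g F \<omega>)\<^sup>2) \<omega>"
    using assms by (intro mult_nonneg_nonneg ex_nonneg) (auto simp: power_le_one)
  then show ?thesis using noise1_energy[OF assms(1,2), of F \<omega> s] by linarith
qed

text \<open>Noise is applied one coordinate at a time and the losses from
  \<open>noise1_energy\<close> add up. Each loss is bounded by the original deviation because
  deviations commute with noise and noise contracts. The case \<open>s = 0\<close> is the
  Efron-Stein inequality.\<close>

lemma noise_energy:
  assumes "finite G" "G' \<subseteq> G" "0 \<le> s" "s \<le> 1"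
  shows "noise W w 0 G (\<lambda>\<omega>. (F \<omega>)\<^sup>2) \<omega> - noise W w 0 G (\<lambda>\<omega>. (noise W w s G' F \<omega>)\<^sup>2) \<omega>
    \<le> (1 - s\<^sup>2) * (\<Sum>g\<in>G'. noise W w 0 G (\<lambda>\<omega>. (deviation g F \<omega>)\<^sup>2) \<omega>)"
proof -
  let ?L = "\<lambda>F. noise W w 0 G F \<omega>"
  have "finite G'" using assms finite_subset by blast
  then show ?thesis using assms(2)
  proof (induction G' arbitrary: F rule: finite_induct)
    case (insert g G')
    let ?F = "noise1 W w s g F"
    have s: "0 \<le> 1 - s\<^sup>2" using assms by (simp add: power_le_one)
    have "?L (\<lambda>\<omega>. (?F \<omega>)\<^sup>2) - ?L (\<lambda>\<omega>. (noise W w s G' ?F \<omega>)\<^sup>2) \<le> (1 - s\<^sup>2) * (\<Sum>g'\<in>G'. ?L (\<lambda>\<omega>. (deviation g' ?F \<omega>)\<^sup>2))"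
      using insert by blast
    also have "\<dots> \<le> (1 - s\<^sup>2) * (\<Sum>g'\<in>G'. ?L (\<lambda>\<omega>. (deviation g' F \<omega>)\<^sup>2))"
    proof (intro mult_left_mono[OF _ s] sum_mono)
      fix g'
      have "deviation g' ?F = noise1 W w s g (deviation g' F)"
        using noise_deviation[of "{g}" s g' F] by (simp add: noise_insert)
      then show "?L (\<lambda>\<omega>. (deviation g' ?F \<omega>)\<^sup>2) \<le> ?L (\<lambda>\<omega>. (deviation g' F \<omega>)\<^sup>2)"
        using noise1_contraction[of G g s "deviation g' F"] insert.prems assms by simp
    qed
    finally have "?L (\<lambda>\<omega>. (?F \<omega>)\<^sup>2) - ?L (\<lambda>\<omega>. (noise W w s G' ?F \<omega>)\<^sup>2) \<le> (1 - s\<^sup>2) * (\<Sum>g'\<in>G'. ?L (\<lambda>\<omega>. (deviation g' F \<omega>)\<^sup>2))" .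
    moreover have "?L (\<lambda>\<omega>. (F \<omega>)\<^sup>2) - ?L (\<lambda>\<omega>. (?F \<omega>)\<^sup>2) = (1 - s\<^sup>2) * ?L (\<lambda>\<omega>. (deviation g F \<omega>)\<^sup>2)"
      using noise1_energy[OF assms(1)] insert.prems by simp
    ultimately show ?case using insert(1,2) by (simp add: noise_insert' algebra_simps)
  qed simp
qed

text \<open>Being self-adjoint and idempotent, the expectation over \<open>G'\<close> is an
  orthogonal projection.\<close>

lemma noise_residual_energy:
  assumes "finite G" "G' \<subseteq> G"
  shows "noise W w 0 G (\<lambda>\<omega>. (F \<omega> - noise W w 0 G' F \<omega>)\<^sup>2) \<omega>
    = noise W w 0 G (\<lambda>\<omega>. (F \<omega>)\<^sup>2) \<omega> - noise W w 0 G (\<lambda>\<omega>. (noise W w 0 G' F \<omega>)\<^sup>2) \<omega>"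
proof -
  let ?A = "noise W w 0 G' F" and ?L = "\<lambda>F. noise W w 0 G F \<omega>"
  have fin: "finite G'" using assms finite_subset by blast
  have "(\<lambda>\<omega>. (F \<omega> - ?A \<omega>)\<^sup>2) = (\<lambda>\<omega>. ((F \<omega>)\<^sup>2 - 2 * (F \<omega> * ?A \<omega>)) + (?A \<omega>)\<^sup>2)"
    by (simp add: power2_eq_square algebra_simps)
  moreover have "?L (\<lambda>\<omega>. F \<omega> * ?A \<omega>) = ?L (\<lambda>\<omega>. (?A \<omega>)\<^sup>2)"
    using ex_self_adjoint[OF assms, of F 0 ?A] fin by (simp add: noise_noise power2_eq_square)
  ultimately show ?thesis by (simp add: ex_linear assms(1))
qed

end

subsection \<open>Hypercontractivity and small influences\<close>

context fin_weights
begin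

text \<open>Hypercontractivity from L2 to L4 on one coordinate, with a crude constant: atoms of mass
  at least \<open>lam\<close> bound the fourth moment of the centred function by
  \<open>V\<^sup>2 / lam\<close>, and \<open>r\<^sup>2 \<le> lam / 4\<close> pays for this
  factor.\<close>

lemma four_moment:
  assumes lam: "\<And>v. v \<in> W \<Longrightarrow> lam \<le> w v" "0 < lam" and r: "0 \<le> r" "r\<^sup>2 \<le> lam / 4"
  shows "(\<Sum>v\<in>W. w v * (r * F v + (1 - r) * (\<Sum>v\<in>W. w v * F v)) ^ 4) \<le> (\<Sum>v\<in>W. w v * (F v)\<^sup>2)\<^sup>2"
proof -
  define a where "a = (\<Sum>v\<in>W. w v * F v)"
  define d where "d v = F v - a" for v
  define V where "V = (\<Sum>v\<in>W. w v * (d v)\<^sup>2)"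
  obtain v0 where v0: "v0 \<in> W" using sum_w by (metis sum.empty zero_neq_one ex_in_conv)
  have "w v0 \<le> sum w W" using v0 finite_W w_nonneg by (intro member_le_sum) auto
  then have lam1: "lam \<le> 1" using lam(1)[OF v0] sum_w by simp
  have d0: "(\<Sum>v\<in>W. w v * d v) = 0"
    unfolding d_def by (simp add: algebra_simps sum_subtractf flip: sum_distrib_left) (simp add: a_def sum_w mult.commute)
  have sq: "(\<Sum>v\<in>W. w v * (F v)\<^sup>2) = a\<^sup>2 + V"
  proof -
    have "(\<Sum>v\<in>W. w v * (F v)\<^sup>2) = (\<Sum>v\<in>W. a\<^sup>2 * w v + 2 * a * (w v * d v) + w v * (d v)\<^sup>2)"
      by (intro sum.cong) (simp_all add: d_def power2_eq_square algebra_simps)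
    then show ?thesis by (simp add: sum.distrib V_def d0 sum_w flip: sum_distrib_left)
  qed
  have V0: "0 \<le> V" unfolding V_def by (intro sum_nonneg mult_nonneg_nonneg w_nonneg) auto
  have d_le: "lam * (d v)\<^sup>2 \<le> V" if "v \<in> W" for v
  proof -
    have "lam * (d v)\<^sup>2 \<le> w v * (d v)\<^sup>2" using lam(1) that by (intro mult_right_mono) auto
    also have "\<dots> \<le> V" unfolding V_def using that finite_W w_nonneg
      by (intro member_le_sum) auto
    finally show ?thesis .
  qed
  have fourth: "lam * (\<Sum>v\<in>W. w v * (d v) ^ 4) \<le> V\<^sup>2"
  proof -
    have "lam * (\<Sum>v\<in>W. w v * (d v) ^ 4) = (\<Sum>v\<in>W. (w v * (d v)\<^sup>2) * (lam * (d v)\<^sup>2))"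
      unfolding sum_distrib_left by (intro sum.cong) (simp_all add: power2_eq_square power4_eq_xxxx)
    also have "\<dots> \<le> (\<Sum>v\<in>W. (w v * (d v)\<^sup>2) * V)"
      using d_le w_nonneg by (intro sum_mono mult_left_mono) auto
    also have "\<dots> = V\<^sup>2" by (simp add: V_def power2_eq_square flip: sum_distrib_right)
    finally show ?thesis .
  qed
  \<comment> \<open>Adding this square trades the cubic term, whose sign is unknown, for quadratic
    and quartic ones.\<close>
  have pt: "(a + r * x) ^ 4 \<le> a ^ 4 + 4 * a ^ 3 * r * x + 8 * a\<^sup>2 * r\<^sup>2 * x\<^sup>2 + 3 * r ^ 4 * x ^ 4" for x
  proof -
    have "0 \<le> 2 * (r * x)\<^sup>2 * (a - r * x)\<^sup>2" by simp
    also have "\<dots> = a ^ 4 + 4 * a ^ 3 * r * x + 8 * a\<^sup>2 * r\<^sup>2 * x\<^sup>2 + 3 * r ^ 4 * x ^ 4 - (a + r * x) ^ 4"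
      by (simp add: power2_eq_square power3_eq_cube power4_eq_xxxx algebra_simps)
    finally show ?thesis by simp
  qed
  have "(\<Sum>v\<in>W. w v * (r * F v + (1 - r) * a) ^ 4) = (\<Sum>v\<in>W. w v * (a + r * d v) ^ 4)"
    by (simp add: d_def algebra_simps)
  also have "\<dots> \<le> (\<Sum>v\<in>W. w v * (a ^ 4 + 4 * a ^ 3 * r * d v + 8 * a\<^sup>2 * r\<^sup>2 * (d v)\<^sup>2 + 3 * r ^ 4 * (d v) ^ 4))"
    by (intro sum_mono mult_left_mono pt w_nonneg)
  also have "\<dots> = (\<Sum>v\<in>W. a ^ 4 * w v + (4 * a ^ 3 * r) * (w v * d v) + (8 * a\<^sup>2 * r\<^sup>2) * (w v * (d v)\<^sup>2) + (3 * r ^ 4) * (w v * (d v) ^ 4))"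
    by (simp add: algebra_simps)
  also have "\<dots> = a ^ 4 * sum w W + (4 * a ^ 3 * r) * (\<Sum>v\<in>W. w v * d v) + (8 * a\<^sup>2 * r\<^sup>2) * V + (3 * r ^ 4) * (\<Sum>v\<in>W. w v * (d v) ^ 4)"
    by (simp only: sum.distrib sum_distrib_left V_def)
  also have "\<dots> \<le> a ^ 4 + 2 * a\<^sup>2 * V + V\<^sup>2"
  proof -
    have "(8 * r\<^sup>2) * (a\<^sup>2 * V) \<le> 2 * (a\<^sup>2 * V)"
      using r(2) lam1 V0 by (intro mult_right_mono) auto
    moreover have "(3 * r ^ 4) * (\<Sum>v\<in>W. w v * (d v) ^ 4) \<le> V\<^sup>2"
    proof -
      have "r ^ 4 = r\<^sup>2 * r\<^sup>2" by (simp add: power2_eq_square power4_eq_xxxx)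
      also have "\<dots> \<le> (lam / 4) * (1 / 4)" using r lam lam1 by (intro mult_mono) auto
      finally have "3 * r ^ 4 \<le> lam" using lam by simp
      then have "(3 * r ^ 4) * (\<Sum>v\<in>W. w v * (d v) ^ 4) \<le> lam * (\<Sum>v\<in>W. w v * (d v) ^ 4)"
        by (intro mult_right_mono sum_nonneg mult_nonneg_nonneg w_nonneg) auto
      then show ?thesis using fourth by linarith
    qed
    ultimately show ?thesis unfolding d0 sum_w by (simp add: algebra_simps)
  qed
  also have "\<dots> = (a\<^sup>2 + V)\<^sup>2" by (simp add: power2_eq_square power4_eq_xxxx algebra_simps)
  finally show ?thesis unfolding sq a_def .
qed

text \<open>After \<open>four_moment\<close> at \<open>g\<close>, the bound is a double sum over
  slices \<open>u\<close>, \<open>v\<close> in the remaining coordinates. Cauchy-Schwarz separates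
  the two slices, and the induction hypothesis applies to each.\<close>

lemma hypercontractive:
  assumes lam: "\<And>v. v \<in> W \<Longrightarrow> lam \<le> w v" "0 < lam" and r: "0 \<le> r" "r\<^sup>2 \<le> lam / 4" and "finite G"
  shows "noise W w 0 G (\<lambda>\<omega>. (noise W w r G F \<omega>) ^ 4) \<omega> \<le> (noise W w 0 G (\<lambda>\<omega>. (F \<omega>)\<^sup>2) \<omega>)\<^sup>2"
  using \<open>finite G\<close>
proof (induction G arbitrary: F \<omega> rule: finite_induct)
  case (insert g G)
  note G = insert(1,2)
  let ?L = "\<lambda>F. noise W w 0 G F \<omega>" and ?H = "noise W w r G F"
  define Hv where "Hv v = (\<lambda>\<omega>. ?H (\<omega>(g := v)))" for v
  define Fv where "Fv v = (\<lambda>\<omega>. F (\<omega>(g := v)))" for v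
  have Hv: "Hv v = noise W w r G (Fv v)" for v
    unfolding Hv_def Fv_def using noise_upd[OF G] by blast
  have Fv0: "0 \<le> ?L (\<lambda>\<omega>. (Fv v \<omega>)\<^sup>2)" for v by (rule ex_nonneg[OF G(1)]) simp
  have cs: "?L (\<lambda>\<omega>. (Hv u \<omega>)\<^sup>2 * (Hv v \<omega>)\<^sup>2) \<le> ?L (\<lambda>\<omega>. (Fv u \<omega>)\<^sup>2) * ?L (\<lambda>\<omega>. (Fv v \<omega>)\<^sup>2)" for u v
  proof (rule power2_le_imp_le)
    have "(?L (\<lambda>\<omega>. (Hv u \<omega>)\<^sup>2 * (Hv v \<omega>)\<^sup>2))\<^sup>2 \<le> ?L (\<lambda>\<omega>. ((Hv u \<omega>)\<^sup>2)\<^sup>2) * ?L (\<lambda>\<omega>. ((Hv v \<omega>)\<^sup>2)\<^sup>2)"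
      by (rule ex_cauchy_schwarz[OF G(1)])
    also have "\<dots> = ?L (\<lambda>\<omega>. (Hv u \<omega>) ^ 4) * ?L (\<lambda>\<omega>. (Hv v \<omega>) ^ 4)"
      by (simp flip: power_mult)
    also have "\<dots> \<le> (?L (\<lambda>\<omega>. (Fv u \<omega>)\<^sup>2))\<^sup>2 * (?L (\<lambda>\<omega>. (Fv v \<omega>)\<^sup>2))\<^sup>2"
      unfolding Hv by (intro mult_mono insert.IH ex_nonneg G) auto
    finally show "(?L (\<lambda>\<omega>. (Hv u \<omega>)\<^sup>2 * (Hv v \<omega>)\<^sup>2))\<^sup>2 \<le> (?L (\<lambda>\<omega>. (Fv u \<omega>)\<^sup>2) * ?L (\<lambda>\<omega>. (Fv v \<omega>)\<^sup>2))\<^sup>2"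
      by (simp add: power_mult_distrib)
  qed (intro mult_nonneg_nonneg Fv0)
  have "noise W w 0 (insert g G) (\<lambda>\<omega>. (noise W w r (insert g G) F \<omega>) ^ 4) \<omega>
      = ?L (avg W w g (\<lambda>\<omega>. (noise1 W w r g ?H \<omega>) ^ 4))"
    using G by (simp add: noise_insert'[of G g 0] noise_insert[of G g r] noise1_0)
  also have "\<dots> \<le> ?L (\<lambda>\<omega>. (\<Sum>v\<in>W. w v * (Hv v \<omega>)\<^sup>2)\<^sup>2)"
  proof (rule ex_mono[OF G(1)])
    fix \<omega>
    show "avg W w g (\<lambda>\<omega>. (noise1 W w r g ?H \<omega>) ^ 4) \<omega> \<le> (\<Sum>v\<in>W. w v * (Hv v \<omega>)\<^sup>2)\<^sup>2"
      using four_moment[OF lam r, of "\<lambda>v. Hv v \<omega>"] by (simp add: avg_def noise1_def Hv_def)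
  qed
  also have "(\<lambda>\<omega>. (\<Sum>v\<in>W. w v * (Hv v \<omega>)\<^sup>2)\<^sup>2) = (\<lambda>\<omega>. \<Sum>u\<in>W. \<Sum>v\<in>W. (w u * w v) * ((Hv u \<omega>)\<^sup>2 * (Hv v \<omega>)\<^sup>2))"
    by (simp add: power2_eq_square[of "sum _ _"] sum_product mult.assoc mult.left_commute)
  also have "?L \<dots> = (\<Sum>u\<in>W. \<Sum>v\<in>W. (w u * w v) * ?L (\<lambda>\<omega>. (Hv u \<omega>)\<^sup>2 * (Hv v \<omega>)\<^sup>2))"
    by (simp only: ex_sum[OF G(1)] ex_linear(3)[OF G(1)])
  also have "\<dots> \<le> (\<Sum>u\<in>W. \<Sum>v\<in>W. (w u * w v) * (?L (\<lambda>\<omega>. (Fv u \<omega>)\<^sup>2) * ?L (\<lambda>\<omega>. (Fv v \<omega>)\<^sup>2)))"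
    by (intro sum_mono mult_left_mono cs mult_nonneg_nonneg w_nonneg)
  also have "\<dots> = (\<Sum>v\<in>W. w v * ?L (\<lambda>\<omega>. (Fv v \<omega>)\<^sup>2))\<^sup>2"
    by (simp add: power2_eq_square[of "sum _ _"] sum_product mult.assoc mult.left_commute)
  also have "(\<Sum>v\<in>W. w v * ?L (\<lambda>\<omega>. (Fv v \<omega>)\<^sup>2)) = ?L (avg W w g (\<lambda>\<omega>. (F \<omega>)\<^sup>2))"
    unfolding avg_def Fv_def by (simp only: ex_sum[OF G(1)] ex_linear(3)[OF G(1)])
  also have "\<dots> = noise W w 0 (insert g G) (\<lambda>\<omega>. (F \<omega>)\<^sup>2) \<omega>"
    using G by (simp add: noise_insert' noise1_0)
  finally show ?case .
qed (simp flip: power_mult)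

text \<open>Its expectation is the influence of \<open>g\<close>. It is an indicator that dominates
  \<open>deviation\<close>, which is the form in which \<open>noise_deviation_small\<close> takes
  its bound \<open>B\<close>.\<close>

definition pivotal :: "(('g \<Rightarrow> 'w) \<Rightarrow> real) \<Rightarrow> 'g \<Rightarrow> ('g \<Rightarrow> 'w) \<Rightarrow> real" where
  "pivotal f g = (\<lambda>\<omega>. if \<exists>v\<in>W. f (\<omega>(g := v)) \<noteq> f \<omega> then 1 else 0)"

lemma deviation_le_pivotal:
  assumes "\<And>\<omega>. f \<omega> \<in> {0, 1}"
  shows "\<bar>deviation g f \<omega>\<bar> \<le> pivotal f g \<omega>"
proof (cases "\<exists>v\<in>W. f (\<omega>(g := v)) \<noteq> f \<omega>")
  case True
  have f01: "0 \<le> f \<omega>" "f \<omega> \<le> 1" for \<omega> using assms[of \<omega>] by auto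
  have "avg W w g f \<omega> \<le> avg W w g (\<lambda>_. 1) \<omega>" "avg W w g (\<lambda>_. 0) \<omega> \<le> avg W w g f \<omega>"
    by (rule avg_mono, simp add: f01)+
  then show ?thesis using True f01[of \<omega>] by (simp add: avg_const deviation_def pivotal_def)
next
  case False
  then have "avg W w g f \<omega> = (\<Sum>v\<in>W. w v * f \<omega>)" unfolding avg_def by (intro sum.cong) auto
  then show ?thesis using False by (simp add: deviation_def pivotal_def sum_w flip: sum_distrib_right)
qed

text \<open>The dual form of hypercontractivity, from L(4/3) to L2. Self-adjointness writes the
  energy as the pairing of \<open>u\<close> with \<open>z\<close>; two applications of
  Cauchy-Schwarz against the indicator \<open>B\<close> leave the fourth moment of \<open>z\<close>,
  which \<open>hypercontractive\<close> bounds by the energy again.\<close>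

lemma noise_deviation_small:
  assumes lam: "\<And>v. v \<in> W \<Longrightarrow> lam \<le> w v" "0 < lam" and r: "0 \<le> r" "r\<^sup>2 \<le> lam / 4" and G: "finite G"
    and u: "\<And>\<omega>. \<bar>u \<omega>\<bar> \<le> B \<omega>" and B: "\<And>\<omega>. B \<omega> \<in> {0, 1 :: real}"
  shows "(noise W w 0 G (\<lambda>\<omega>. (noise W w r G u \<omega>)\<^sup>2) \<omega>)\<^sup>2 \<le> (noise W w 0 G B \<omega>) ^ 3"
proof -
  let ?L = "\<lambda>F. noise W w 0 G F \<omega>" and ?T = "noise W w r G"
  define N where "N = ?L (\<lambda>\<omega>. (?T u \<omega>)\<^sup>2)"
  define p where "p = ?L B"
  define z where "z = ?T (?T u)"
  have B0: "0 \<le> B \<omega>" and BB: "(B \<omega>)\<^sup>2 = B \<omega>" for \<omega> using B[of \<omega>] by auto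
  have N0: "0 \<le> N" unfolding N_def by (rule ex_nonneg[OF G]) simp
  have p0: "0 \<le> p" unfolding p_def by (rule ex_nonneg[OF G B0])
  have "N = ?L (\<lambda>\<omega>. u \<omega> * z \<omega>)"
    using ex_self_adjoint[OF G subset_refl, of u r "?T u"] by (simp add: N_def z_def power2_eq_square)
  also have "\<dots> \<le> ?L (\<lambda>\<omega>. B \<omega> * \<bar>z \<omega>\<bar>)"
  proof (rule ex_mono[OF G])
    fix \<omega>
    have "u \<omega> * z \<omega> \<le> \<bar>u \<omega>\<bar> * \<bar>z \<omega>\<bar>" by (metis abs_ge_self abs_mult)
    also have "\<dots> \<le> B \<omega> * \<bar>z \<omega>\<bar>" by (intro mult_right_mono u) auto
    finally show "u \<omega> * z \<omega> \<le> B \<omega> * \<bar>z \<omega>\<bar>" .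
  qed
  finally have "N\<^sup>2 \<le> (?L (\<lambda>\<omega>. B \<omega> * \<bar>z \<omega>\<bar>))\<^sup>2" using N0 by (intro power_mono)
  also have "(\<lambda>\<omega>. B \<omega> * \<bar>z \<omega>\<bar>) = (\<lambda>\<omega>. B \<omega> * (B \<omega> * \<bar>z \<omega>\<bar>))"
    using BB by (metis mult.assoc power2_eq_square)
  also have "(?L \<dots>)\<^sup>2 \<le> ?L (\<lambda>\<omega>. (B \<omega>)\<^sup>2) * ?L (\<lambda>\<omega>. (B \<omega> * \<bar>z \<omega>\<bar>)\<^sup>2)"
    by (rule ex_cauchy_schwarz[OF G])
  also have "\<dots> = p * ?L (\<lambda>\<omega>. B \<omega> * (z \<omega>)\<^sup>2)" by (simp add: BB p_def power_mult_distrib)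
  finally have 1: "N\<^sup>2 \<le> p * ?L (\<lambda>\<omega>. B \<omega> * (z \<omega>)\<^sup>2)" .
  have "(?L (\<lambda>\<omega>. B \<omega> * (z \<omega>)\<^sup>2))\<^sup>2 \<le> ?L (\<lambda>\<omega>. (B \<omega>)\<^sup>2) * ?L (\<lambda>\<omega>. ((z \<omega>)\<^sup>2)\<^sup>2)"
    by (rule ex_cauchy_schwarz[OF G])
  also have "\<dots> = p * ?L (\<lambda>\<omega>. (z \<omega>) ^ 4)" by (simp add: BB p_def flip: power_mult)
  also have "\<dots> \<le> p * N\<^sup>2" unfolding z_def N_def
    by (intro mult_left_mono p0 hypercontractive[OF lam r G])
  finally have 2: "(?L (\<lambda>\<omega>. B \<omega> * (z \<omega>)\<^sup>2))\<^sup>2 \<le> p * N\<^sup>2" .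
  have "(N\<^sup>2)\<^sup>2 \<le> (p * ?L (\<lambda>\<omega>. B \<omega> * (z \<omega>)\<^sup>2))\<^sup>2" using 1 by (intro power_mono) auto
  also have "\<dots> \<le> p\<^sup>2 * (p * N\<^sup>2)" using 2 by (simp add: power_mult_distrib mult_left_mono)
  finally have *: "N\<^sup>2 * N\<^sup>2 \<le> p ^ 3 * N\<^sup>2" by (simp add: power2_eq_square power3_eq_cube algebra_simps)
  have "N\<^sup>2 \<le> p ^ 3"
  proof (cases "N = 0")
    case False
    then have "0 < N\<^sup>2" by simp
    then show ?thesis using * mult_le_cancel_right_pos by blast
  qed (use p0 in simp)
  then show ?thesis by (simp add: N_def p_def)
qed

text \<open>
  The squared norms of \<open>T\<^sup>j h\<close>, where \<open>T\<close> is the noise operator and \<open>h\<close> the part of \<open>f\<close> that depends on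
  \<open>G'\<close>, are log-convex in \<open>j\<close>. Bounded total influence prevents a large first drop, hence fast decay,
  whereas small influences on \<open>G'\<close> force the \<open>n\<close>-th one to be small by hypercontractivity.
\<close>

lemma friedgut:
  assumes lam: "\<And>v. v \<in> W \<Longrightarrow> lam \<le> w v" "0 < lam"
    and r: "0 \<le> r" "r \<le> 1" "(r ^ n)\<^sup>2 \<le> lam / 4"
    and G: "finite G" "G' \<subseteq> G" and f: "\<And>\<omega>. f \<omega> \<in> {0, 1}"
    and tau: "0 \<le> \<tau>" and infl: "\<And>g. g \<in> G' \<Longrightarrow> noise W w 0 G (pivotal f g) \<omega> \<le> \<tau>"
    and total: "(\<Sum>g\<in>G. noise W w 0 G (pivotal f g) \<omega>) \<le> C"
    and eps: "0 < \<epsilon>" "(1 - r\<^sup>2) * C \<le> \<epsilon> / 2"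
    and V: "\<epsilon> \<le> noise W w 0 G (\<lambda>\<omega>. (f \<omega> - noise W w 0 G' f \<omega>)\<^sup>2) \<omega>"
  shows "\<epsilon> / 2 ^ n \<le> sqrt \<tau> * C"
proof -
  let ?L = "\<lambda>F. noise W w 0 G F \<omega>"
  have G': "finite G'" using G finite_subset by blast
  define h where "h = (\<lambda>\<omega>. f \<omega> - noise W w 0 G' f \<omega>)"
  define a where "a j = ?L (\<lambda>\<omega>. (noise W w (r ^ j) G h \<omega>)\<^sup>2)" for j
  have p0: "0 \<le> ?L (pivotal f g)" for g by (rule ex_nonneg[OF G(1)]) (simp add: pivotal_def)
  have piv01: "pivotal f g \<omega> \<in> {0, 1}" for g \<omega> by (simp add: pivotal_def)
  have dev: "?L (\<lambda>\<omega>. (deviation g f \<omega>)\<^sup>2) \<le> ?L (pivotal f g)" for g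
  proof (rule ex_mono[OF G(1)])
    fix \<omega>
    have "\<bar>deviation g f \<omega>\<bar>\<^sup>2 \<le> (pivotal f g \<omega>)\<^sup>2"
      using deviation_le_pivotal[where \<omega> = \<omega> and g = g, OF f] by (intro power_mono) auto
    then show "(deviation g f \<omega>)\<^sup>2 \<le> pivotal f g \<omega>" using piv01[of g \<omega>] by auto
  qed
  have a0: "a 0 = ?L (\<lambda>\<omega>. (h \<omega>)\<^sup>2)"
  proof -
    have "noise W w 1 G h = h" using G(1)
      by (induction G rule: finite_induct) (simp_all add: noise_insert noise1_def)
    then show ?thesis by (simp add: a_def)
  qed
  have a0_ge: "\<epsilon> \<le> a 0" using V by (simp add: a0 h_def)
  have a_nonneg: "0 \<le> a j" for j unfolding a_def by (rule ex_nonneg[OF G(1)]) simp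
  have hdev: "?L (\<lambda>\<omega>. (deviation g h \<omega>)\<^sup>2) \<le> ?L (\<lambda>\<omega>. (deviation g f \<omega>)\<^sup>2)" for g
  proof -
    have "deviation g h = (\<lambda>\<omega>. deviation g f \<omega> - noise W w 0 G' (deviation g f) \<omega>)"
      unfolding noise_deviation[OF G'] using avg_linear[of g 1 f "-1" "noise W w 0 G' f"]
      by (simp add: deviation_def h_def algebra_simps)
    then have "?L (\<lambda>\<omega>. (deviation g h \<omega>)\<^sup>2) = ?L (\<lambda>\<omega>. (deviation g f \<omega>)\<^sup>2) - ?L (\<lambda>\<omega>. (noise W w 0 G' (deviation g f) \<omega>)\<^sup>2)"
      by (simp add: noise_residual_energy[OF G])
    moreover have "0 \<le> ?L (\<lambda>\<omega>. (noise W w 0 G' (deviation g f) \<omega>)\<^sup>2)" by (rule ex_nonneg[OF G(1)]) simp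
    ultimately show ?thesis by linarith
  qed
  have "a 0 - a 1 \<le> (1 - r\<^sup>2) * (\<Sum>g\<in>G. ?L (\<lambda>\<omega>. (deviation g h \<omega>)\<^sup>2))"
    using noise_energy[OF G(1) subset_refl r(1,2), of h \<omega>] by (simp add: a0) (simp add: a_def)
  also have "\<dots> \<le> (1 - r\<^sup>2) * C"
    using hdev dev total r by (intro mult_left_mono order.trans[OF sum_mono total])
      (auto intro: order.trans simp: power_le_one)
  finally have a1: "a 0 / 2 \<le> a 1" using eps(2) a0_ge by linarith
  have logconvex: "(a (Suc j))\<^sup>2 \<le> a j * a (Suc (Suc j))" for j
  proof -
    have "a (Suc j) = ?L (\<lambda>\<omega>. noise W w (r ^ j) G h \<omega> * noise W w (r ^ Suc (Suc j)) G h \<omega>)"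
    proof -
      have T: "noise W w (r ^ Suc j) G h = noise W w r G (noise W w (r ^ j) G h)" for j
        using G(1) by (simp add: noise_noise)
      show ?thesis
        unfolding a_def power2_eq_square
        by (subst T[of "Suc j"], subst ex_self_adjoint[OF G(1) subset_refl], simp only: T)
    qed
    then show ?thesis unfolding a_def using ex_cauchy_schwarz[OF G(1)] by simp
  qed
  have a_pos: "0 < a j \<and> a j / 2 \<le> a (Suc j)" for j
  proof (induction j)
    case 0
    then show ?case using a1 a0_ge eps(1) by simp
  next
    case (Suc j)
    then have pos: "0 < a (Suc j)" by linarith
    have "(a j / 2) * a (Suc j) \<le> (a (Suc j))\<^sup>2"
      using Suc pos by (simp add: power2_eq_square mult_right_mono)
    also have "\<dots> \<le> a j * a (Suc (Suc j))" by (rule logconvex)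
    finally have "a j * (a (Suc j) / 2) \<le> a j * a (Suc (Suc j))" by simp
    then show ?case using Suc pos by (metis mult_le_cancel_left_pos)
  qed
  have "a 0 / 2 ^ j \<le> a j" for j
  proof (induction j)
    case (Suc j)
    have "a 0 / 2 ^ Suc j = (a 0 / 2 ^ j) / 2" by simp
    also have "\<dots> \<le> a j / 2" using Suc by (intro divide_right_mono) auto
    also have "\<dots> \<le> a (Suc j)" using a_pos by blast
    finally show ?case .
  qed simp
  moreover have "\<epsilon> / 2 ^ n \<le> a 0 / 2 ^ n" using a0_ge by (intro divide_right_mono) auto
  ultimately have "\<epsilon> / 2 ^ n \<le> a n" by (meson order.trans)
  \<comment> \<open>Efron-Stein over \<open>G'\<close>: the mean of \<open>h\<close> over
    \<open>G'\<close> vanishes and stays zero under noise, so the energy is bounded by deviations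
    along \<open>G'\<close> alone.\<close>
  also have "a n \<le> (\<Sum>g\<in>G'. ?L (\<lambda>\<omega>. (deviation g (noise W w (r ^ n) G h) \<omega>)\<^sup>2))"
  proof -
    have "noise W w 0 G' h = (\<lambda>_. 0)"
      unfolding h_def using noise_linear[OF G', of 0 1 f "-1" "noise W w 0 G' f"] G' by (simp add: noise_noise)
    then have "noise W w 0 G' (noise W w (r ^ n) G h) = (\<lambda>_. 0)"
      using G G' by (simp add: noise_commute[of G' G] noise_const)
    then show ?thesis using noise_energy[OF G, of 0 "noise W w (r ^ n) G h" \<omega>] G
      by (simp add: a_def noise_const)
  qed
  also have "\<dots> \<le> (\<Sum>g\<in>G'. sqrt \<tau> * ?L (pivotal f g))"
  proof (rule sum_mono)
    fix g assume g: "g \<in> G'"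
    let ?p = "?L (pivotal f g)"
    have "deviation g (noise W w 0 G' f) = (\<lambda>_. 0)"
    proof -
      have "noise W w 0 G' f = noise1 W w 0 g (noise W w 0 (G' - {g}) f)"
        using noise_insert[of "G' - {g}" g 0 f] g G' by (simp add: insert_absorb)
      then show ?thesis by (simp add: deviation_def noise1_0 avg_avg)
    qed
    moreover have "deviation g h = (\<lambda>\<omega>. deviation g f \<omega> - deviation g (noise W w 0 G' f) \<omega>)"
      using avg_linear[of g 1 f "-1" "noise W w 0 G' f"] by (simp add: deviation_def h_def algebra_simps)
    ultimately have "deviation g h = deviation g f" by simp
    then have eq: "deviation g (noise W w (r ^ n) G h) = noise W w (r ^ n) G (deviation g f)"
      using noise_deviation[OF G(1)] by metis
    have "(?L (\<lambda>\<omega>. (noise W w (r ^ n) G (deviation g f) \<omega>)\<^sup>2))\<^sup>2 \<le> ?p ^ 3"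
      using r by (intro noise_deviation_small[OF lam _ _ G(1) deviation_le_pivotal[OF f] piv01]) auto
    also have "\<dots> = ?p * ?p\<^sup>2" by (simp add: power2_eq_square power3_eq_cube)
    also have "\<dots> \<le> \<tau> * ?p\<^sup>2" using infl[OF g] by (intro mult_right_mono) auto
    also have "\<dots> = (sqrt \<tau> * ?p)\<^sup>2" using tau by (simp add: power_mult_distrib)
    finally have "?L (\<lambda>\<omega>. (noise W w (r ^ n) G (deviation g f) \<omega>)\<^sup>2) \<le> sqrt \<tau> * ?p"
      using p0 tau by (meson mult_nonneg_nonneg power2_le_imp_le real_sqrt_ge_zero)
    then show "?L (\<lambda>\<omega>. (deviation g (noise W w (r ^ n) G h) \<omega>)\<^sup>2) \<le> sqrt \<tau> * ?p"
      unfolding eq .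
  qed
  also have "\<dots> = sqrt \<tau> * (\<Sum>g\<in>G'. ?L (pivotal f g))" by (simp add: sum_distrib_left)
  also have "\<dots> \<le> sqrt \<tau> * C"
    using sum_mono2[OF G(1,2), of "\<lambda>g. ?L (pivotal f g)"] p0 total tau
    by (intro mult_left_mono) (force, simp)
  finally show ?thesis .
qed

end

subsection \<open>Differentiating the expectation in the bias\<close>

definition cW :: "nat \<Rightarrow> (nat \<times> bool) set" where
  "cW D = {..<D} \<times> UNIV"

text \<open>The law of a uniform offset below \<open>D\<close> and an independent bit of bias
  \<open>t\<close>; only the bit feels the parameter.\<close>

definition cw :: "nat \<Rightarrow> real \<Rightarrow> nat \<times> bool \<Rightarrow> real" where
  "cw D t v = (if snd v then t else 1 - t) / real D"

definition slope :: "nat \<Rightarrow> 'g \<Rightarrow> (('g \<Rightarrow> nat \<times> bool) \<Rightarrow> real) \<Rightarrow> ('g \<Rightarrow> nat \<times> bool) \<Rightarrow> real" where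
  "slope D g F = (\<lambda>\<omega>. \<Sum>z<D. (F (\<omega>(g := (z, True))) - F (\<omega>(g := (z, False)))) / real D)"

definition face :: "nat \<Rightarrow> bool \<Rightarrow> 'g \<Rightarrow> (('g \<Rightarrow> nat \<times> bool) \<Rightarrow> real) \<Rightarrow> ('g \<Rightarrow> nat \<times> bool) \<Rightarrow> real" where
  "face D b g F = (\<lambda>\<omega>. \<Sum>z<D. F (\<omega>(g := (z, b))) / real D)"

lemma sum_cW: "(\<Sum>v\<in>cW D. h v) = (\<Sum>z<D. h (z, False) + h (z, True))"
proof -
  have "(\<Sum>v\<in>cW D. h v) = (\<Sum>z<D. \<Sum>b\<in>UNIV. h (z, b))"
    unfolding cW_def by (simp only: sum.cartesian_product case_prod_eta)
  then show ?thesis by (simp add: UNIV_bool)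
qed

lemma signed_weights_cw: "0 < D \<Longrightarrow> signed_weights (cW D) (cw D t)"
  by unfold_locales (simp add: sum_cW cw_def flip: add_divide_distrib)

lemma fin_weights_cw: "0 < D \<Longrightarrow> 0 \<le> t \<Longrightarrow> t \<le> 1 \<Longrightarrow> fin_weights (cW D) (cw D t)"
  using signed_weights_cw[of D t] unfolding fin_weights_def fin_weights_axioms_def
  by (simp add: cW_def cw_def)

lemma avg_cw: "avg (cW D) (cw D t) g F = (\<lambda>\<omega>. (1 - t) * face D False g F \<omega> + t * face D True g F \<omega>)"
  unfolding avg_def face_def sum_cW by (simp add: cw_def sum.distrib sum_distrib_left)

lemma slope_face: "slope D g F = (\<lambda>\<omega>. 1 * face D True g F \<omega> + (-1) * face D False g F \<omega>)"
  unfolding slope_def face_def by (simp add: diff_divide_distrib sum_subtractf)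

lemma face_slope:
  assumes "g \<noteq> g'"
  shows "face D b g (slope D g' F) = slope D g' (face D b g F)"
proof
  fix \<omega>
  have "(\<Sum>z<D. \<Sum>y<D. (F (\<omega>(g := (z, b), g' := (y, True))) - F (\<omega>(g := (z, b), g' := (y, False)))) / D / D)
     = (\<Sum>y<D. \<Sum>z<D. (F (\<omega>(g' := (y, True), g := (z, b))) - F (\<omega>(g' := (y, False), g := (z, b)))) / D / D)"
    by (subst sum.swap) (simp only: fun_upd_twist[OF assms])
  then show "face D b g (slope D g' F) \<omega> = slope D g' (face D b g F) \<omega>"
    unfolding face_def slope_def by (simp only: sum_divide_distrib sum_subtractf diff_divide_distrib)
qed

definition mean :: "nat \<Rightarrow> real \<Rightarrow> 'g set \<Rightarrow> (('g \<Rightarrow> nat \<times> bool) \<Rightarrow> real) \<Rightarrow> ('g \<Rightarrow> nat \<times> bool) \<Rightarrow> real" where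
  "mean D t = noise (cW D) (cw D t) 0"

text \<open>Russo's formula. The mean over one coordinate is affine in \<open>t\<close> with
  coefficient \<open>slope\<close>; the induction is the product rule, and \<open>face_slope\<close>
  moves the slopes of the other coordinates past the average over \<open>g\<close>.\<close>

lemma has_derivative_expectation:
  assumes D: "0 < D" and "finite G"
  shows "((\<lambda>t. mean D t G F \<omega>) has_real_derivative
    (\<Sum>g\<in>G. mean D t G (slope D g F) \<omega>)) (at t)"
  using \<open>finite G\<close>
proof (induction G arbitrary: F rule: finite_induct)
  case empty
  interpret signed_weights "cW D" "cw D u" for u by (rule signed_weights_cw[OF D])
  show ?case by (simp add: mean_def)
next
  case (insert g G)
  interpret signed_weights "cW D" "cw D u" for u by (rule signed_weights_cw[OF D])
  let ?N = "\<lambda>t F. mean D t G F \<omega>"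
  have N: "mean D t (insert g G) H \<omega> = (1 - t) * ?N t (face D False g H) + t * ?N t (face D True g H)" for t H
    using insert(1,2) by (simp add: mean_def noise_insert' noise1_0 avg_cw noise_linear)
  have "((\<lambda>t. (1 - t) * ?N t (face D False g F) + t * ?N t (face D True g F)) has_real_derivative
    (1 - t) * (\<Sum>g'\<in>G. ?N t (slope D g' (face D False g F))) + (0 - 1) * ?N t (face D False g F)
     + (t * (\<Sum>g'\<in>G. ?N t (slope D g' (face D True g F))) + 1 * ?N t (face D True g F))) (at t)"
    by (intro DERIV_add DERIV_mult' DERIV_diff DERIV_ident DERIV_const insert.IH)
  moreover have "(1 - t) * (\<Sum>g'\<in>G. ?N t (slope D g' (face D False g F))) + (0 - 1) * ?N t (face D False g F)
     + (t * (\<Sum>g'\<in>G. ?N t (slope D g' (face D True g F))) + 1 * ?N t (face D True g F)) = (\<Sum>g'\<in>insert g G. mean D t (insert g G) (slope D g' F) \<omega>)"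
  proof -
    have "(\<Sum>g'\<in>G. mean D t (insert g G) (slope D g' F) \<omega>)
      = (\<Sum>g'\<in>G. (1 - t) * ?N t (slope D g' (face D False g F)) + t * ?N t (slope D g' (face D True g F)))"
      unfolding N using insert(2) by (intro sum.cong refl) (subst (1 2) face_slope, auto)
    moreover have "mean D t (insert g G) (slope D g F) \<omega> = ?N t (face D True g F) - ?N t (face D False g F)"
    proof -
      have "face D b g (slope D g F) = slope D g F" for b
        unfolding face_def slope_def using D by simp
      then have "mean D t (insert g G) (slope D g F) \<omega> = ?N t (slope D g F)"
        unfolding N by (simp add: algebra_simps)
      then show ?thesis unfolding slope_face mean_def noise_linear[OF insert(1)] by simp
    qed
    ultimately show ?thesis using insert(1,2) by (simp add: sum.distrib sum_distrib_left)
  qed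
  ultimately show ?case unfolding N by simp
qed

text \<open>
  The derivative in the bias only sees the second component of a variable; the hypothesis \<open>conn\<close>
  makes it control the influence of the whole variable.
\<close>

lemma pivotal_le_slope:
  fixes f :: "('g \<Rightarrow> nat \<times> bool) \<Rightarrow> real"
  assumes D: "0 < D" and t: "0 \<le> t" "t \<le> 1" and G: "finite G" "g \<in> G"
    and f: "\<And>\<omega>. f \<omega> \<in> {0, 1}"
    and mono: "\<And>\<omega> z. f (\<omega>(g := (z, False))) \<le> f (\<omega>(g := (z, True)))"
    and conn: "\<And>\<omega> u v. (\<forall>z<D. f (\<omega>(g := (z, True))) = f (\<omega>(g := (z, False)))) \<Longrightarrow> u \<in> cW D \<Longrightarrow> v \<in> cW D
       \<Longrightarrow> f (\<omega>(g := u)) = f (\<omega>(g := v))"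
  shows "noise (cW D) (cw D t) 0 G (fin_weights.pivotal (cW D) f g) \<omega>
    \<le> real D * noise (cW D) (cw D t) 0 G (slope D g f) \<omega>"
proof -
  interpret fin_weights "cW D" "cw D t" by (rule fin_weights_cw[OF D t])
  have "noise (cW D) (cw D t) 0 G (pivotal f g) \<omega> = noise (cW D) (cw D t) 0 G (avg (cW D) (cw D t) g (pivotal f g)) \<omega>"
    using noise_absorb[OF G(1), of "{g}" 0 "pivotal f g"] G(2) by (simp add: noise_insert noise1_0)
  also have "\<dots> \<le> noise (cW D) (cw D t) 0 G (\<lambda>\<omega>. real D * slope D g f \<omega>) \<omega>"
  proof (rule ex_mono[OF G(1)])
    fix \<omega>
    have S: "real D * slope D g f \<omega> = (\<Sum>z<D. f (\<omega>(g := (z, True))) - f (\<omega>(g := (z, False))))"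
      unfolding slope_def using D by (simp flip: sum_divide_distrib)
    show "avg (cW D) (cw D t) g (pivotal f g) \<omega> \<le> real D * slope D g f \<omega>"
    proof (cases "\<forall>z<D. f (\<omega>(g := (z, True))) = f (\<omega>(g := (z, False)))")
      case True
      have "avg (cW D) (cw D t) g (pivotal f g) \<omega> \<le> avg (cW D) (cw D t) g (\<lambda>_. 0) \<omega>"
      proof (rule avg_mono)
        fix v assume v: "v \<in> cW D"
        have "f (\<omega>(g := v, g := u)) = f (\<omega>(g := v))" if "u \<in> cW D" for u
          unfolding fun_upd_upd by (rule conn[OF True that v])
        then have "(\<exists>u\<in>cW D. f (\<omega>(g := v, g := u)) \<noteq> f (\<omega>(g := v))) = False" by blast
        then show "pivotal f g (\<omega>(g := v)) \<le> 0" unfolding pivotal_def by (simp only: if_False order.refl)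
      qed
      then show ?thesis using True by (simp add: avg_const S)
    next
      case False
      then obtain z where z: "z < D" "f (\<omega>(g := (z, True))) \<noteq> f (\<omega>(g := (z, False)))" by blast
      have "avg (cW D) (cw D t) g (pivotal f g) \<omega> \<le> avg (cW D) (cw D t) g (\<lambda>_. 1) \<omega>"
        by (rule avg_mono) (simp add: pivotal_def)
      also have "\<dots> = 1" by (simp add: avg_const)
      also have "1 = f (\<omega>(g := (z, True))) - f (\<omega>(g := (z, False)))"
        using z(2) mono[of \<omega> z] f[of "\<omega>(g := (z, True))"] f[of "\<omega>(g := (z, False))"] by auto
      also have "\<dots> \<le> (\<Sum>z<D. f (\<omega>(g := (z, True))) - f (\<omega>(g := (z, False))))"
        using z(1) mono by (intro member_le_sum) auto
      finally show ?thesis unfolding S .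
    qed
  qed
  also have "\<dots> = real D * noise (cW D) (cw D t) 0 G (slope D g f) \<omega>"
    by (rule ex_linear(3)[OF G(1)])
  finally show ?thesis .
qed

text \<open>Let \<open>A\<close> be the mean of \<open>f\<close> given the coordinates in
  \<open>J\<close>. As \<open>f\<close> is 0-1 valued, the variance that remains after fixing
  \<open>J\<close> is the expectation of \<open>A * (1 - A)\<close>. Since \<open>c \<le> A\<close>
  everywhere, a remaining variance below \<open>c * \<delta>\<close> forces the mean of
  \<open>f\<close> above \<open>1 - \<delta>\<close>. The bound \<open>r\<close> depends on
  \<open>D\<close>, \<open>c\<close> and \<delta> only.\<close>

lemma sharp_threshold:
  fixes c \<delta> :: real
  assumes D: "0 < D" and c: "0 < c" and \<delta>: "0 < \<delta>"
  shows "\<exists>r. \<forall>(G :: 'g set) f \<omega>. finite G \<longrightarrow> (\<forall>\<omega>. f \<omega> \<in> {0, 1}) \<longrightarrow>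
    (\<forall>g\<in>G. \<forall>\<omega> z. f (\<omega>(g := (z, False))) \<le> f (\<omega>(g := (z, True)))) \<longrightarrow>
    (\<forall>g\<in>G. \<forall>\<omega>. (\<forall>z<D. f (\<omega>(g := (z, True))) = f (\<omega>(g := (z, False)))) \<longrightarrow>
       (\<forall>u\<in>cW D. \<forall>v\<in>cW D. f (\<omega>(g := u)) = f (\<omega>(g := v)))) \<longrightarrow>
    (\<forall>J\<subseteq>G. card J \<le> r \<longrightarrow> (\<forall>t. 0 \<le> t \<longrightarrow> t \<le> 1 \<longrightarrow> (\<forall>\<omega>. c \<le> noise (cW D) (cw D t) 0 (G - J) f \<omega>))) \<longrightarrow>
    1 - \<delta> \<le> noise (cW D) (cw D (1 / 2)) 0 G f \<omega>"
proof -
  \<comment> \<open>\<open>C\<close> bounds the total influence: a function with values in the unit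
    interval has derivative at most 4 somewhere on an interval of length 1/4, and
    \<open>pivotal_le_slope\<close> costs a factor \<open>D\<close>. On the interval from 1/4 to 1/2
    both values of the bit have probability at least 1/4, which gives \<open>lam\<close>.\<close>
  define C where "C = 4 * real D"
  define \<epsilon> where "\<epsilon> = c * \<delta>"
  define x where "x = min 1 (\<epsilon> / (4 * C))"
  define q where "q = 1 - x"
  define lam where "lam = 1 / (4 * real D)"
  have C: "0 < C" using D by (simp add: C_def)
  have \<epsilon>: "0 < \<epsilon>" using c \<delta> by (simp add: \<epsilon>_def)
  have x: "0 < x" "x \<le> 1" "x \<le> \<epsilon> / (4 * C)" using C \<epsilon> by (auto simp: x_def)
  have q: "0 \<le> q" "q < 1" using x by (auto simp: q_def)
  have qC: "(1 - q\<^sup>2) * C \<le> \<epsilon> / 2"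
  proof -
    have "1 - q\<^sup>2 \<le> 2 * x" by (simp add: q_def power2_eq_square algebra_simps)
    then have "(1 - q\<^sup>2) * C \<le> 2 * (\<epsilon> / (4 * C)) * C" using x C by (intro mult_right_mono) auto
    then show ?thesis using C by simp
  qed
  have lam: "0 < lam" using D by (simp add: lam_def)
  obtain n where n: "q ^ n < min 1 (lam / 4)"
    using real_arch_pow_inv[of "min 1 (lam / 4)" q] q lam by auto
  have qn: "(q ^ n)\<^sup>2 \<le> lam / 4"
  proof -
    have "q ^ n * q ^ n \<le> q ^ n * 1" using n q by (intro mult_left_mono) auto
    then show ?thesis using n by (simp add: power2_eq_square)
  qed
  \<comment> \<open>Makes \<open>sqrt \<tau> * C\<close> equal to half of
    \<open>\<epsilon> / 2 ^ n\<close>, against the conclusion of \<open>friedgut\<close>.\<close>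
  define \<tau> where "\<tau> = (\<epsilon> / (2 * 2 ^ n * C))\<^sup>2"
  have tau: "0 < \<tau>" using \<epsilon> C by (simp add: \<tau>_def)
  have sqrt_tau: "sqrt \<tau> * C < \<epsilon> / 2 ^ n"
  proof -
    have "sqrt \<tau> = \<epsilon> / (2 * 2 ^ n * C)" using \<epsilon> C by (simp add: \<tau>_def)
    then have "sqrt \<tau> * C = (\<epsilon> / 2 ^ n) / 2" using C by simp
    moreover have "y / 2 < y" if "0 < y" for y :: real using that by simp
    from this[of "\<epsilon> / 2 ^ n"] have "\<epsilon> / 2 ^ n / 2 < \<epsilon> / 2 ^ n" using \<epsilon> by simp
    ultimately show ?thesis by (simp only:)
  qed
  \<comment> \<open>By Markov's inequality at most \<open>C / \<tau>\<close> coordinates have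
    influence above \<tau>.\<close>
  define r where "r = nat \<lceil>C / \<tau>\<rceil>"
  show ?thesis
  proof (intro exI[of _ r] allI impI)
    fix G :: "'g set" and f :: "('g \<Rightarrow> nat \<times> bool) \<Rightarrow> real" and \<omega>
    assume G: "finite G" and f: "\<forall>\<omega>. f \<omega> \<in> {0, 1}"
      and mono: "\<forall>g\<in>G. \<forall>\<omega> z. f (\<omega>(g := (z, False))) \<le> f (\<omega>(g := (z, True)))"
      and conn: "\<forall>g\<in>G. \<forall>\<omega>. (\<forall>z<D. f (\<omega>(g := (z, True))) = f (\<omega>(g := (z, False)))) \<longrightarrow>
         (\<forall>u\<in>cW D. \<forall>v\<in>cW D. f (\<omega>(g := u)) = f (\<omega>(g := v)))"
      and cond: "\<forall>J\<subseteq>G. card J \<le> r \<longrightarrow> (\<forall>t. 0 \<le> t \<longrightarrow> t \<le> 1 \<longrightarrow> (\<forall>\<omega>. c \<le> noise (cW D) (cw D t) 0 (G - J) f \<omega>))"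
    let ?\<psi> = "\<lambda>t. noise (cW D) (cw D t) 0 G f \<omega>"
    let ?\<psi>' = "\<lambda>t. \<Sum>g\<in>G. noise (cW D) (cw D t) 0 G (slope D g f) \<omega>"
    have f01: "0 \<le> f \<omega>" "f \<omega> \<le> 1" "(f \<omega>)\<^sup>2 = f \<omega>" for \<omega> using f[rule_format, of \<omega>] by auto
    have deriv: "(?\<psi> has_real_derivative ?\<psi>' t) (at t)" for t
      using has_derivative_expectation[OF D G] unfolding mean_def by blast
    have \<psi>01: "0 \<le> ?\<psi> t" "?\<psi> t \<le> 1" if "0 \<le> t" "t \<le> 1" for t
    proof -
      interpret fin_weights "cW D" "cw D t" by (rule fin_weights_cw[OF D that])
      show "0 \<le> ?\<psi> t" by (rule ex_nonneg[OF G f01(1)])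
      show "?\<psi> t \<le> 1" using ex_mono[OF G f01(2)] by (simp add: noise_const[OF G])
    qed
    obtain t where t: "1 / 4 < t" "t < 1 / 2" "?\<psi> (1 / 2) - ?\<psi> (1 / 4) = (1 / 2 - 1 / 4) * ?\<psi>' t"
      using MVT2[of "1 / 4" "1 / 2" ?\<psi> ?\<psi>'] deriv by auto
    have *: "x \<le> 4" if "b \<le> 1" "0 \<le> a" "b - a = (1 / 2 - 1 / 4) * x" for a b x :: real
      using that by simp
    have \<psi>': "?\<psi>' t \<le> 4" by (rule *[OF _ _ t(3)]) (simp_all add: \<psi>01)
    have t01: "0 \<le> t" "t \<le> 1" using t by auto
    interpret fin_weights "cW D" "cw D t" by (rule fin_weights_cw[OF D t01])
    let ?L = "\<lambda>F. noise (cW D) (cw D t) 0 G F \<omega>"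
    have total: "(\<Sum>g\<in>G. ?L (pivotal f g)) \<le> C"
    proof -
      have "(\<Sum>g\<in>G. ?L (pivotal f g)) \<le> (\<Sum>g\<in>G. real D * ?L (slope D g f))"
        using f mono conn by (intro sum_mono pivotal_le_slope[OF D t01 G]) blast+
      also have "\<dots> = real D * ?\<psi>' t" by (simp add: sum_distrib_left)
      also have "\<dots> \<le> C" using \<psi>' D by (simp add: C_def)
      finally show ?thesis .
    qed
    define J where "J = {g \<in> G. \<tau> < ?L (pivotal f g)}"
    have J: "J \<subseteq> G" by (auto simp: J_def)
    have p0: "0 \<le> ?L (pivotal f g)" for g by (rule ex_nonneg[OF G]) (simp add: pivotal_def)
    have "real (card J) * \<tau> \<le> (\<Sum>g\<in>J. ?L (pivotal f g))"
      using sum_mono[of J "\<lambda>_. \<tau>" "\<lambda>g. ?L (pivotal f g)"] by (auto simp: J_def)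
    also have "\<dots> \<le> (\<Sum>g\<in>G. ?L (pivotal f g))" by (intro sum_mono2 G J p0)
    finally have "real (card J) \<le> C / \<tau>" using total tau by (simp add: pos_le_divide_eq)
    then have "card J \<le> r" by (simp add: r_def) linarith
    then have fbar: "c \<le> noise (cW D) (cw D t) 0 (G - J) f \<omega>" for \<omega> using cond J t01 by blast
    let ?A = "noise (cW D) (cw D t) 0 (G - J) f"
    define V where "V = ?L (\<lambda>\<omega>. (f \<omega> - ?A \<omega>)\<^sup>2)"
    have GJ: "finite (G - J)" "G - J \<subseteq> G" using G by auto
    have "V < \<epsilon>"
    proof (rule ccontr)
      assume "\<not> V < \<epsilon>"
      then have "\<epsilon> / 2 ^ n \<le> sqrt \<tau> * C"
        using q qn lam G GJ f tau total \<epsilon> qC t D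
        by (intro friedgut[of lam q n G "G - J" f \<tau> \<omega> C \<epsilon>])
          (auto simp: J_def V_def lam_def cw_def cW_def field_simps)
      then show False using sqrt_tau by simp
    qed
    \<comment> \<open>Uses \<open>c \<le> ?A \<omega>\<close> for every \<omega>; a bound on the
      mean alone would not relate it to the variance.\<close>
    moreover have "c * (1 - ?L f) \<le> V"
    proof -
      have "c * (1 - ?L f) = ?L (\<lambda>\<omega>. c * (1 - ?A \<omega>))"
        unfolding ex_linear[OF G] noise_const[OF G] noise_absorb[OF G GJ(2)] by simp
      also have "\<dots> \<le> ?L (\<lambda>\<omega>. ?A \<omega> - (?A \<omega>)\<^sup>2)"
      proof (rule ex_mono[OF G])
        fix \<omega>
        have "?A \<omega> \<le> 1" using ex_mono[OF GJ(1) f01(2)] by (simp add: noise_const[OF GJ(1)])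
        then have "c * (1 - ?A \<omega>) \<le> ?A \<omega> * (1 - ?A \<omega>)" using fbar by (intro mult_right_mono) auto
        then show "c * (1 - ?A \<omega>) \<le> ?A \<omega> - (?A \<omega>)\<^sup>2" by (simp add: power2_eq_square algebra_simps)
      qed
      also have "\<dots> = V"
        unfolding V_def noise_residual_energy[OF G GJ(2)] f01(3) ex_linear(2)[OF G] noise_absorb[OF G GJ(2)] by simp
      finally show ?thesis .
    qed
    ultimately have "c * (1 - ?\<psi> t) < c * \<delta>" by (simp add: \<epsilon>_def)
    then have "1 - \<delta> \<le> ?\<psi> t" using c by simp
    \<comment> \<open>The mean value theorem does not say which bias \<open>t\<close> occurs, only
      that it lies below 1/2; monotonicity carries the bound to the fixed bias.\<close>
    also have "?\<psi> t \<le> ?\<psi> (1 / 2)"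
    proof (rule DERIV_nonneg_imp_nondecreasing[of t "1 / 2" ?\<psi>])
      show "t \<le> 1 / 2" using t by simp
      fix u assume u: "t \<le> u" "u \<le> 1 / 2"
      then have u01: "0 \<le> u" "u \<le> 1" using t by auto
      interpret U: fin_weights "cW D" "cw D u" by (rule fin_weights_cw[OF D u01])
      have "0 \<le> ?\<psi>' u"
        using mono by (intro sum_nonneg U.ex_nonneg[OF G]) (auto simp: slope_def intro!: sum_nonneg divide_nonneg_nonneg)
      then show "\<exists>y. (?\<psi> has_real_derivative y) (at u) \<and> 0 \<le> y" using deriv by blast
    qed
    finally show "1 - \<delta> \<le> ?\<psi> (1 / 2)" .
  qed
qed

subsection \<open>Random disjoint subsets of the alphabet\<close>

text \<open>
  For \<open>m \<ge> s\<close> the alphabet \<open>{1..m}\<close> splits into \<open>m div s\<close> groups of sizes in \<open>{s..<2 * s}\<close>, the last one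
  taking the remainder. A variable \<open>(z, u)\<close> opens for the colour with offset \<open>c\<close> the cyclic position
  \<open>z + c\<close> of its group and, if \<open>u\<close> holds, the next one too. So the offsets \<open>2 * j\<close> give disjoint open
  sets, no group is ever entirely closed, and the bias of \<open>u\<close> is the parameter of a monotone family.
\<close>

definition grp :: "nat \<Rightarrow> nat \<Rightarrow> nat \<Rightarrow> nat" where
  "grp m s a = min ((a - 1) div s) (m div s - 1)"

definition pos :: "nat \<Rightarrow> nat \<Rightarrow> nat \<Rightarrow> nat" where
  "pos m s a = a - 1 - s * grp m s a"

definition sz :: "nat \<Rightarrow> nat \<Rightarrow> nat \<Rightarrow> nat" where
  "sz m s g = (if g = m div s - 1 then m - s * g else s)"

definition opn :: "nat \<Rightarrow> nat \<times> bool \<Rightarrow> nat \<Rightarrow> nat \<Rightarrow> bool" where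
  "opn c y S p \<longleftrightarrow> p = (fst y + c) mod S \<or> (snd y \<and> p = (fst y + c + 1) mod S)"

definition open_at :: "nat \<Rightarrow> nat \<Rightarrow> nat \<Rightarrow> nat \<times> bool \<Rightarrow> nat \<Rightarrow> bool" where
  "open_at m s c y a \<longleftrightarrow> opn c y (sz m s (grp m s a)) (pos m s a)"

lemma sz_bounds:
  assumes "0 < s" "s \<le> m" "g < m div s"
  shows "s \<le> sz m s g" "sz m s g < 2 * s"
proof -
  define q where "q = m div s"
  have "s * q + m mod s = m" "m mod s < s" using assms by (simp_all add: q_def)
  moreover have "0 < q" using assms by (simp add: q_def)
  then obtain q' where "q = Suc q'" using gr0_conv_Suc by blast
  ultimately show "s \<le> sz m s g" "sz m s g < 2 * s"
    unfolding sz_def q_def[symmetric] by auto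
qed

lemma grp_less:
  assumes "0 < s" "s \<le> m"
  shows "grp m s a < m div s"
proof -
  have "0 < m div s" using assms by (simp add: div_greater_zero_iff)
  then show ?thesis by (simp add: grp_def)
qed

lemma mult_grp_le: "0 < s \<Longrightarrow> s * grp m s a \<le> a - 1"
proof -
  have "s * grp m s a \<le> s * ((a - 1) div s)" by (simp add: grp_def)
  also have "\<dots> \<le> a - 1" by simp
  finally show ?thesis .
qed

lemma pos_less:
  assumes "0 < s" "s \<le> m" "a \<in> {1..m}"
  shows "pos m s a < sz m s (grp m s a)"
proof (cases "grp m s a = m div s - 1")
  case True
  then show ?thesis using assms mult_grp_le[of s m a] by (auto simp: pos_def sz_def)
next
  case False
  then have "grp m s a = (a - 1) div s" by (auto simp: grp_def min_def split: if_splits)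
  then have "pos m s a = (a - 1) mod s" by (simp add: pos_def minus_mult_div_eq_mod)
  then show ?thesis using assms False by (simp add: sz_def)
qed

lemma inj_grp_pos:
  assumes "0 < s" "a \<in> {1..m}" "b \<in> {1..m}" "grp m s a = grp m s b" "pos m s a = pos m s b"
  shows "a = b"
  using assms mult_grp_le[of s m a] mult_grp_le[of s m b] unfolding pos_def by auto

lemma grp_pos_surj:
  assumes "0 < s" "s \<le> m" "g < m div s" "p < sz m s g"
  shows "\<exists>a\<in>{1..m}. grp m s a = g \<and> pos m s a = p"
proof (intro bexI[of _ "s * g + p + 1"] conjI)
  let ?a = "s * g + p + 1"
  define q where "q = m div s"
  have m: "s * q + m mod s = m" by (simp add: q_def)
  have le: "s * Suc g \<le> s * q" using assms q_def by (intro mult_le_mono) auto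
  show a: "?a \<in> {1..m}"
    using assms(4) le m by (auto simp: sz_def split: if_splits)
  show "grp m s ?a = g"
  proof (cases "g = q - 1")
    case True
    then have "g \<le> (?a - 1) div s" using assms(1) by simp
    then show ?thesis using True by (simp add: grp_def q_def min_def)
  next
    case False
    then have "p < s" using assms(4) by (simp add: sz_def q_def)
    then have "(?a - 1) div s = g" using assms(1) by simp
    then show ?thesis using assms(3) by (simp add: grp_def)
  qed
  then show "pos m s ?a = p" by (simp add: pos_def)
qed

lemma mod_add_left_cancel:
  fixes z u v S :: nat
  assumes "(z + u) mod S = (z + v) mod S" "u < S" "v < S"
  shows "u = v"
proof -
  have "u = v" if "(z + u) mod S = (z + v) mod S" "u < S" "v < S" "u \<le> v" for u v :: nat
  proof -
    have "S dvd (z + v) - (z + u)" using that by (metis add_le_mono1 add.commute mod_eq_dvd_iff_nat)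
    then have "S dvd v - u" by simp
    then show ?thesis using that by (meson diff_is_0_eq dvd_imp_le le_antisym less_imp_diff_less not_le zero_less_diff)
  qed
  from this[of u v] this[of v u] assms show ?thesis by fastforce
qed

lemma opn_disjoint:
  assumes "opn (2 * j) y S p" "opn (2 * j') y S p" "j < h" "j' < h" "2 * h \<le> S"
  shows "j = j'"
proof -
  have *: "\<exists>u\<in>{c, c + 1}. p = (fst y + u) mod S" if "opn c y S p" for c
    using that unfolding opn_def by (metis add.assoc insertCI)
  obtain u where u: "u \<in> {2 * j, 2 * j + 1}" "p = (fst y + u) mod S"
    using *[OF assms(1)] by blast
  obtain v where v: "v \<in> {2 * j', 2 * j' + 1}" "p = (fst y + v) mod S"
    using *[OF assms(2)] by blast
  have "u = v"
    by (rule mod_add_left_cancel[of "fst y" u S v]) (use u v assms in auto)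
  then show ?thesis using u(1) v(1) by auto
qed

text \<open>The variable with index \<open>(i, g)\<close> governs the letters of group
  \<open>g\<close> at coordinate \<open>i\<close>. The indicator is real-valued so that the
  averaging operators apply to it.\<close>

definition hit :: "nat \<Rightarrow> nat \<Rightarrow> nat \<Rightarrow> (nat \<Rightarrow> nat) set \<Rightarrow> nat set \<Rightarrow> (nat \<times> nat \<Rightarrow> nat \<times> bool) \<Rightarrow> real" where
  "hit m s c A I \<omega> = of_bool (\<exists>x\<in>A. \<forall>i\<in>I. open_at m s c (\<omega> (i, grp m s (x i))) (x i))"

lemma hit_mono_upd:
  assumes "\<And>p. opn c y (sz m s (snd g)) p \<Longrightarrow> opn c y' (sz m s (snd g)) p"
  shows "hit m s c A I (\<omega>(g := y)) \<le> hit m s c A I (\<omega>(g := y'))"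
proof -
  have "open_at m s c ((\<omega>(g := y')) (i, grp m s a)) a" if "open_at m s c ((\<omega>(g := y)) (i, grp m s a)) a" for i a
    using that assms unfolding open_at_def by (cases "g = (i, grp m s a)") auto
  then have "(\<exists>x\<in>A. \<forall>i\<in>I. open_at m s c ((\<omega>(g := y)) (i, grp m s (x i))) (x i)) \<longrightarrow>
     (\<exists>x\<in>A. \<forall>i\<in>I. open_at m s c ((\<omega>(g := y')) (i, grp m s (x i))) (x i))" by blast
  then show ?thesis unfolding hit_def by (simp add: of_bool_def del: fun_upd_apply)
qed

text \<open>If the bit never matters, then \<open>(z, True)\<close> can be replaced by
  \<open>(z, False)\<close>. The former opens all that \<open>(z + 1, False)\<close> opens, so the
  value does not increase from \<open>z\<close> to \<open>z + 1\<close>. Going once around the cycle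
  shows that it is constant. This is the hypothesis \<open>conn\<close> of
  \<open>pivotal_le_slope\<close>.\<close>

lemma hit_connected:
  assumes S: "0 < sz m s (snd g)" "sz m s (snd g) \<le> D"
    and eq: "\<forall>z<D. hit m s c A I (\<omega>(g := (z, True))) = hit m s c A I (\<omega>(g := (z, False)))"
    and "u \<in> cW D" "v \<in> cW D"
  shows "hit m s c A I (\<omega>(g := u)) = hit m s c A I (\<omega>(g := v))"
proof -
  let ?S = "sz m s (snd g)"
  let ?f = "\<lambda>z b. hit m s c A I (\<omega>(g := (z, b)))"
  have per: "?f z b = ?f z' b" if "z mod ?S = z' mod ?S" for z z' b
  proof -
    have "(z + k) mod ?S = (z' + k) mod ?S" for k using that by (metis mod_add_left_eq)
    then have "opn c (z, b) ?S = opn c (z', b) ?S"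
      by (simp only: fun_eq_iff opn_def fst_conv snd_conv add.assoc simp_thms)
    then show ?thesis by (intro order.antisym hit_mono_upd) auto
  qed
  \<comment> \<open>The hypothesis covers \<open>z < D\<close> only; as \<open>D\<close> is at least
    the group size, every residue is represented.\<close>
  have TF: "?f z True = ?f z False" for z
    using eq per[of z "z mod ?S"] S by (metis mod_less_divisor mod_mod_trivial order.strict_trans2)
  have step: "?f (Suc z) False \<le> ?f z False" for z
  proof -
    have "?f (Suc z) False \<le> ?f z True" by (rule hit_mono_upd) (auto simp: opn_def)
    then show ?thesis by (simp only: TF)
  qed
  have dec: "?f z' False \<le> ?f z False" if "z \<le> z'" for z z'
    using that step by (rule lift_Suc_antimono_le[of "\<lambda>z. ?f z False", rotated])
  have le: "?f z False \<le> ?f z' False" for z z'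
  proof -
    have "?f z False = ?f (z + ?S * z') False" by (rule per) simp
    also have "z' \<le> z + ?S * z'" using S(1) by (simp add: trans_le_add2)
    then have "?f (z + ?S * z') False \<le> ?f z' False" by (rule dec)
    finally show ?thesis .
  qed
  have F: "?f z b = ?f z False" for z b using TF by (cases b) auto
  have "?f z b = ?f z' b'" for z z' b b'
    unfolding F[of z b] F[of z' b'] by (rule order.antisym[OF le le])
  from this[of "fst u" "snd u" "fst v" "snd v"] show ?thesis by (simp only: prod.collapse)
qed

section \<open>Power inequalities and summation by parts for the induction on the dimension\<close>

lemma powr_increment_antimono:
  fixes u v d \<alpha> :: real
  assumes "0 < v" "v \<le> u" "0 \<le> d" "0 < \<alpha>" "\<alpha> \<le> 1"
  shows "(u + d) powr \<alpha> - u powr \<alpha> \<le> (v + d) powr \<alpha> - v powr \<alpha>"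
proof (rule DERIV_nonpos_imp_nonincreasing[OF assms(2), of "\<lambda>t. (t + d) powr \<alpha> - t powr \<alpha>"])
  fix t assume t: "v \<le> t" "t \<le> u"
  have "((\<lambda>t. (t + d) powr \<alpha> - t powr \<alpha>) has_real_derivative (\<alpha> * (t + d) powr (\<alpha> - 1) * 1 - \<alpha> * t powr (\<alpha> - 1) * 1)) (at t)"
    using t assms by (auto intro!: derivative_eq_intros simp: powr_diff)
  moreover have "(t + d) powr (\<alpha> - 1) \<le> t powr (\<alpha> - 1)"
    using t assms by (intro powr_mono2') auto
  then have "\<alpha> * (t + d) powr (\<alpha> - 1) * 1 - \<alpha> * t powr (\<alpha> - 1) * 1 \<le> 0"
    using assms by (simp add: mult_left_mono)
  ultimately show "\<exists>y. ((\<lambda>t. (t + d) powr \<alpha> - t powr \<alpha>) has_real_derivative y) (at t) \<and> y \<le> 0" by blast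
qed

text \<open>A discrete form of the embedding of the Lorentz space \<open>L(1/\<alpha>, 1)\<close> into \<open>L(1/\<alpha>)\<close>.\<close>

lemma sum_powr_antimono:
  fixes y :: "nat \<Rightarrow> real"
  assumes \<alpha>: "0 < \<alpha>" "\<alpha> \<le> 1" and "\<And>i. i < M \<Longrightarrow> 0 \<le> y i" "\<And>i j. i \<le> j \<Longrightarrow> j < M \<Longrightarrow> y j \<le> y i"
  shows "(\<Sum>j<M. y j) powr \<alpha> \<le> (\<Sum>j<M. (y j) powr \<alpha> * (real (Suc j) powr \<alpha> - real j powr \<alpha>))"
  using assms(3,4)
proof (induction M)
  case (Suc M)
  define H where "H = (\<Sum>j<M. y j)"
  define d where "d = y M"
  have d: "0 \<le> d" using Suc.prems by (simp add: d_def)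
  have "real M * d \<le> H"
    using sum_mono[of "{..<M}" "\<lambda>_. d" y] Suc.prems(2) by (simp add: d_def H_def)
  then have "(H + d) powr \<alpha> - H powr \<alpha> \<le> (real M * d + d) powr \<alpha> - (real M * d) powr \<alpha>"
  proof (cases "M = 0 \<or> d = 0")
    case True
    then show ?thesis by (auto simp: H_def)
  next
    case False
    then show ?thesis using \<open>real M * d \<le> H\<close> d \<alpha> by (intro powr_increment_antimono) auto
  qed
  also have "real M * d + d = real (Suc M) * d" by (simp add: algebra_simps)
  also have "(real (Suc M) * d) powr \<alpha> - (real M * d) powr \<alpha> = d powr \<alpha> * (real (Suc M) powr \<alpha> - real M powr \<alpha>)"
    using d by (simp add: powr_mult algebra_simps del: of_nat_Suc)
  finally show ?case using Suc by (simp add: H_def d_def)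
qed simp

lemma ex_sorted_enumeration:
  fixes y :: "'a \<Rightarrow> real"
  assumes "finite S"
  shows "\<exists>e. bij_betw e {..<card S} S \<and> (\<forall>i j. i \<le> j \<longrightarrow> j < card S \<longrightarrow> y (e j) \<le> y (e i))"
proof -
  obtain xs where xs: "set xs = S" "distinct xs" using assms finite_distinct_list by blast
  let ?ys = "sort_key (\<lambda>a. - y a) xs"
  have "length ?ys = card S" using xs distinct_card by fastforce
  moreover have "bij_betw (nth ?ys) {..<length ?ys} S"
    using xs by (intro bij_betw_nth) auto
  moreover have "y (?ys ! j) \<le> y (?ys ! i)" if "i \<le> j" "j < length ?ys" for i j
    using sorted_nth_mono[OF sorted_sort_key[of "\<lambda>a. - y a" xs] that(1)] that by simp
  ultimately show ?thesis by (intro exI[of _ "nth ?ys"]) auto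
qed

lemma sum_telescope_from:
  fixes z :: "nat \<Rightarrow> real"
  assumes "j0 < M"
  shows "(\<Sum>j<M. (z j - (if Suc j < M then z (Suc j) else 0)) * of_bool (j0 \<le> j)) = z j0"
proof -
  define z' where "z' j = (if j < M then z j else 0)" for j
  have "(\<Sum>j<M. (z j - (if Suc j < M then z (Suc j) else 0)) * of_bool (j0 \<le> j)) = (\<Sum>j<M. if j0 \<le> j then z' j - z' (Suc j) else 0)"
    by (intro sum.cong) (auto simp: z'_def)
  also have "\<dots> = (\<Sum>j\<in>{j0..<M}. z' j - z' (Suc j))"
    by (subst sum.inter_filter[symmetric]) (auto intro!: sum.cong)
  also have "\<dots> = z' j0 - z' M"
    using sum_Suc_diff'[of j0 M "\<lambda>j. - z' j"] assms by simp
  finally show ?thesis using assms by (simp add: z'_def)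
qed

lemma abel_sum:
  fixes z Q :: "nat \<Rightarrow> real"
  assumes "Q 0 = 0"
  shows "(\<Sum>j<M. (z j - (if Suc j < M then z (Suc j) else 0)) * Q (Suc j)) = (\<Sum>j<M. z j * (Q (Suc j) - Q j))"
proof (cases M)
  case (Suc N)
  have "(\<Sum>j<N. (z j - z (Suc j)) * Q (Suc j)) = (\<Sum>j<N. z j * (Q (Suc j) - Q j)) - z N * Q N" for N
    by (induction N) (simp_all add: assms algebra_simps)
  from this[of N] show ?thesis unfolding Suc by (simp add: algebra_simps)
qed simp

text \<open>Layer-cake argument. If \<open>j0\<close> is the first index with \<open>P\<close>, the
  differences of \<open>z\<close> from \<open>j0\<close> on telescope to \<open>z j0\<close>, which
  \<open>K\<close> dominates. Taking expectations and summing by parts moves the differences from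
  \<open>z\<close> to \<open>Q\<close>.\<close>

lemma (in fin_weights) ex_first_open:
  assumes G: "finite G" and K0: "\<And>\<omega>. 0 \<le> K \<omega>"
    and z: "\<And>i. i < M \<Longrightarrow> 0 \<le> z i" "\<And>i j. i \<le> j \<Longrightarrow> j < M \<Longrightarrow> z j \<le> z i"
    and K: "\<And>\<omega> j. j < M \<Longrightarrow> P j \<omega> \<Longrightarrow> z j \<le> K \<omega>"
    and Q: "Q 0 = 0" "\<And>j. j < M \<Longrightarrow> Q (Suc j) \<le> noise W w 0 G (\<lambda>\<omega>. of_bool (\<exists>i\<le>j. P i \<omega>)) \<omega>"
  shows "(\<Sum>j<M. z j * (Q (Suc j) - Q j)) \<le> noise W w 0 G K \<omega>"
proof -
  let ?d = "\<lambda>j. z j - (if Suc j < M then z (Suc j) else 0)"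
  have d0: "0 \<le> ?d j" if "j < M" for j using z that by auto
  have pt: "(\<Sum>j<M. ?d j * of_bool (\<exists>i\<le>j. P i \<omega>)) \<le> K \<omega>" for \<omega>
  proof (cases "\<exists>j<M. P j \<omega>")
    case True
    define j0 where "j0 = (LEAST j. P j \<omega>)"
    have j0: "P j0 \<omega>" "\<And>j. P j \<omega> \<Longrightarrow> j0 \<le> j" using True unfolding j0_def by (auto intro: LeastI Least_le)
    then have less: "j0 < M" using True le_less_trans by blast
    have "(\<Sum>j<M. ?d j * of_bool (\<exists>i\<le>j. P i \<omega>)) = (\<Sum>j<M. ?d j * of_bool (j0 \<le> j))"
      using j0 by (intro sum.cong arg_cong2[where f = "(*)"] arg_cong[where f = of_bool] refl) (meson order.trans)
    then show ?thesis using sum_telescope_from[OF less] K[OF less j0(1)] by simp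
  next
    case False
    then have "(\<Sum>j<M. ?d j * of_bool (\<exists>i\<le>j. P i \<omega>)) = 0" by (intro sum.neutral) auto
    then show ?thesis using K0 by simp
  qed
  have "(\<Sum>j<M. z j * (Q (Suc j) - Q j)) = (\<Sum>j<M. ?d j * Q (Suc j))" by (rule abel_sum[of Q z M, OF Q(1), symmetric])
  also have "\<dots> \<le> (\<Sum>j<M. ?d j * noise W w 0 G (\<lambda>\<omega>. of_bool (\<exists>i\<le>j. P i \<omega>)) \<omega>)"
    using d0 Q(2) by (intro sum_mono mult_left_mono) auto
  also have "\<dots> = noise W w 0 G (\<lambda>\<omega>. \<Sum>j<M. ?d j * of_bool (\<exists>i\<le>j. P i \<omega>)) \<omega>"
    by (simp only: ex_sum[OF G] ex_linear(3)[OF G])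
  also have "\<dots> \<le> noise W w 0 G K \<omega>" by (rule ex_mono[OF G pt])
  finally show ?thesis .
qed

section \<open>Probability of opening a letter and of hitting a family\<close>

lemma card_le_fibers:
  assumes "finite B" "\<And>g. g \<in> f ` B \<Longrightarrow> card {a \<in> B. f a = g} \<le> D"
  shows "card B \<le> D * card (f ` B)"
proof -
  have "card B = card (\<Union>g\<in>f ` B. {a \<in> B. f a = g})" by (rule arg_cong[where f = card]) auto
  also have "\<dots> \<le> (\<Sum>g\<in>f ` B. card {a \<in> B. f a = g})" using assms(1) by (intro card_UN_le) simp
  also have "\<dots> \<le> of_nat (card (f ` B)) * D" by (intro sum_bounded_above assms(2))
  finally show ?thesis by (simp add: mult.commute)
qed

lemma card_grp_fiber:
  assumes "0 < s" "s \<le> m"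
  shows "card {a \<in> {1..m}. grp m s a = g} \<le> 2 * s"
proof (cases "g < m div s")
  case True
  have "card {a \<in> {1..m}. grp m s a = g} \<le> card {..<sz m s g}"
    using pos_less[OF assms] inj_grp_pos[OF assms(1)]
    by (intro card_inj_on_le[where f = "pos m s"]) (auto simp: inj_on_def)
  then show ?thesis using sz_bounds[OF assms True] by simp
next
  case False
  then have "{a \<in> {1..m}. grp m s a = g} = {}" using grp_less[OF assms] by auto
  then show ?thesis by (simp only: card.empty)
qed

lemma prod_of_bool: "finite G \<Longrightarrow> (\<Prod>g\<in>G. of_bool (P g)) = (of_bool (\<forall>g\<in>G. P g) :: real)"
  by (induction G rule: finite_induct) auto

text \<open>The groups at \<open>i\<close> are independent. In each group that meets
  \<open>B\<close>, a fixed letter of \<open>B\<close> is opened by one particular offset, whatever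
  the bit, hence with probability at least \<open>1 / D\<close>.\<close>

lemma ex_open_ge:
  fixes i :: 'a
  assumes s: "0 < s" "s \<le> m" and D: "D = 2 * s" and t: "0 \<le> t" "t \<le> 1" and B: "B \<subseteq> {1..m}"
  shows "1 - (1 - 1 / real D) ^ card (grp m s ` B) \<le>
    noise (cW D) (cw D t) 0 ({i} \<times> {..<m div s}) (\<lambda>\<omega>. of_bool (\<exists>a\<in>B. open_at m s c (\<omega> (i, grp m s a)) a)) \<omega>"
proof -
  have D0: "0 < D" using s D by simp
  interpret fin_weights "cW D" "cw D t" by (rule fin_weights_cw[OF D0 t])
  let ?G = "{i} \<times> {..<m div s}" and ?q = "1 - 1 / real D"
  have G: "finite ?G" by simp
  define \<phi> :: "'a \<times> nat \<Rightarrow> nat \<times> bool \<Rightarrow> real"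
    where "\<phi> g v = of_bool (\<forall>a\<in>B. grp m s a = snd g \<longrightarrow> \<not> open_at m s c v a)" for g v
  have q: "0 \<le> ?q" using D0 by simp
  have eq: "of_bool (\<exists>a\<in>B. open_at m s c (\<omega> (i, grp m s a)) a) = 1 - (\<Prod>g\<in>?G. \<phi> g (\<omega> g))" for \<omega>
  proof -
    have "(\<forall>g\<in>?G. \<forall>a\<in>B. grp m s a = snd g \<longrightarrow> \<not> open_at m s c (\<omega> g) a)
       \<longleftrightarrow> \<not> (\<exists>a\<in>B. open_at m s c (\<omega> (i, grp m s a)) a)"
      using grp_less[OF s] by auto
    then show ?thesis unfolding \<phi>_def prod_of_bool[OF G] by simp
  qed
  have mass: "(\<Sum>v\<in>cW D. cw D t v * \<phi> g v) \<le> (if snd g \<in> grp m s ` B then ?q else 1)" for g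
  proof -
    have le: "cw D t v * \<phi> g v \<le> cw D t v" if "v \<in> cW D" for v
      using w_nonneg[OF that] by (simp add: \<phi>_def)
    show ?thesis
    proof (cases "snd g \<in> grp m s ` B")
      case True
      then obtain a where a: "a \<in> B" "snd g = grp m s a" by blast
      let ?S = "sz m s (grp m s a)"
      have p: "pos m s a < ?S" using pos_less[OF s] a B by blast
      \<comment> \<open>Solves \<open>z + c = pos\<close> modulo the group size; the multiple
        \<open>?S * c\<close> keeps the subtraction of naturals from truncating.\<close>
      define z where "z = (pos m s a + ?S * c - c) mod ?S"
      have z: "z < D" using p sz_bounds[OF s grp_less[OF s], of a] D by (simp add: z_def order.strict_trans[OF mod_less_divisor])
      have "c \<le> ?S * c" using p by simp
      then have e: "pos m s a + ?S * c - c + c = pos m s a + ?S * c" by linarith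
      have "(z + c) mod ?S = pos m s a"
        unfolding z_def mod_add_left_eq e using p by simp
      then have "open_at m s c (z, b) a" for b unfolding open_at_def opn_def by simp
      then have \<phi>0: "\<phi> g (z, b) = 0" for b using a unfolding \<phi>_def by auto
      let ?Z = "{(z, False), (z, True)}"
      have "(\<Sum>v\<in>cW D. cw D t v * \<phi> g v) = (\<Sum>v\<in>cW D - ?Z. cw D t v * \<phi> g v)"
        using \<phi>0 finite_W by (intro sum.mono_neutral_right) auto
      also have "\<dots> \<le> (\<Sum>v\<in>cW D - ?Z. cw D t v)" using le by (intro sum_mono) auto
      also have "\<dots> = 1 - (\<Sum>v\<in>?Z. cw D t v)"
        using z finite_W by (subst sum_diff) (auto simp: cW_def sum_w[unfolded cW_def])
      also have "(\<Sum>v\<in>?Z. cw D t v) = 1 / D" by (simp add: cw_def flip: add_divide_distrib)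
      finally show ?thesis using True by simp
    next
      case False
      have "(\<Sum>v\<in>cW D. cw D t v * \<phi> g v) \<le> 1" using sum_mono[of "cW D" "\<lambda>v. cw D t v * \<phi> g v" "cw D t", OF le] sum_w by simp
      then show ?thesis using False by simp
    qed
  qed
  have "(\<Prod>g\<in>?G. \<Sum>v\<in>cW D. cw D t v * \<phi> g v) \<le> (\<Prod>g\<in>?G. if snd g \<in> grp m s ` B then ?q else 1)"
    using mass w_nonneg by (intro prod_mono) (auto simp: \<phi>_def intro!: sum_nonneg)
  also have "\<dots> = ?q ^ card {g \<in> ?G. snd g \<in> grp m s ` B}"
    by (simp add: prod.If_cases Int_def)
  also have "{g \<in> ?G. snd g \<in> grp m s ` B} = {i} \<times> grp m s ` B" using grp_less[OF s] by auto
  finally show ?thesis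
    unfolding eq ex_linear(2)[OF G] noise_prod[OF G] noise_const[OF G]
    by (simp add: card_cartesian_product_singleton)
qed

lemma card_cube: "finite I \<Longrightarrow> card (cube m I) = m ^ card I"
  by (simp add: cube_def card_PiE)

lemma finite_cube: "finite I \<Longrightarrow> finite (cube m I)"
  by (simp add: cube_def finite_PiE)

lemma card_sum_fibers:
  assumes "finite I" "A \<subseteq> cube m I" "i \<in> I"
  shows "card A = (\<Sum>a\<in>{1..m}. card {x \<in> A. x i = a})"
proof -
  have "finite A" using assms finite_cube finite_subset by blast
  moreover have "A = (\<Union>a\<in>{1..m}. {x \<in> A. x i = a})" using assms by (auto simp: cube_def PiE_def Pi_def)
  ultimately show ?thesis by (subst \<open>A = _\<close>, subst card_UN_disjoint) auto
qed

text \<open>The inequality tensorises without loss. Order the letters at \<open>i\<close> by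
  decreasing density of their sections. If letter \<open>a\<close> is open, hitting its section
  suffices, which has conditional probability at least \<open>y a powr \<alpha>\<close> by
  induction; and one of the \<open>j\<close> densest letters is open with probability at least
  \<open>(j / m) powr \<alpha>\<close>. \<open>ex_first_open\<close> combines the two bounds, and
  \<open>sum_powr_antimono\<close> turns the result into the power of the average density.\<close>

lemma hit_powr_ge:
  assumes s: "0 < s" "s \<le> m" and D: "D = 2 * s" and t: "0 \<le> t" "t \<le> 1"
    and \<alpha>: "0 < \<alpha>" "\<alpha> \<le> 1"
    and thr: "\<And>j c. 1 \<le> j \<Longrightarrow> j < m \<Longrightarrow> j \<le> D * c \<Longrightarrow> (real j / real m) powr \<alpha> \<le> 1 - (1 - 1 / real D) ^ c"
    and "finite I" "A \<subseteq> cube m I"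
  shows "(real (card A) / real m ^ card I) powr \<alpha> \<le> noise (cW D) (cw D t) 0 (I \<times> {..<m div s}) (hit m s c A I) \<omega>"
  using assms(9,10)
proof (induction I arbitrary: A \<omega> rule: finite_induct)
  case empty
  then have "A = {} \<or> A = {\<lambda>_. undefined}" by (auto simp: cube_def)
  then show ?case by (auto simp: hit_def noise_def)
next
  case (insert i I)
  have D0: "0 < D" using s D by simp
  have m: "0 < m" using s by simp
  interpret fin_weights "cW D" "cw D t" by (rule fin_weights_cw[OF D0 t])
  let ?n = "m div s"
  define Aa where "Aa a = (\<lambda>x. restrict x I) ` {x \<in> A. x i = a}" for a
  have inj: "inj_on (\<lambda>x. restrict x I) {x \<in> A. x i = a}" for a
  proof (rule inj_onI)
    fix x x' assume x: "x \<in> {x \<in> A. x i = a}" "x' \<in> {x \<in> A. x i = a}" "restrict x I = restrict x' I"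
    then have "x \<in> cube m (insert i I)" "x' \<in> cube m (insert i I)" using insert.prems by auto
    then show "x = x'" unfolding cube_def
    proof (rule PiE_ext)
      fix j assume "j \<in> insert i I"
      then show "x j = x' j" using x(1,2) fun_cong[OF x(3), of j] by (auto simp: restrict_def split: if_splits)
    qed
  qed
  have card_Aa: "card (Aa a) = card {x \<in> A. x i = a}" for a unfolding Aa_def by (rule card_image[OF inj])
  have Aa: "Aa a \<subseteq> cube m I" for a using insert.prems unfolding Aa_def cube_def by (auto simp: PiE_def Pi_def)
  define y where "y a = real (card (Aa a)) / real m ^ card I" for a
  define K where "K = noise (cW D) (cw D t) 0 (I \<times> {..<?n}) (hit m s c A (insert i I))"
  have fin: "finite (I \<times> {..<?n})" "finite ({i} \<times> {..<?n})" using insert(1) by auto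
  have K0: "0 \<le> K \<omega>" for \<omega> unfolding K_def by (rule ex_nonneg[OF fin(1)]) (simp add: hit_def)
  have K_ge: "y a powr \<alpha> \<le> K \<omega>" if op: "open_at m s c (\<omega> (i, grp m s a)) a" for a \<omega>
  proof -
    define C :: "(nat \<times> nat \<Rightarrow> nat \<times> bool) \<Rightarrow> real" where "C \<omega>' = of_bool (open_at m s c (\<omega>' (i, grp m s a)) a)" for \<omega>'
    have "C \<omega>' * hit m s c (Aa a) I \<omega>' \<le> hit m s c A (insert i I) \<omega>'" for \<omega>'
    proof (cases "C \<omega>' = 1 \<and> hit m s c (Aa a) I \<omega>' = 1")
      case True
      then obtain x where "x \<in> Aa a" "\<forall>j\<in>I. open_at m s c (\<omega>' (j, grp m s (x j))) (x j)"
        by (auto simp: hit_def split: if_splits)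
      then obtain x' where "x' \<in> A" "x' i = a" "\<forall>j\<in>I. open_at m s c (\<omega>' (j, grp m s (x' j))) (x' j)"
        unfolding Aa_def by auto
      moreover have "open_at m s c (\<omega>' (i, grp m s a)) a" using True by (simp add: C_def)
      ultimately have "hit m s c A (insert i I) \<omega>' = 1" unfolding hit_def by auto
      then show ?thesis using True by simp
    next
      case False
      then show ?thesis by (auto simp: C_def hit_def)
    qed
    then have "noise (cW D) (cw D t) 0 (I \<times> {..<?n}) (\<lambda>\<omega>'. C \<omega>' * hit m s c (Aa a) I \<omega>') \<omega> \<le> K \<omega>"
      unfolding K_def by (rule ex_mono[OF fin(1)])
    also have "noise (cW D) (cw D t) 0 (I \<times> {..<?n}) (\<lambda>\<omega>'. C \<omega>' * hit m s c (Aa a) I \<omega>')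
       = (\<lambda>\<omega>'. C \<omega>' * noise (cW D) (cw D t) 0 (I \<times> {..<?n}) (hit m s c (Aa a) I) \<omega>')"
      by (rule noise_mult_indep[OF fin(1)]) (use insert(2) in \<open>auto simp: C_def\<close>)
    finally have "noise (cW D) (cw D t) 0 (I \<times> {..<?n}) (hit m s c (Aa a) I) \<omega> \<le> K \<omega>"
      using op by (simp add: C_def)
    then show ?thesis unfolding y_def using insert.IH[OF Aa, of a \<omega>] by linarith
  qed
  obtain e where e: "bij_betw e {..<m} {1..m}" "\<And>j j'. j \<le> j' \<Longrightarrow> j' < m \<Longrightarrow> y (e j') \<le> y (e j)"
    using ex_sorted_enumeration[of "{1..m}" y] by auto
  define Q where "Q j = (real j / real m) powr \<alpha>" for j :: nat
  define P where "P j \<omega>' \<longleftrightarrow> open_at m s c (\<omega>' (i, grp m s (e j))) (e j)" for j and \<omega>' :: "nat \<times> nat \<Rightarrow> nat \<times> bool"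
  have Q_le: "Q (Suc j) \<le> noise (cW D) (cw D t) 0 ({i} \<times> {..<?n}) (\<lambda>\<omega>. of_bool (\<exists>i\<le>j. P i \<omega>)) \<omega>" if j: "j < m" for j
  proof -
    define B where "B = e ` {..j}"
    have B: "B \<subseteq> {1..m}" using e(1) j unfolding B_def bij_betw_def by auto
    have cB: "card B = Suc j" unfolding B_def
      using e(1) j by (subst card_image) (auto simp: bij_betw_def intro: inj_on_subset)
    have PB: "(\<exists>i\<le>j. P i \<omega>') \<longleftrightarrow> (\<exists>a\<in>B. open_at m s c (\<omega>' (i, grp m s a)) a)" for \<omega>'
      unfolding B_def P_def by auto
    show ?thesis
    \<comment> \<open>For the full alphabet \<open>Q\<close> equals 1, so no error is affordable.
      Here it is used that group 0 always has an open position, whatever its variable.\<close>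
    proof (cases "Suc j = m")
      case True
      then have full: "B = {1..m}" using B cB by (intro card_subset_eq) auto
      have "\<exists>a\<in>{1..m}. open_at m s c (\<omega>' (i, grp m s a)) a" for \<omega>' :: "nat \<times> nat \<Rightarrow> nat \<times> bool"
      proof -
        have n: "0 < ?n" using s by (simp add: div_greater_zero_iff)
        then have "(fst (\<omega>' (i, 0)) + c) mod sz m s 0 < sz m s 0" using sz_bounds(1)[OF s n] s by simp
        from grp_pos_surj[OF s n this] show ?thesis unfolding open_at_def opn_def by force
      qed
      then show ?thesis unfolding PB full using True m by (simp add: Q_def noise_const)
    next
      case False
      have "Suc j \<le> D * card (grp m s ` B)"
      proof -
        have finB: "finite B" using B finite_subset by blast
        have "card {a \<in> B. grp m s a = g} \<le> D" for g
        proof -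
          have "card {a \<in> B. grp m s a = g} \<le> card {a \<in> {1..m}. grp m s a = g}"
            using B by (intro card_mono) auto
          then show ?thesis using card_grp_fiber[OF s, of g] D by simp
        qed
        from card_le_fibers[OF finB this] show ?thesis using cB by simp
      qed
      then have "Q (Suc j) \<le> 1 - (1 - 1 / real D) ^ card (grp m s ` B)"
        unfolding Q_def using False j by (intro thr) auto
      also have "\<dots> \<le> noise (cW D) (cw D t) 0 ({i} \<times> {..<?n}) (\<lambda>\<omega>. of_bool (\<exists>i\<le>j. P i \<omega>)) \<omega>"
        unfolding PB by (rule ex_open_ge[OF s D t B])
      finally show ?thesis .
    qed
  qed
  have y0: "0 \<le> y a" for a by (simp add: y_def)
  have "real (card A) = (\<Sum>a\<in>{1..m}. real (card (Aa a)))"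
    unfolding card_Aa using card_sum_fibers[of "insert i I" A m i] insert by simp
  then have cardA: "real (card A) / real m ^ card (insert i I) = (\<Sum>a\<in>{1..m}. y a) / real m"
    using insert(1,2) by (simp add: y_def sum_divide_distrib mult.commute)
  also have "(\<Sum>a\<in>{1..m}. y a) = (\<Sum>j<m. y (e j))" by (rule sum.reindex_bij_betw[OF e(1), symmetric])
  finally have "(real (card A) / real m ^ card (insert i I)) powr \<alpha> = (\<Sum>j<m. y (e j)) powr \<alpha> / real m powr \<alpha>"
    using y0 by (simp add: powr_divide sum_nonneg)
  also have "\<dots> \<le> (\<Sum>j<m. y (e j) powr \<alpha> * (real (Suc j) powr \<alpha> - real j powr \<alpha>)) / real m powr \<alpha>"
    using e(2) y0 by (intro divide_right_mono sum_powr_antimono \<alpha>) auto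
  also have "\<dots> = (\<Sum>j<m. y (e j) powr \<alpha> * (Q (Suc j) - Q j))"
    unfolding sum_divide_distrib
    by (intro sum.cong refl) (simp add: Q_def powr_divide del: of_nat_Suc flip: diff_divide_distrib)
  also have "\<dots> \<le> noise (cW D) (cw D t) 0 ({i} \<times> {..<?n}) K \<omega>"
  proof (rule ex_first_open[OF fin(2) K0, where P = P])
    show "y (e j) powr \<alpha> \<le> K \<omega>" if "P j \<omega>" for j \<omega> using K_ge that by (simp add: P_def)
    show "y (e j') powr \<alpha> \<le> y (e j) powr \<alpha>" if "j \<le> j'" "j' < m" for j j'
      using e(2)[OF that] y0 \<alpha> by (intro powr_mono2) auto
    show "Q 0 = 0" using \<alpha> by (simp add: Q_def)
  qed (use Q_le in auto)
  also have "\<dots> = noise (cW D) (cw D t) 0 (insert i I \<times> {..<?n}) (hit m s c A (insert i I)) \<omega>"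
  proof -
    have "insert i I \<times> {..<?n} = {i} \<times> {..<?n} \<union> I \<times> {..<?n}" by auto
    moreover have "({i} \<times> {..<?n}) \<inter> (I \<times> {..<?n}) = {}" using insert(2) by auto
    ultimately show ?thesis unfolding K_def using fin by (simp add: noise_Un)
  qed
  finally show ?case .
qed

text \<open>The exponent is fitted to small \<open>j\<close>: up to \<open>sqrt m\<close> the left
  side is at most m^(-\<alpha>/2) = 1 / D, already the chance of opening within one group. For
  larger \<open>j\<close> the right side misses 1 by an amount exponentially small in
  \<open>sqrt m\<close>, whereas the left side stays below 1 by at least
  \<open>\<alpha> / (2 * m)\<close>.\<close>

lemma powr_threshold:
  assumes D: "2 \<le> (D :: nat)"
  shows "\<exists>m0. \<forall>m\<ge>m0. 0 < 2 * ln (real D) / ln (real m) \<and> 2 * ln (real D) / ln (real m) \<le> 1 \<and>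
    (\<forall>j c. 1 \<le> j \<longrightarrow> j < m \<longrightarrow> j \<le> D * c \<longrightarrow>
      (real j / real m) powr (2 * ln (real D) / ln (real m)) \<le> 1 - (1 - 1 / real D) ^ c)"
proof -
  define q where "q = 1 - 1 / real D"
  have q: "0 < q" "q < 1" using D by (auto simp: q_def)
  define L where "L = ln (real D)"
  have L: "0 < L" using D by (simp add: L_def)
  \<comment> \<open>With \<open>x = \<kappa> * sqrt m\<close> one gets
    \<open>q ^ c \<le> exp (- (6 * x)) \<le> 1 / x ^ 6\<close>. The sixth power makes this of order
    m^(-3), below the required \<open>L / (m * ln m)\<close> for large \<open>m\<close>.\<close>
  define \<kappa> where "\<kappa> = - ln q / (6 * real D)"
  have \<kappa>: "0 < \<kappa>" unfolding \<kappa>_def using q D by (intro divide_pos_pos) auto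
  define m0 where "m0 = max (max 3 (D ^ 2)) (nat \<lceil>1 / (\<kappa> ^ 6 * L)\<rceil>)"
  show ?thesis
  proof (intro exI[of _ m0] allI impI conjI)
    fix m assume m0: "m0 \<le> m"
    then have m: "3 \<le> m" "D ^ 2 \<le> m" "1 / (\<kappa> ^ 6 * L) \<le> real m"
      unfolding m0_def by (simp_all add: nat_le_iff ceiling_le_iff)
    define \<alpha> where "\<alpha> = 2 * ln (real D) / ln (real m)"
    have lnm: "0 < ln (real m)" using m by simp
    show "0 < 2 * ln (real D) / ln (real m)" using L lnm by (simp add: L_def)
    then have \<alpha>0: "0 < \<alpha>" by (simp add: \<alpha>_def)
    have "2 * ln (real D) = ln (real D ^ 2)" using D by (simp add: ln_realpow)
    also have "\<dots> \<le> ln (real m)" using m(1,2) D by (subst ln_le_cancel_iff) (auto simp flip: of_nat_power)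
    finally show le1: "2 * ln (real D) / ln (real m) \<le> 1" using lnm by simp
    fix j c assume j: "1 \<le> j" "j < m" "j \<le> D * c"
    have c: "1 \<le> c" using j by (cases c) auto
    have "(real j / real m) powr \<alpha> \<le> 1 - q ^ c"
    proof (cases "j * j \<le> m")
      case True
      have "real j \<le> sqrt (real m)" using True by (intro real_le_rsqrt) (simp add: power2_eq_square flip: of_nat_mult)
      then have "real j / real m \<le> real m powr (1 / 2) / real m"
        using m by (intro divide_right_mono) (auto simp: powr_half_sqrt)
      also have "\<dots> = real m powr (- 1 / 2)" using m powr_diff[of "real m" "1 / 2" 1] by simp
      finally have "(real j / real m) powr \<alpha> \<le> (real m powr (- 1 / 2)) powr \<alpha>"
        using \<alpha>0 by (intro powr_mono2) auto
      also have "\<dots> = exp (- L)" using m lnm by (simp add: powr_powr powr_def \<alpha>_def L_def)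
      also have "\<dots> = 1 / real D" using D by (simp add: L_def exp_minus inverse_eq_divide)
      also have "\<dots> = 1 - q ^ 1" by (simp add: q_def)
      also have "\<dots> \<le> 1 - q ^ c" using q c power_decreasing[of 1 c q] by simp
      finally show ?thesis .
    next
      case False
      have jm: "sqrt (real m) \<le> real j" using False by (intro real_le_lsqrt) (auto simp: power2_eq_square simp flip: of_nat_mult)
      have "real j / real m \<le> 1 - 1 / real m" using j m by (simp add: field_simps)
      also have "\<dots> \<le> exp (- (1 / real m))" using exp_ge_add_one_self[of "- (1 / real m)"] by simp
      finally have "(real j / real m) powr \<alpha> \<le> exp (- (1 / real m)) powr \<alpha>"
        using \<alpha>0 by (intro powr_mono2) auto
      also have "\<dots> = exp (- (\<alpha> / real m))" by (simp add: powr_def)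
      also have "\<dots> \<le> 1 - (\<alpha> / real m) / 2"
      proof -
        define x where "x = \<alpha> / real m"
        have "\<alpha> \<le> real m" using le1 m unfolding \<alpha>_def by linarith
        then have x: "0 \<le> x" "x \<le> 1" using \<alpha>0 m by (auto simp: x_def divide_le_eq)
        have "1 \<le> (1 - x / 2) * (1 + x)" using x by (simp add: algebra_simps mult_left_le)
        also have "\<dots> \<le> (1 - x / 2) * exp x" using x by (intro mult_left_mono) auto
        finally show ?thesis unfolding x_def[symmetric] by (simp add: exp_minus field_simps)
      qed
      also have "(\<alpha> / real m) / 2 = L / (real m * ln (real m))" by (simp add: \<alpha>_def L_def)
      also have "1 - L / (real m * ln (real m)) \<le> 1 - q ^ c"
      proof -
        define x where "x = \<kappa> * sqrt (real m)"
        have x: "0 < x" using \<kappa> m by (simp add: x_def)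
        have "real j \<le> real D * real c" using j(3) by (simp flip: of_nat_mult)
        then have "sqrt (real m) / real D \<le> real c" using jm D by (simp add: divide_le_eq mult.commute)
        then have "(- ln q) * (sqrt (real m) / real D) \<le> (- ln q) * real c" using q by (intro mult_left_mono) auto
        then have "6 * x \<le> - (real c * ln q)" by (simp add: x_def \<kappa>_def mult.commute)
        then have "q ^ c \<le> exp (- (6 * x))"
          using q by (simp add: powr_realpow[symmetric] powr_def)
        also have "\<dots> \<le> 1 / x ^ 6"
        proof -
          have "x \<le> exp x" using exp_ge_add_one_self[of x] by linarith
          then have "x ^ 6 \<le> exp x ^ 6" using x by (intro power_mono) auto
          also have "\<dots> = exp (6 * x)" by (simp flip: exp_of_nat_mult)
          finally show ?thesis using x by (simp add: exp_minus field_simps)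
        qed
        also have "x ^ 6 = \<kappa> ^ 6 * real m ^ 3"
        proof -
          have "sqrt (real m) ^ 6 = (sqrt (real m) ^ 2) ^ 3" by (simp only: power_mult[symmetric]) simp
          also have "\<dots> = real m ^ 3" by simp
          finally show ?thesis by (simp add: x_def power_mult_distrib)
        qed
        also have "1 / (\<kappa> ^ 6 * real m ^ 3) \<le> L / (real m * real m)"
        proof -
          have "1 \<le> real m * (\<kappa> ^ 6 * L)" using m(3) \<kappa> L by (simp add: divide_le_eq)
          then have "1 * (real m * real m) \<le> (real m * (\<kappa> ^ 6 * L)) * (real m * real m)" by (intro mult_right_mono) auto
          then show ?thesis using m \<kappa> by (simp add: divide_le_eq pos_le_divide_eq power3_eq_cube mult_ac)
        qed
        also have "\<dots> \<le> L / (real m * ln (real m))"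
          using m L lnm ln_le_minus_one[of "real m"] by (intro divide_left_mono mult_left_mono mult_pos_pos) auto
        finally show ?thesis by simp
      qed
      finally show ?thesis .
    qed
    then show "(real j / real m) powr (2 * ln (real D) / ln (real m)) \<le> 1 - (1 - 1 / real D) ^ c"
      by (simp add: \<alpha>_def q_def)
  qed
qed

section \<open>From constant probability to pairwise disagreement\<close>

lemma hit_indep:
  assumes "\<And>x i. x \<in> A \<Longrightarrow> i \<in> I \<Longrightarrow> (i, grp m s (x i)) \<noteq> g"
  shows "hit m s c A I (\<omega>(g := v)) = hit m s c A I \<omega>"
proof -
  have "(\<omega>(g := v)) (i, grp m s (x i)) = \<omega> (i, grp m s (x i))" if "x \<in> A" "i \<in> I" for x i
    using assms[OF that] by simp
  then show ?thesis unfolding hit_def by (simp only: cong: bex_cong ball_cong)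
qed

text \<open>Feeds the constant from \<open>hit_powr_ge\<close> into \<open>sharp_threshold\<close>.
  The index set \<open>I'\<close> may exceed \<open>I\<close>, so that families on different
  coordinate sets share one probability space; the failure probability \<open>1 / (2 * h)\<close> is
  chosen for a union bound over \<open>h\<close> families.\<close>

lemma hit_probability:
  fixes h k :: nat
  assumes h: "0 < h"
  obtains m0 r where "\<And>m I I' A c \<omega>. m0 \<le> m \<Longrightarrow> finite I' \<Longrightarrow> I \<subseteq> I' \<Longrightarrow> A \<subseteq> cube m I \<Longrightarrow>
    (\<forall>E\<subseteq>I \<times> {1..m}. card E \<le> r \<longrightarrow> 1 / real m ^ k \<le> real (card {x \<in> A. \<forall>(i, a)\<in>E. x i \<noteq> a}) / real m ^ card I) \<Longrightarrow>
    1 - 1 / (2 * real h) \<le> noise (cW (4 * h)) (cw (4 * h) (1 / 2)) 0 (I' \<times> {..<m div (2 * h)}) (hit m (2 * h) c A I) \<omega>"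
proof -
  \<comment> \<open>Groups of at least \<open>2 * h\<close> letters leave room for \<open>h\<close>
    disjoint pairs of cyclic positions, and \<open>D\<close> exceeds every group size.\<close>
  define D where "D = 4 * h"
  define s where "s = 2 * h"
  have s: "0 < s" "D = 2 * s" and D: "0 < D" "2 \<le> D" using h by (auto simp: s_def D_def)
  \<comment> \<open>The value of \<open>(1 / m ^ k) powr \<alpha>\<close>, in which \<open>m\<close>
    cancels because \<alpha> is \<open>2 * ln D / ln m\<close>.\<close>
  define c0 where "c0 = 1 / real D ^ (2 * k)"
  have c0: "0 < c0" using D by (simp add: c0_def)
  have h0: "0 < 1 / (2 * real h)" using h by simp
  obtain r1 where r1: "\<And>(G :: (nat \<times> nat) set) f \<omega>. finite G \<Longrightarrow> (\<forall>\<omega>. f \<omega> \<in> {0, 1}) \<Longrightarrow>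
    (\<forall>g\<in>G. \<forall>\<omega> z. f (\<omega>(g := (z, False))) \<le> f (\<omega>(g := (z, True)))) \<Longrightarrow>
    (\<forall>g\<in>G. \<forall>\<omega>. (\<forall>z<D. f (\<omega>(g := (z, True))) = f (\<omega>(g := (z, False)))) \<longrightarrow>
       (\<forall>u\<in>cW D. \<forall>v\<in>cW D. f (\<omega>(g := u)) = f (\<omega>(g := v)))) \<Longrightarrow>
    (\<forall>J\<subseteq>G. card J \<le> r1 \<longrightarrow> (\<forall>t. 0 \<le> t \<longrightarrow> t \<le> 1 \<longrightarrow> (\<forall>\<omega>. c0 \<le> noise (cW D) (cw D t) 0 (G - J) f \<omega>))) \<Longrightarrow>
    1 - 1 / (2 * real h) \<le> noise (cW D) (cw D (1 / 2)) 0 G f \<omega>"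
    using sharp_threshold[OF D(1) c0 h0] by blast
  obtain m1 where m1: "\<And>m. m1 \<le> m \<Longrightarrow> 0 < 2 * ln (real D) / ln (real m) \<and> 2 * ln (real D) / ln (real m) \<le> 1 \<and>
    (\<forall>j c. 1 \<le> j \<longrightarrow> j < m \<longrightarrow> j \<le> D * c \<longrightarrow>
      (real j / real m) powr (2 * ln (real D) / ln (real m)) \<le> 1 - (1 - 1 / real D) ^ c)"
    using powr_threshold[OF D(2)] by blast
  show ?thesis
  \<comment> \<open>A group holds at most \<open>D\<close> letters, so \<open>r1\<close> groups are
    emptied by at most \<open>D * r1\<close> dictators.\<close>
  proof (rule that[of "max m1 (max s 2)" "D * r1"])
    fix m I I' A c and \<omega> :: "nat \<times> nat \<Rightarrow> nat \<times> bool"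
    assume m: "max m1 (max s 2) \<le> m" and I': "finite I'" and I: "I \<subseteq> I'" and A: "A \<subseteq> cube m I"
      and unc: "\<forall>E\<subseteq>I \<times> {1..m}. card E \<le> D * r1 \<longrightarrow> 1 / real m ^ k \<le> real (card {x \<in> A. \<forall>(i, a)\<in>E. x i \<noteq> a}) / real m ^ card I"
    have finI: "finite I" using I I' finite_subset by blast
    have sm: "s \<le> m" "2 \<le> m" using m by auto
    let ?n = "m div s" and ?f = "hit m s c A I"
    let ?G = "I' \<times> {..<?n}"
    have G: "finite ?G" using I' by simp
    define \<alpha> where "\<alpha> = 2 * ln (real D) / ln (real m)"
    have \<alpha>: "0 < \<alpha>" "\<alpha> \<le> 1"
      "\<And>j c. 1 \<le> j \<Longrightarrow> j < m \<Longrightarrow> j \<le> D * c \<Longrightarrow> (real j / real m) powr \<alpha> \<le> 1 - (1 - 1 / real D) ^ c"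
      using m1[of m] m unfolding \<alpha>_def by auto
    have c0_eq: "(1 / real m ^ k) powr \<alpha> = c0"
    proof -
      have "ln (1 / real m ^ k) = - (real k * ln (real m))" using sm by (simp add: ln_div ln_realpow)
      then have "(1 / real m ^ k) powr \<alpha> = exp (- (real (2 * k) * ln (real D)))"
        using sm by (simp add: powr_def \<alpha>_def)
      also have "\<dots> = inverse (exp (ln (real D)) ^ (2 * k))" by (simp only: exp_minus exp_of_nat_mult)
      also have "\<dots> = c0" using D by (simp add: c0_def inverse_eq_divide)
      finally show ?thesis .
    qed
    have "1 - 1 / (2 * real h) \<le> noise (cW D) (cw D (1 / 2)) 0 ?G ?f \<omega>"
    proof (rule r1[OF G])
      show "\<forall>\<omega>. ?f \<omega> \<in> {0, 1}" unfolding hit_def of_bool_def by (metis insertCI)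
      show "\<forall>g\<in>?G. \<forall>\<omega> z. ?f (\<omega>(g := (z, False))) \<le> ?f (\<omega>(g := (z, True)))"
        by (intro ballI allI hit_mono_upd) (auto simp: opn_def)
      show "\<forall>g\<in>?G. \<forall>\<omega>. (\<forall>z<D. ?f (\<omega>(g := (z, True))) = ?f (\<omega>(g := (z, False)))) \<longrightarrow>
         (\<forall>u\<in>cW D. \<forall>v\<in>cW D. ?f (\<omega>(g := u)) = ?f (\<omega>(g := v)))"
      proof (intro ballI allI impI)
        fix g \<omega> u v
        assume g: "g \<in> ?G" and eq: "\<forall>z<D. ?f (\<omega>(g := (z, True))) = ?f (\<omega>(g := (z, False)))" and uv: "u \<in> cW D" "v \<in> cW D"
        have "snd g < ?n" using g by auto
        then have "0 < sz m s (snd g)" "sz m s (snd g) \<le> D"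
          using sz_bounds[OF s(1) sm(1)] s by (auto intro: order.strict_trans2 less_imp_le)
        then show "?f (\<omega>(g := u)) = ?f (\<omega>(g := v))" using eq uv by (rule hit_connected)
      qed
      show "\<forall>J\<subseteq>?G. card J \<le> r1 \<longrightarrow> (\<forall>t. 0 \<le> t \<longrightarrow> t \<le> 1 \<longrightarrow> (\<forall>\<omega>. c0 \<le> noise (cW D) (cw D t) 0 (?G - J) ?f \<omega>))"
      proof (intro allI impI)
        fix J t and \<omega> :: "nat \<times> nat \<Rightarrow> nat \<times> bool"
        assume J: "J \<subseteq> ?G" "card J \<le> r1" and t: "0 \<le> t" "t \<le> (1 :: real)"
        interpret fin_weights "cW D" "cw D t" by (rule fin_weights_cw[OF D(1) t])
        \<comment> \<open>Avoiding every letter in the groups of \<open>J\<close> makes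
          \<open>hit\<close> for the smaller family independent of the variables in
          \<open>J\<close>. Its lower bound therefore holds for every assignment on
          \<open>J\<close>, as the pointwise hypothesis of \<open>sharp_threshold\<close>
          demands.\<close>
        define E where "E = {(i, a) \<in> I \<times> {1..m}. (i, grp m s a) \<in> J}"
        define A' where "A' = {x \<in> A. \<forall>(i, a)\<in>E. x i \<noteq> a}"
        have finJ: "finite J" using J G finite_subset by blast
        have finE: "finite E" using finI unfolding E_def by (auto intro: finite_subset[of _ "I \<times> {1..m}"])
        have "card E \<le> D * card ((\<lambda>(i, a). (i, grp m s a)) ` E)"
        proof (rule card_le_fibers[OF finE])
          fix g assume "g \<in> (\<lambda>(i, a). (i, grp m s a)) ` E"
          have "card {x \<in> E. (case x of (i, a) \<Rightarrow> (i, grp m s a)) = g} \<le> card {a \<in> {1..m}. grp m s a = snd g}"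
            by (rule card_inj_on_le[where f = snd]) (auto simp: inj_on_def E_def)
          also have "\<dots> \<le> D" using card_grp_fiber[OF s(1) sm(1)] s(2) by simp
          finally show "card {x \<in> E. (case x of (i, a) \<Rightarrow> (i, grp m s a)) = g} \<le> D" .
        qed
        also have "\<dots> \<le> D * card J" by (intro mult_le_mono2 card_mono finJ) (auto simp: E_def)
        also have "\<dots> \<le> D * r1" using J by simp
        finally have "card E \<le> D * r1" .
        moreover have "E \<subseteq> I \<times> {1..m}" unfolding E_def by auto
        ultimately have dens: "1 / real m ^ k \<le> real (card A') / real m ^ card I"
          unfolding A'_def using unc by simp
        let ?X = "I \<times> {..<?n}"
        have X: "finite ?X" "?X \<subseteq> ?G" using finI I by auto
        have indep: "hit m s c A' I (\<omega>(g := v)) = hit m s c A' I \<omega>" if "g \<in> J \<or> g \<notin> ?X" for g \<omega> v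
        proof (rule hit_indep)
          fix x i assume x: "x \<in> A'" "i \<in> I"
          then have "x \<in> cube m I" using A unfolding A'_def by blast
          then have xi: "x i \<in> {1..m}" unfolding cube_def by (rule PiE_mem) (rule x(2))
          have "(i, x i) \<notin> E" using x unfolding A'_def by auto
          then have "(i, grp m s (x i)) \<notin> J" using x xi by (auto simp: E_def)
          moreover have "(i, grp m s (x i)) \<in> ?X" using x grp_less[OF s(1) sm(1)] by auto
          ultimately show "(i, grp m s (x i)) \<noteq> g" using that by auto
        qed
        have "c0 \<le> (real (card A') / real m ^ card I) powr \<alpha>"
          unfolding c0_eq[symmetric] using dens \<alpha> by (intro powr_mono2) auto
        also have "\<dots> \<le> noise (cW D) (cw D t) 0 ?X (hit m s c A' I) \<omega>"
          using A by (intro hit_powr_ge s sm t \<alpha> finI) (auto simp: A'_def)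
        also have "noise (cW D) (cw D t) 0 ?X (hit m s c A' I) = noise (cW D) (cw D t) 0 (?X - J) (hit m s c A' I)"
        proof -
          have "noise (cW D) (cw D t) 0 ((?X - J) \<union> (?X \<inter> J)) (hit m s c A' I) = noise (cW D) (cw D t) 0 (?X - J) (noise (cW D) (cw D t) 0 (?X \<inter> J) (hit m s c A' I))"
            using X by (intro noise_Un) auto
          also have "noise (cW D) (cw D t) 0 (?X \<inter> J) (hit m s c A' I) = hit m s c A' I"
            using X indep by (intro noise_indep) auto
          finally show ?thesis by (simp only: Un_Diff_Int)
        qed
        also have "noise (cW D) (cw D t) 0 (?X - J) (hit m s c A' I) = noise (cW D) (cw D t) 0 (?G - J) (hit m s c A' I)"
        proof -
          have "?G - J = (?X - J) \<union> (?G - J - ?X)" using X(2) by blast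
          then have "noise (cW D) (cw D t) 0 (?G - J) (hit m s c A' I) = noise (cW D) (cw D t) 0 (?X - J) (noise (cW D) (cw D t) 0 (?G - J - ?X) (hit m s c A' I))"
            using noise_Un[of "?X - J" "?G - J - ?X" 0 "hit m s c A' I"] X(1) G by (simp add: Int_Diff) blast
          also have "noise (cW D) (cw D t) 0 (?G - J - ?X) (hit m s c A' I) = hit m s c A' I"
            using G indep by (intro noise_indep) auto
          finally show ?thesis ..
        qed
        also have "noise (cW D) (cw D t) 0 (?G - J) (hit m s c A' I) \<omega> \<le> noise (cW D) (cw D t) 0 (?G - J) ?f \<omega>"
          using G by (intro ex_mono) (auto simp: hit_def A'_def)
        finally show "c0 \<le> noise (cW D) (cw D t) 0 (?G - J) ?f \<omega>" .
      qed
    qed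
    then show "1 - 1 / (2 * real h) \<le> noise (cW (4 * h)) (cw (4 * h) (1 / 2)) 0 (I' \<times> {..<m div (2 * h)}) (hit m (2 * h) c A I) \<omega>"
      by (simp add: D_def s_def)
  qed
qed

text \<open>Offsets \<open>2 * j\<close> give disjoint open sets under every assignment, so
  disagreement is automatic once each family is hit; the union bound runs over single families and
  leaves total failure at most 1/2.\<close>

lemma ex_pairwise_disagreeing:
  fixes h k :: nat
  obtains m0 r where "\<And>m (I :: nat \<Rightarrow> nat set) A. m0 \<le> m \<Longrightarrow> (\<forall>j<h. finite (I j) \<and> A j \<subseteq> cube m (I j) \<and>
      (\<forall>E\<subseteq>I j \<times> {1..m}. card E \<le> r \<longrightarrow> 1 / real m ^ k \<le> real (card {x \<in> A j. \<forall>(i, a)\<in>E. x i \<noteq> a}) / real m ^ card (I j))) \<Longrightarrow>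
    \<exists>x. (\<forall>j<h. x j \<in> A j) \<and> (\<forall>j<h. \<forall>j'<h. j \<noteq> j' \<longrightarrow> (\<forall>i\<in>I j \<inter> I j'. x j i \<noteq> x j' i))"
proof (cases "h = 0")
  case False
  then have h: "0 < h" by simp
  show ?thesis
  proof (rule hit_probability[OF h, where k = k])
    fix m0 r assume r: "\<And>m I I' A c \<omega>. m0 \<le> m \<Longrightarrow> finite I' \<Longrightarrow> I \<subseteq> I' \<Longrightarrow> A \<subseteq> cube m I \<Longrightarrow>
      (\<forall>E\<subseteq>I \<times> {1..m}. card E \<le> r \<longrightarrow> 1 / real m ^ k \<le> real (card {x \<in> A. \<forall>(i, a)\<in>E. x i \<noteq> a}) / real m ^ card I) \<Longrightarrow>
      1 - 1 / (2 * real h) \<le> noise (cW (4 * h)) (cw (4 * h) (1 / 2)) 0 (I' \<times> {..<m div (2 * h)}) (hit m (2 * h) c A I) \<omega>"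
    show thesis
    proof (rule that[of "max m0 (2 * h)" r])
      fix m and I :: "nat \<Rightarrow> nat set" and A
      assume m: "max m0 (2 * h) \<le> m" and *: "\<forall>j<h. finite (I j) \<and> A j \<subseteq> cube m (I j) \<and>
        (\<forall>E\<subseteq>I j \<times> {1..m}. card E \<le> r \<longrightarrow> 1 / real m ^ k \<le> real (card {x \<in> A j. \<forall>(i, a)\<in>E. x i \<noteq> a}) / real m ^ card (I j))"
      define I' where "I' = (\<Union>j<h. I j)"
      have I': "finite I'" "\<And>j. j < h \<Longrightarrow> I j \<subseteq> I'" using * by (auto simp: I'_def)
      let ?G = "I' \<times> {..<m div (2 * h)}"
      let ?f = "\<lambda>j. hit m (2 * h) (2 * j) (A j) (I j)"
      have G: "finite ?G" using I' by simp
      interpret fin_weights "cW (4 * h)" "cw (4 * h) (1 / 2)" by (rule fin_weights_cw) (use h in auto)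
      let ?L = "\<lambda>F. noise (cW (4 * h)) (cw (4 * h) (1 / 2)) 0 ?G F (\<lambda>_. undefined)"
      have hitj: "1 - 1 / (2 * real h) \<le> ?L (?f j)" if "j < h" for j
        using * m I' that by (intro r) auto
      have "\<exists>\<omega>. \<forall>j<h. ?f j \<omega> = 1"
      proof (rule ccontr)
        assume "\<not> ?thesis"
        then have ex: "\<exists>j<h. ?f j \<omega> \<noteq> 1" for \<omega> by blast
        have "1 \<le> (\<Sum>j<h. 1 - ?f j \<omega>)" for \<omega>
        proof -
          obtain j where j: "j < h" "?f j \<omega> \<noteq> 1" using ex by blast
          then have "1 = 1 - ?f j \<omega>" by (auto simp: hit_def)
          also have "\<dots> \<le> (\<Sum>j<h. 1 - ?f j \<omega>)" using j by (intro member_le_sum) (auto simp: hit_def)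
          finally show ?thesis .
        qed
        then have "1 \<le> ?L (\<lambda>\<omega>. \<Sum>j<h. 1 - ?f j \<omega>)"
          using ex_mono[OF G, of "\<lambda>_. 1"] by (simp add: noise_const[OF G])
        also have "\<dots> = (\<Sum>j<h. 1 - ?L (?f j))"
          unfolding ex_sum[OF G] ex_linear(2)[OF G] noise_const[OF G] ..
        also have "\<dots> \<le> (\<Sum>j<h. 1 / (2 * real h))" using hitj by (intro sum_mono) (auto simp: algebra_simps)
        also have "\<dots> = 1 / 2" using h by simp
        finally show False by simp
      qed
      then obtain \<omega> where "\<forall>j<h. ?f j \<omega> = 1" by blast
      then have "\<forall>j<h. \<exists>x\<in>A j. \<forall>i\<in>I j. open_at m (2 * h) (2 * j) (\<omega> (i, grp m (2 * h) (x i))) (x i)"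
        by (simp only: hit_def of_bool_eq_1_iff)
      then obtain x where x: "\<forall>j<h. x j \<in> A j \<and> (\<forall>i\<in>I j. open_at m (2 * h) (2 * j) (\<omega> (i, grp m (2 * h) (x j i))) (x j i))"
        by metis
      have "x j i \<noteq> x j' i" if j: "j < h" "j' < h" "j \<noteq> j'" "i \<in> I j \<inter> I j'" for j j' i
      proof
        assume eq: "x j i = x j' i"
        let ?g = "grp m (2 * h) (x j i)"
        have sm: "0 < 2 * h" "2 * h \<le> m" using h m by auto
        have "opn (2 * j) (\<omega> (i, ?g)) (sz m (2 * h) ?g) (pos m (2 * h) (x j i))"
          "opn (2 * j') (\<omega> (i, ?g)) (sz m (2 * h) ?g) (pos m (2 * h) (x j i))"
          using x j eq unfolding open_at_def by (metis IntD1, metis IntD2)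
        then have "j = j'" using j(1,2) by (rule opn_disjoint) (use sz_bounds(1)[OF sm grp_less[OF sm]] in auto)
        then show False using j by simp
      qed
      then show "\<exists>x. (\<forall>j<h. x j \<in> A j) \<and> (\<forall>j<h. \<forall>j'<h. j \<noteq> j' \<longrightarrow> (\<forall>i\<in>I j \<inter> I j'. x j i \<noteq> x j' i))"
        using x by blast
    qed
  qed
qed (rule that[of 0 0], simp)

subsection \<open>Restrictions of uncapturable families\<close>

lemma card_agreeing_le:
  assumes "finite I" "A \<subseteq> cube m I" "F \<subseteq> I" "\<And>x i. x \<in> A \<Longrightarrow> i \<in> F \<Longrightarrow> x i = b i"
  shows "inj_on (\<lambda>x. restrict x (I - F)) A" "(\<lambda>x. restrict x (I - F)) ` A \<subseteq> cube m (I - F)"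
    "card A * m ^ card F \<le> m ^ card I"
proof -
  show inj: "inj_on (\<lambda>x. restrict x (I - F)) A"
  proof (rule inj_onI)
    fix x y assume xy: "x \<in> A" "y \<in> A" "restrict x (I - F) = restrict y (I - F)"
    then have "x \<in> cube m I" "y \<in> cube m I" using assms by auto
    then show "x = y" unfolding cube_def
    proof (rule PiE_ext)
      fix i assume "i \<in> I"
      then show "x i = y i" using assms(4)[of x i] assms(4)[of y i] xy(1,2) fun_cong[OF xy(3), of i]
        by (cases "i \<in> F") auto
    qed
  qed
  show img: "(\<lambda>x. restrict x (I - F)) ` A \<subseteq> cube m (I - F)"
    using assms(2) by (auto simp: cube_def PiE_def Pi_def)
  have "card A \<le> card (cube m (I - F))"
    using assms(1) by (intro card_inj_on_le[OF inj img] finite_cube) auto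
  also have "\<dots> = m ^ card (I - F)" using assms(1) by (intro card_cube) auto
  finally have "card A * m ^ card F \<le> m ^ card (I - F) * m ^ card F" by (rule mult_right_mono) simp
  also have "\<dots> = m ^ card I"
    using assms(1,3) by (simp add: card_Diff_subset finite_subset card_mono flip: power_add)
  finally show "card A * m ^ card F \<le> m ^ card I" .
qed

text \<open>Maximise the number of members agreeing with \<open>b\<close> on \<open>F\<close>,
  weighted by \<open>m powr ((1 - \<gamma>) * card F)\<close>. Maximality against larger sets is the
  globalness claim, and against the empty set it keeps the density. Since a restriction has at most
  \<open>m ^ (card I - card F)\<close> members, each fixed coordinate gains a factor
  \<open>m powr \<gamma>\<close> in density, which bounds \<open>card F\<close>.\<close>

lemma ex_global_restriction:
  fixes \<gamma> :: real
  assumes I: "finite I" and A: "A \<subseteq> cube m I" and m: "2 \<le> m"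
    and dens: "real m ^ card I \<le> real (card A) * real m ^ k"
  obtains F b where "F \<subseteq> I" "\<gamma> * real (card F) \<le> real k"
    "real m ^ card I \<le> real (card {x \<in> A. \<forall>i\<in>F. x i = b i}) * real m powr ((1 - \<gamma>) * card F) * real m ^ k"
    "\<And>B b'. B \<subseteq> I - F \<Longrightarrow> real (card {x \<in> {x \<in> A. \<forall>i\<in>F. x i = b i}. \<forall>i\<in>B. x i = b' i}) * real m powr ((1 - \<gamma>) * card B)
       \<le> real (card {x \<in> A. \<forall>i\<in>F. x i = b i})"
proof -
  define agr where "agr F b = {x \<in> A. \<forall>i\<in>F. x i = b i}" for F and b :: "nat \<Rightarrow> nat"
  define wt where "wt p = real (card (agr (fst p) (snd p))) * real m powr ((1 - \<gamma>) * card (fst p))" for p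
  have finA: "finite A" using A I finite_cube finite_subset by blast
  have "0 < real m ^ card I" using m by simp
  then have "0 < real (card A) * real m ^ k" using dens by (rule order.strict_trans2)
  then have A0: "A \<noteq> {}" by auto
  \<comment> \<open>Taking the prescribed values from members of \<open>A\<close> makes the maximum
    finite; every nonempty restriction is described by one of its members.\<close>
  let ?S = "Pow I \<times> A"
  have S: "finite (wt ` ?S)" "wt ` ?S \<noteq> {}" using finA I A0 by auto
  obtain p where p: "p \<in> ?S" "wt p = Max (wt ` ?S)" using Max_in[OF S] by auto
  obtain F b where Fb: "p = (F, b)" by (cases p)
  have F: "F \<subseteq> I" using p Fb by auto
  have max: "real (card (agr F' b')) * real m powr ((1 - \<gamma>) * card F') \<le> real (card (agr F b)) * real m powr ((1 - \<gamma>) * card F)"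
    if "F' \<subseteq> I" for F' b'
  proof (cases "agr F' b' = {}")
    case True
    then show ?thesis by simp
  next
    case False
    then obtain x where x: "x \<in> A" "\<forall>i\<in>F'. x i = b' i" by (auto simp: agr_def)
    then have "agr F' x = agr F' b'" by (auto simp: agr_def)
    moreover have "wt (F', x) \<le> wt p" unfolding p(2) using x that by (intro Max_ge S) auto
    ultimately show ?thesis by (simp add: wt_def Fb)
  qed
  let ?G = "agr F b"
  have G: "?G \<subseteq> cube m I" using A by (auto simp: agr_def)
  have "real (card A) \<le> real (card ?G) * real m powr ((1 - \<gamma>) * card F)"
    using max[of "{}" b] m by (simp add: agr_def)
  then have "real (card A) * real m ^ k \<le> real (card ?G) * real m powr ((1 - \<gamma>) * card F) * real m ^ k"
    by (intro mult_right_mono) auto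
  then have dens': "real m ^ card I \<le> real (card ?G) * real m powr ((1 - \<gamma>) * card F) * real m ^ k"
    using dens by linarith
  have "\<gamma> * real (card F) \<le> real k"
  proof -
    have "card ?G * m ^ card F \<le> m ^ card I"
      using card_agreeing_le(3)[OF I G F, of b] by (auto simp: agr_def)
    then have le: "real (card ?G) * real m ^ card F \<le> real m ^ card I"
      by (metis of_nat_le_iff of_nat_mult of_nat_power)
    have eq: "real m powr ((1 - \<gamma>) * card F) = real m ^ card F * real m powr (- (\<gamma> * card F))"
      using m by (simp add: powr_realpow[symmetric] algebra_simps flip: powr_add)
    have "real m ^ card I \<le> (real (card ?G) * real m ^ card F) * (real m powr (- (\<gamma> * card F)) * real m ^ k)"
      using dens' unfolding eq by (simp add: mult_ac)
    also have "\<dots> \<le> real m ^ card I * (real m powr (- (\<gamma> * card F)) * real m ^ k)"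
      by (intro mult_right_mono le) auto
    finally have "1 \<le> real m powr (- (\<gamma> * card F)) * real m ^ k" using m by simp
    also have "\<dots> = real m powr (real k - \<gamma> * card F)"
      using m by (simp add: powr_realpow[symmetric] algebra_simps flip: powr_add)
    finally have "real m powr 0 \<le> real m powr (real k - \<gamma> * card F)" using m by simp
    then show ?thesis using m by (subst (asm) powr_le_cancel_iff) auto
  qed
  moreover have "real (card {x \<in> ?G. \<forall>i\<in>B. x i = b' i}) * real m powr ((1 - \<gamma>) * card B) \<le> real (card ?G)"
    if B: "B \<subseteq> I - F" for B b'
  proof -
    have fin: "finite F" "finite B" "F \<inter> B = {}"
      using F B finite_subset[OF F I] finite_subset[OF B finite_Diff[OF I]] by auto
    have eq: "{x \<in> ?G. \<forall>i\<in>B. x i = b' i} = agr (F \<union> B) (\<lambda>i. if i \<in> F then b i else b' i)"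
      using B by (auto simp: agr_def)
    have FB: "F \<union> B \<subseteq> I" using F B by blast
    have "real (card {x \<in> ?G. \<forall>i\<in>B. x i = b' i}) * real m powr ((1 - \<gamma>) * card (F \<union> B))
       \<le> real (card ?G) * real m powr ((1 - \<gamma>) * card F)"
      unfolding eq by (rule max[OF FB])
    moreover have "real m powr ((1 - \<gamma>) * card (F \<union> B)) = real m powr ((1 - \<gamma>) * card B) * real m powr ((1 - \<gamma>) * card F)"
      using fin by (simp add: card_Un_disjoint algebra_simps flip: powr_add)
    ultimately show ?thesis using m by (simp flip: mult.assoc)
  qed
  ultimately show thesis using that[OF F] dens' unfolding agr_def by blast
qed

text \<open>A letter is light if it has less than half of its uniform share. Let \<open>Z\<close>
  count the light letters of \<open>x\<close> at the coordinates in \<open>S\<close>; its mean is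
  \<open>T\<close> on the cube but at most \<open>T / 2\<close> on \<open>C\<close>. Comparing the
  sums of \<open>exp (- Z x)\<close> over both sets shows that \<open>C\<close> is smaller than the
  cube by a factor exponential in \<open>T\<close>.\<close>

lemma few_light_coordinates:
  assumes I: "finite I" and C: "C \<subseteq> cube m I" "C \<noteq> {}" and m: "0 < m" and h: "0 < h"
  shows "real (card {i \<in> I. m \<le> 2 * h * card {b \<in> {1..m}. 2 * m * card {x \<in> C. x i = b} < card C}})
    \<le> 20 * real h * ln (real m ^ card I / real (card C))"
proof -
  define L where "L i = {b \<in> {1..m}. 2 * m * card {x \<in> C. x i = b} < card C}" for i
  define S where "S = {i \<in> I. m \<le> 2 * h * card (L i)}"
  define T where "T = (\<Sum>i\<in>S. real (card (L i)) / real m)"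
  define Z where "Z x = (\<Sum>i\<in>S. of_bool (x i \<in> L i) :: real)" for x
  have S: "S \<subseteq> I" "finite S" using I by (auto simp: S_def)
  have finC: "finite C" using C I finite_cube finite_subset by blast
  have C0: "0 < real (card C)" using finC C by (simp add: card_gt_0_iff)
  have T_ge: "real (card S) \<le> 2 * real h * T"
  proof -
    have "1 \<le> 2 * real h * (real (card (L i)) / real m)" if "i \<in> S" for i
    proof -
      have "real m \<le> real (2 * h * card (L i))" using that unfolding S_def by (simp only: mem_Collect_eq of_nat_le_iff)
      then show ?thesis using m by (simp add: field_simps)
    qed
    then have "(\<Sum>i\<in>S. 1) \<le> (\<Sum>i\<in>S. 2 * real h * (real (card (L i)) / real m))" by (rule sum_mono)
    then show ?thesis by (simp add: T_def sum_distrib_left)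
  qed
  have sumZ: "(\<Sum>x\<in>C. Z x) \<le> real (card C) * T / 2"
  proof -
    have "(\<Sum>x\<in>C. Z x) = (\<Sum>i\<in>S. \<Sum>x\<in>C. of_bool (x i \<in> L i))" unfolding Z_def by (rule sum.swap)
    also have "\<dots> \<le> (\<Sum>i\<in>S. real (card (L i)) * (real (card C) / (2 * real m)))"
    proof (rule sum_mono)
      fix i
      have L: "finite (L i)" by (simp add: L_def)
      have "(\<Sum>x\<in>C. of_bool (x i \<in> L i)) = (\<Sum>x\<in>C. \<Sum>b\<in>L i. of_bool (x i = b) :: real)"
        using L by (intro sum.cong refl) (simp add: of_bool_def sum.delta)
      also have "\<dots> = (\<Sum>b\<in>L i. \<Sum>x\<in>C. of_bool (x i = b))" by (rule sum.swap)
      also have "\<dots> = (\<Sum>b\<in>L i. real (card {x \<in> C. x i = b}))"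
        using finC by (intro sum.cong refl) (simp add: of_bool_def sum.If_cases Int_def)
      also have "\<dots> \<le> (\<Sum>b\<in>L i. real (card C) / (2 * real m))"
      proof (rule sum_mono)
        fix b assume "b \<in> L i"
        then have "2 * m * card {x \<in> C. x i = b} \<le> card C" by (simp add: L_def)
        then have "real (2 * m * card {x \<in> C. x i = b}) \<le> real (card C)" by (simp only: of_nat_le_iff)
        then show "real (card {x \<in> C. x i = b}) \<le> real (card C) / (2 * real m)"
          using m by (simp add: field_simps)
      qed
      finally show "(\<Sum>x\<in>C. of_bool (x i \<in> L i)) \<le> real (card (L i)) * (real (card C) / (2 * real m))" by simp
    qed
    also have "\<dots> = real (card C) * T / 2" by (simp add: T_def sum_distrib_left sum_divide_distrib field_simps)
    finally show ?thesis .
  qed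
  \<comment> \<open>Jensen's inequality for the exponential, by its tangent at
    \<open>- T / 2\<close>.\<close>
  have "real (card C) * exp (- (T / 2)) \<le> (\<Sum>x\<in>C. exp (- Z x))"
  proof -
    have "real (card C) * exp (- (T / 2)) \<le> exp (- (T / 2)) * (real (card C) * (1 + T / 2) - (\<Sum>x\<in>C. Z x))"
      using sumZ by (subst mult.commute, intro mult_left_mono) (auto simp: algebra_simps)
    also have "real (card C) * (1 + T / 2) - (\<Sum>x\<in>C. Z x) = (\<Sum>x\<in>C. 1 + (T / 2 - Z x))"
      by (simp add: sum.distrib sum_subtractf algebra_simps)
    also have "exp (- (T / 2)) * \<dots> = (\<Sum>x\<in>C. exp (- (T / 2)) * (1 + (T / 2 - Z x)))"
      by (rule sum_distrib_left)
    also have "\<dots> \<le> (\<Sum>x\<in>C. exp (- (T / 2)) * exp (T / 2 - Z x))"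
      by (intro sum_mono mult_left_mono exp_ge_add_one_self) auto
    also have "\<dots> = (\<Sum>x\<in>C. exp (- Z x))" by (simp flip: exp_add)
    finally show ?thesis .
  qed
  also have "\<dots> \<le> (\<Sum>x\<in>cube m I. exp (- Z x))" using C I by (intro sum_mono2 finite_cube) auto
  also have "\<dots> = (\<Sum>x\<in>cube m I. \<Prod>i\<in>I. exp (- of_bool (i \<in> S \<and> x i \<in> L i)))"
  proof (intro sum.cong refl)
    fix x
    have "exp (- Z x) = (\<Prod>i\<in>S. exp (- of_bool (x i \<in> L i)))"
      unfolding Z_def sum_negf[symmetric] by (rule exp_sum[OF S(2)])
    also have "\<dots> = (\<Prod>i\<in>I. exp (- of_bool (i \<in> S \<and> x i \<in> L i)))"
      using S I by (intro prod.mono_neutral_cong_left) auto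
    finally show "exp (- Z x) = (\<Prod>i\<in>I. exp (- of_bool (i \<in> S \<and> x i \<in> L i)))" .
  qed
  also have "\<dots> = (\<Prod>i\<in>I. \<Sum>b\<in>{1..m}. exp (- of_bool (i \<in> S \<and> b \<in> L i)))"
    unfolding cube_def using I by (intro prod_sum_PiE[symmetric]) auto
  \<comment> \<open>The rate 3/5 comes from \<open>exp (- 1) \<le> 2 / 5\<close>. It exceeds the 1/2
    of the lower bound by 1/10, and this gap produces the constant 20.\<close>
  also have "\<dots> \<le> (\<Prod>i\<in>I. real m * exp (- (3 / 5) * (if i \<in> S then real (card (L i)) / real m else 0)))"
  proof (intro prod_mono conjI sum_nonneg)
    fix i
    show "(\<Sum>b\<in>{1..m}. exp (- of_bool (i \<in> S \<and> b \<in> L i))) \<le> real m * exp (- (3 / 5) * (if i \<in> S then real (card (L i)) / real m else 0))"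
    proof (cases "i \<in> S")
      case True
      let ?\<beta> = "real (card (L i)) / real m"
      have "5 / 2 \<le> exp (1 :: real)" using exp_lower_Taylor_quadratic[of 1] by simp
      then have e1: "exp (- 1 :: real) \<le> 2 / 5" by (simp add: exp_minus field_simps)
      have "(\<Sum>b\<in>{1..m}. exp (- of_bool (i \<in> S \<and> b \<in> L i))) \<le> (\<Sum>b\<in>{1..m}. 1 - (3 / 5) * (of_bool (b \<in> L i) :: real))"
        using e1 True by (intro sum_mono) auto
      also have "\<dots> = real m - (3 / 5) * real (card (L i))"
      proof -
        have *: "(\<Sum>b\<in>{1..m}. of_bool (b \<in> L i) :: real) = real (card (L i))"
          by (simp add: of_bool_def sum.If_cases) (auto simp: L_def Int_def intro: arg_cong[where f = card])
        show ?thesis unfolding sum_subtractf sum_distrib_left[symmetric] * by simp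
      qed
      also have "\<dots> = real m * (1 + - (3 / 5) * ?\<beta>)" using m by (simp add: field_simps)
      also have "\<dots> \<le> real m * exp (- (3 / 5) * ?\<beta>)" by (intro mult_left_mono exp_ge_add_one_self) auto
      finally show ?thesis using True by simp
    qed simp
  qed simp
  also have "\<dots> = real m ^ card I * exp (- (3 / 5) * T)"
  proof -
    have "(\<Prod>i\<in>I. exp (- (3 / 5) * (if i \<in> S then real (card (L i)) / real m else 0)))
      = exp (\<Sum>i\<in>I. - (3 / 5) * (if i \<in> S then real (card (L i)) / real m else 0))"
      by (rule exp_sum[OF I, symmetric])
    also have "(\<Sum>i\<in>I. - (3 / 5) * (if i \<in> S then real (card (L i)) / real m else 0)) = - (3 / 5) * T"
      unfolding T_def sum_distrib_left[symmetric] using S I by (simp add: sum.If_cases Int_absorb1)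
    finally show ?thesis by (simp add: prod.distrib)
  qed
  finally have "real (card C) * exp (- (T / 2)) \<le> real m ^ card I * exp (- (3 / 5) * T)" .
  then have "real (card C) * exp (- (T / 2)) * exp (3 / 5 * T) \<le> real m ^ card I * exp (- (3 / 5) * T) * exp (3 / 5 * T)"
    by (intro mult_right_mono) auto
  then have "real (card C) * exp (T / 10) \<le> real m ^ card I" by (simp add: mult.assoc flip: exp_add)
  then have "exp (T / 10) \<le> real m ^ card I / real (card C)" using C0 by (simp add: field_simps)
  then have "T / 10 \<le> ln (real m ^ card I / real (card C))" by (subst ln_ge_iff) (use C0 m in auto)
  then have "2 * real h * T \<le> 2 * real h * (10 * ln (real m ^ card I / real (card C)))" by (intro mult_left_mono) auto
  then show ?thesis using T_ge unfolding S_def L_def by linarith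
qed

lemma uncapturableD:
  assumes unc: "uncapturable m I r \<epsilon> A" and I: "finite I" and m: "0 < m" and D: "D \<subseteq> I \<times> {1..m}" "card D \<le> r"
  shows "\<epsilon> * real m ^ card I < real (card {x \<in> A. \<forall>(i, a)\<in>D. x i \<noteq> a})"
proof -
  have A: "A \<subseteq> cube m I" using unc by (simp add: uncapturable_def)
  have "\<epsilon> < mu m I (A - (\<Union>(i,a)\<in>D. dictator m I i a))" using unc D by (auto simp: uncapturable_def)
  also have "(A - (\<Union>(i,a)\<in>D. dictator m I i a)) \<inter> cube m I = {x \<in> A. \<forall>(i, a)\<in>D. x i \<noteq> a}"
    using A by (auto simp: dictator_def)
  then have "mu m I (A - (\<Union>(i,a)\<in>D. dictator m I i a)) = real (card {x \<in> A. \<forall>(i, a)\<in>D. x i \<noteq> a}) / real m ^ card I"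
    by (simp add: mu_def card_cube[OF I])
  finally show ?thesis using m by (simp add: field_simps)
qed

lemma card_avoiding_ge:
  fixes c :: real
  assumes "finite G" "finite E" "\<And>i a. (i, a) \<in> E \<Longrightarrow> real (card {x \<in> G. x i = a}) \<le> c" "real (card E) * c \<le> real (card G) / 2"
  shows "real (card G) / 2 \<le> real (card {x \<in> G. \<forall>(i, a)\<in>E. x i \<noteq> a})"
proof -
  let ?P = "{x \<in> G. \<forall>(i, a)\<in>E. x i \<noteq> a}" and ?U = "\<Union>(i, a)\<in>E. {x \<in> G. x i = a}"
  have "card G = card (?P \<union> ?U)" by (rule arg_cong[where f = card]) auto
  moreover have "card (?P \<union> ?U) \<le> card ?P + card ?U" by (rule card_Un_le)
  moreover have "card ?U \<le> (\<Sum>(i, a)\<in>E. card {x \<in> G. x i = a})"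
    using card_UN_le[OF assms(2), of "\<lambda>(i, a). {x \<in> G. x i = a}"] by (simp add: case_prod_unfold)
  ultimately have "card G \<le> card ?P + (\<Sum>(i, a)\<in>E. card {x \<in> G. x i = a})" by linarith
  then have "real (card G) \<le> real (card ?P) + real (\<Sum>(i, a)\<in>E. card {x \<in> G. x i = a})"
    by (simp only: of_nat_add[symmetric] of_nat_le_iff)
  moreover have "real (\<Sum>(i, a)\<in>E. card {x \<in> G. x i = a}) \<le> (\<Sum>p\<in>E. c)"
    unfolding of_nat_sum by (intro sum_mono) (use assms(3) in auto)
  ultimately show ?thesis using assms(4) by simp
qed

subsection \<open>Planting the agreements\<close>

text \<open>
  The families are restricted in the order of their indices: \<open>A j\<close> first loses the values fixed for
  the earlier ones and is then restricted to \<open>b j\<close> on \<open>F j\<close>.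
\<close>

definition core :: "(nat \<Rightarrow> (nat \<Rightarrow> nat) set) \<Rightarrow> (nat \<Rightarrow> nat set) \<Rightarrow> (nat \<Rightarrow> nat set) \<Rightarrow> (nat \<Rightarrow> nat \<Rightarrow> nat) \<Rightarrow> nat \<Rightarrow> (nat \<Rightarrow> nat) set" where
  "core A I F b j = {x \<in> A j. (\<forall>j'<j. \<forall>i\<in>F j' \<inter> I j. x i \<noteq> b j' i) \<and> (\<forall>i\<in>F j. x i = b j i)}"

text \<open>The values fixed for earlier families amount to at most \<open>h * K\<close> dictators,
  so uncapturability keeps density \<open>1 / m ^ k\<close> when they are removed. Only then is the
  next family restricted, and its fixed values cannot coincide with the earlier ones.\<close>

lemma ex_global_cores:
  fixes \<gamma> :: real
  assumes m: "2 \<le> m" and \<gamma>: "0 < \<gamma>" and K: "real k / \<gamma> \<le> real K" and r: "h * K \<le> r"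
    and A: "\<And>j. j < h \<Longrightarrow> finite (I j) \<and> uncapturable m (I j) r (1 / real m ^ k) (A j)"
  shows "\<exists>F b. \<forall>j<h. F j \<subseteq> I j \<and> card (F j) \<le> K \<and>
    real m ^ card (I j) \<le> real (card (core A I F b j)) * real m powr ((1 - \<gamma>) * card (F j)) * real m ^ k \<and>
    (\<forall>B b'. B \<subseteq> I j - F j \<longrightarrow> real (card {x \<in> core A I F b j. \<forall>i\<in>B. x i = b' i}) * real m powr ((1 - \<gamma>) * card B)
       \<le> real (card (core A I F b j)))"
proof -
  let ?P = "\<lambda>F b j. F j \<subseteq> I j \<and> card (F j) \<le> K \<and>
    real m ^ card (I j) \<le> real (card (core A I F b j)) * real m powr ((1 - \<gamma>) * card (F j)) * real m ^ k \<and>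
    (\<forall>B b'. B \<subseteq> I j - F j \<longrightarrow> real (card {x \<in> core A I F b j. \<forall>i\<in>B. x i = b' i}) * real m powr ((1 - \<gamma>) * card B)
       \<le> real (card (core A I F b j)))"
  have "\<exists>F b. \<forall>j<n. ?P F b j" if "n \<le> h" for n
    using that
  proof (induction n)
    case (Suc n)
    then obtain F b where Fb: "\<forall>j<n. ?P F b j" by auto
    have n: "n < h" using Suc.prems by simp
    have I: "finite (I n)" and unc: "uncapturable m (I n) r (1 / real m ^ k) (A n)" using A[OF n] by auto
    have An: "A n \<subseteq> cube m (I n)" using unc by (simp add: uncapturable_def)
    \<comment> \<open>Cut down to pairs that form dictators on \<open>I n\<close>; values outside
      the alphabet are avoided by every member anyway, as \<open>A0_eq\<close> records.\<close>
    define D where "D = (\<Union>j<n. (\<lambda>i. (i, b j i)) ` F j) \<inter> I n \<times> {1..m}"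
    have finF: "finite (F j)" if "j < n" for j using Fb that A[of j] n finite_subset by (metis order.strict_trans)
    have "card D \<le> card (\<Union>j<n. (\<lambda>i. (i, b j i)) ` F j)"
      unfolding D_def using finF by (intro card_mono) auto
    also have "\<dots> \<le> (\<Sum>j<n. card ((\<lambda>i. (i, b j i)) ` F j))" by (rule card_UN_le) simp
    also have "\<dots> \<le> (\<Sum>j<n. K)" using Fb finF by (intro sum_mono) (meson card_image_le lessThan_iff order.trans)
    also have "\<dots> \<le> h * K" using n by simp
    finally have cD: "card D \<le> r" using r by simp
    define A0 where "A0 = {x \<in> A n. \<forall>(i, a)\<in>D. x i \<noteq> a}"
    have "1 / real m ^ k * real m ^ card (I n) < real (card A0)"
      unfolding A0_def using m by (intro uncapturableD[OF unc I _ _ cD]) (auto simp: D_def)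
    then have dens: "real m ^ card (I n) \<le> real (card A0) * real m ^ k" using m by (simp add: field_simps)
    have A0: "A0 \<subseteq> cube m (I n)" using An by (auto simp: A0_def)
    have A0_eq: "A0 = {x \<in> A n. \<forall>j<n. \<forall>i\<in>F j \<inter> I n. x i \<noteq> b j i}"
    proof -
      have "(\<forall>(i, a)\<in>D. x i \<noteq> a) \<longleftrightarrow> (\<forall>j<n. \<forall>i\<in>F j \<inter> I n. x i \<noteq> b j i)" if "x \<in> A n" for x
      proof -
        have "x i \<in> {1..m}" if "i \<in> I n" for i
          using \<open>x \<in> A n\<close> An that unfolding cube_def by (meson PiE_mem subsetD)
        then show ?thesis unfolding D_def by force
      qed
      then show ?thesis unfolding A0_def by blast
    qed
    show ?case
    proof (rule ex_global_restriction[OF I A0 m dens, of \<gamma>])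
      fix F0 b0
      assume F0: "F0 \<subseteq> I n" "\<gamma> * real (card F0) \<le> real k"
        "real m ^ card (I n) \<le> real (card {x \<in> A0. \<forall>i\<in>F0. x i = b0 i}) * real m powr ((1 - \<gamma>) * card F0) * real m ^ k"
        "\<And>B b'. B \<subseteq> I n - F0 \<Longrightarrow> real (card {x \<in> {x \<in> A0. \<forall>i\<in>F0. x i = b0 i}. \<forall>i\<in>B. x i = b' i}) * real m powr ((1 - \<gamma>) * card B)
          \<le> real (card {x \<in> A0. \<forall>i\<in>F0. x i = b0 i})"
      have core_n: "core A I (F(n := F0)) (b(n := b0)) n = {x \<in> A0. \<forall>i\<in>F0. x i = b0 i}"
        unfolding core_def A0_eq by auto
      have core_j: "core A I (F(n := F0)) (b(n := b0)) j = core A I F b j" if "j < n" for j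
        unfolding core_def using that by auto
      have "card F0 \<le> K"
      proof -
        have "real (card F0) \<le> real k / \<gamma>" using F0(2) \<gamma> by (simp add: pos_le_divide_eq mult.commute)
        then show ?thesis using K by linarith
      qed
      then have Pn: "?P (F(n := F0)) (b(n := b0)) n"
        unfolding core_n using F0 by simp
      have Pj: "?P (F(n := F0)) (b(n := b0)) j" if "j < n" for j
        unfolding core_j[OF that] using Fb that by simp
      show ?case
      proof (rule exI[of _ "F(n := F0)"], rule exI[of _ "b(n := b0)"], rule allI, rule impI)
        fix j assume "j < Suc n"
        then consider "j = n" | "j < n" by linarith
        then show "?P (F(n := F0)) (b(n := b0)) j"
        proof cases
          case 1
          show ?thesis unfolding 1 by (rule Pn)
        next
          case 2
          then show ?thesis by (rule Pj)
        qed
      qed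
    qed
  qed simp
  from this[of h] show ?thesis by simp
qed

lemma ex_planted_coordinates:
  fixes vtx :: "nat \<Rightarrow> nat \<Rightarrow> 'v"
  assumes m: "3 \<le> m" and V: "finite V" "2 * card V \<le> m" and vtx: "\<And>j q. j < h \<Longrightarrow> q < l \<Longrightarrow> vtx j q \<in> V"
    and C: "\<And>j. j < h \<Longrightarrow> finite (I j) \<and> C j \<subseteq> cube m (I j) \<and> J \<subseteq> I j \<and> real m ^ card (I j) \<le> real (card (C j)) * real m ^ M"
    and J: "finite J" "20 * real h * real h * real (M + 2 * l) * ln (real m) + real l < real (card J)"
  shows "\<exists>\<Phi> val. inj_on \<Phi> {..<l} \<and> \<Phi> ` {..<l} \<subseteq> J \<and> (\<forall>q<l. inj_on (val q) V) \<and>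
    (\<forall>j<h. card (C j) \<le> card {x \<in> C j. \<forall>q<l. x (\<Phi> q) = val q (vtx j q)} * (2 * m) ^ l)"
proof -
  let ?P = "\<lambda>n \<Phi> val. inj_on \<Phi> {..<n} \<and> \<Phi> ` {..<n} \<subseteq> J \<and> (\<forall>q<n. inj_on (val q) V) \<and>
    (\<forall>j<h. card (C j) \<le> card {x \<in> C j. \<forall>q<n. x (\<Phi> q) = val q (vtx j q)} * (2 * m) ^ n)"
  have "\<exists>\<Phi> val. ?P n \<Phi> val" if "n \<le> l" for n
    using that
  proof (induction n)
    case (Suc n)
    then obtain \<Phi> val where P: "?P n \<Phi> val" by auto
    have n: "n < l" using Suc.prems by simp
    define C' where "C' j = {x \<in> C j. \<forall>q<n. x (\<Phi> q) = val q (vtx j q)}" for j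
    define light where "light j i = {b \<in> {1..m}. 2 * m * card {x \<in> C' j. x i = b} < card (C' j)}" for j i
    define Bad where "Bad j = {i \<in> I j. m \<le> 2 * h * card (light j i)}" for j
    have lnm: "0 \<le> ln (real m)" using m by simp
    have bad: "real (card (Bad j)) \<le> 20 * real h * (real (M + 2 * l) * ln (real m))" if j: "j < h" for j
    proof -
      have I: "finite (I j)" "C' j \<subseteq> cube m (I j)" using C[OF j] by (auto simp: C'_def)
      have "card (C j) \<le> card (C' j) * (2 * m) ^ n" using P j unfolding C'_def by blast
      \<comment> \<open>Writing the loss as a power of \<open>m\<close> keeps the logarithm of the
        density a multiple of \<open>ln m\<close>, which the size of \<open>J\<close> can
        outweigh.\<close>
      also have "\<dots> \<le> card (C' j) * m ^ (2 * n)"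
      proof (intro mult_left_mono)
        have "(2 * m) ^ n \<le> (m * m) ^ n" using m by (intro power_mono) auto
        then show "(2 * m) ^ n \<le> m ^ (2 * n)" by (simp add: power_mult power2_eq_square)
      qed simp
      finally have "real (card (C j)) \<le> real (card (C' j)) * real m ^ (2 * n)"
        by (metis of_nat_le_iff of_nat_mult of_nat_power)
      then have "real (card (C j)) * real m ^ M \<le> real (card (C' j)) * real m ^ (2 * n) * real m ^ M"
        by (intro mult_right_mono) auto
      then have le: "real m ^ card (I j) \<le> real (card (C' j)) * real m ^ (M + 2 * n)"
        using C[OF j] by (simp add: power_add mult_ac)
      have "0 < real m ^ card (I j)" using m by simp
      then have "0 < real (card (C' j)) * real m ^ (M + 2 * n)" using le by (rule order.strict_trans2)
      then have pos: "0 < real (card (C' j))" by (simp add: zero_less_mult_iff)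
      then have "C' j \<noteq> {}" by auto
      then have "real (card (Bad j)) \<le> 20 * real h * ln (real m ^ card (I j) / real (card (C' j)))"
        unfolding Bad_def light_def using I m j by (intro few_light_coordinates) auto
      also have "\<dots> \<le> 20 * real h * (real (M + 2 * l) * ln (real m))"
      proof (intro mult_left_mono)
        have "real m ^ card (I j) / real (card (C' j)) \<le> real m ^ (M + 2 * n)"
          using le pos by (simp add: divide_le_eq mult.commute)
        then have "ln (real m ^ card (I j) / real (card (C' j))) \<le> ln (real m ^ (M + 2 * n))"
          using pos m by (subst ln_le_cancel_iff) auto
        also have "\<dots> = real (M + 2 * n) * ln (real m)" using m by (simp add: ln_realpow)
        also have "\<dots> \<le> real (M + 2 * l) * ln (real m)" using lnm n by (intro mult_right_mono) auto
        finally show "ln (real m ^ card (I j) / real (card (C' j))) \<le> real (M + 2 * l) * ln (real m)" .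
      qed simp
      finally show ?thesis .
    qed
    have "\<exists>i\<in>J. i \<notin> \<Phi> ` {..<n} \<and> (\<forall>j<h. i \<notin> Bad j)"
    proof (rule ccontr)
      assume "\<not> ?thesis"
      then have "J \<subseteq> \<Phi> ` {..<n} \<union> (\<Union>j<h. Bad j)" by blast
      moreover have "finite (Bad j)" if "j < h" for j using C[OF that] by (simp add: Bad_def)
      ultimately have "card J \<le> card (\<Phi> ` {..<n} \<union> (\<Union>j<h. Bad j))" by (intro card_mono) auto
      also have "\<dots> \<le> card (\<Phi> ` {..<n}) + card (\<Union>j<h. Bad j)" by (rule card_Un_le)
      also have "\<dots> \<le> n + (\<Sum>j<h. card (Bad j))"
        using card_image_le[of "{..<n}" \<Phi>] card_UN_le[of "{..<h}" Bad] by (intro add_mono) auto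
      finally have "real (card J) \<le> real n + (\<Sum>j<h. real (card (Bad j)))"
        by (metis of_nat_add of_nat_le_iff of_nat_sum)
      also have "(\<Sum>j<h. real (card (Bad j))) \<le> (\<Sum>j<h. 20 * real h * (real (M + 2 * l) * ln (real m)))"
        using bad by (intro sum_mono) auto
      finally show False using J(2) n by (simp add: mult_ac)
    qed
    then obtain i where i: "i \<in> J" "i \<notin> \<Phi> ` {..<n}" "\<And>j. j < h \<Longrightarrow> i \<notin> Bad j" by blast
    define Good where "Good = {1..m} - (\<Union>j<h. light j i)"
    have "2 * card (\<Union>j<h. light j i) \<le> m"
    proof (cases "h = 0")
      case False
      have "2 * h * card (light j i) \<le> m" if "j < h" for j
        using i(1) i(3)[OF that] C[OF that] by (auto simp: Bad_def)
      then have "(\<Sum>j<h. 2 * h * card (light j i)) \<le> (\<Sum>j<h. m)" by (intro sum_mono) auto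
      then have "h * (2 * (\<Sum>j<h. card (light j i))) \<le> h * m" by (simp add: sum_distrib_left mult_ac)
      then have "2 * (\<Sum>j<h. card (light j i)) \<le> m" using False by simp
      moreover have "card (\<Union>j<h. light j i) \<le> (\<Sum>j<h. card (light j i))" by (rule card_UN_le) simp
      ultimately show ?thesis by linarith
    qed simp
    moreover have "card Good = m - card (\<Union>j<h. light j i)"
      unfolding Good_def by (subst card_Diff_subset) (auto simp: light_def)
    ultimately have "card V \<le> card Good" using V(2) by linarith
    then obtain v where v: "v ` V \<subseteq> Good" "inj_on v V"
      using card_le_inj[OF V(1), of Good] by (auto simp: Good_def)
    have "?P (Suc n) (\<Phi>(n := i)) (val(n := v))"
    proof (intro conjI allI impI)
      have "inj_on (\<Phi>(n := i)) (insert n {..<n})"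
        using P i(2) by (auto simp: inj_on_def)
      then show "inj_on (\<Phi>(n := i)) {..<Suc n}" by (simp only: lessThan_Suc)
      show "\<Phi>(n := i) ` {..<Suc n} \<subseteq> J" using P i(1) by (auto simp: less_Suc_eq)
      show "inj_on ((val(n := v)) q) V" if "q < Suc n" for q using P v that by (auto simp: less_Suc_eq)
      fix j assume j: "j < h"
      have "{x \<in> C j. \<forall>q<Suc n. x ((\<Phi>(n := i)) q) = (val(n := v)) q (vtx j q)} = {x \<in> C' j. x i = v (vtx j n)}"
        unfolding C'_def by (auto simp: less_Suc_eq)
      moreover have "v (vtx j n) \<in> Good" using v(1) vtx[OF j n] by blast
      then have "v (vtx j n) \<in> {1..m}" "v (vtx j n) \<notin> light j i" using j by (auto simp: Good_def)
      then have "card (C' j) \<le> 2 * m * card {x \<in> C' j. x i = v (vtx j n)}"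
        unfolding light_def mem_Collect_eq not_less by linarith
      then have "card (C' j) * (2 * m) ^ n \<le> 2 * m * card {x \<in> C' j. x i = v (vtx j n)} * (2 * m) ^ n"
        by (rule mult_right_mono) simp
      then have "card (C j) \<le> card {x \<in> C' j. x i = v (vtx j n)} * (2 * m) ^ Suc n"
        using P j unfolding C'_def[symmetric] by (auto simp: mult_ac intro: order.trans)
      ultimately show "card (C j) \<le> card {x \<in> C j. \<forall>q<Suc n. x ((\<Phi>(n := i)) q) = (val(n := v)) q (vtx j q)} * (2 * m) ^ Suc n"
        by simp
    qed
    then show ?case by blast
  qed simp
  then show ?thesis by blast
qed

section \<open>Choice of the constants and combination of cores, planting and disagreement\<close>

theorem theorem8p4:
  fixes V :: "'v set" and l h :: nat and U E :: "nat \<Rightarrow> 'v set" and s k :: nat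
  assumes "is_configuration V l U h E"
  shows "\<exists>r m0 N :: nat. \<forall>m n (R :: nat \<Rightarrow> nat set) (A :: nat \<Rightarrow> (nat \<Rightarrow> nat) set).
    m \<ge> m0 \<longrightarrow> real n \<ge> real N * ln (real m) \<longrightarrow>
    (\<forall>j<h. R j \<subseteq> {1..n} \<and> card (R j) \<le> k \<and>
       uncapturable m ({1..n} - R j) r (1 / real m ^ k) (A j)) \<longrightarrow>
    (\<exists>x. (\<forall>j<h. x j \<in> A j) \<and>
       realises m ({1..n} - (\<Union>j<h. R j)) l U h E
         (\<lambda>j. restrict (x j) ({1..n} - (\<Union>j<h. R j))))"
proof (rule ex_pairwise_disagreeing[of h "k + 1"])
  fix mp rp
  assume pairwise: "\<And>m (I :: nat \<Rightarrow> nat set) A. mp \<le> m \<Longrightarrow> (\<forall>j<h. finite (I j) \<and> A j \<subseteq> cube m (I j) \<and>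
      (\<forall>E\<subseteq>I j \<times> {1..m}. card E \<le> rp \<longrightarrow>
        1 / real m ^ (k + 1) \<le> real (card {x \<in> A j. \<forall>(i, a)\<in>E. x i \<noteq> a}) / real m ^ card (I j))) \<Longrightarrow>
    \<exists>x. (\<forall>j<h. x j \<in> A j) \<and> (\<forall>j<h. \<forall>j'<h. j \<noteq> j' \<longrightarrow> (\<forall>i\<in>I j \<inter> I j'. x j i \<noteq> x j' i))"
  have finV: "finite V" using assms by (simp add: is_configuration_def)
  have "\<exists>v. E j \<inter> U q = {v}" if "j < h" "q < l" for j q
    using assms that by (simp add: is_configuration_def card_1_singleton_iff)
  then obtain vtx where vtx: "\<And>j q. j < h \<Longrightarrow> q < l \<Longrightarrow> E j \<inter> U q = {vtx j q}" by metis
  have vtxV: "vtx j q \<in> V" if "j < h" "q < l" for j q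
  proof -
    have "E j \<subseteq> V" using assms that by (simp add: is_configuration_def)
    then show ?thesis using vtx[OF that] by blast
  qed
  \<comment> \<open>Chosen so that \<open>(1 - \<gamma>) * (l + 1) = l + 1 / 2\<close>: fixing the
    planted coordinates and one more costs m^(-l-1/2), while planting alone keeps at least a
    constant times m^(-l).\<close>
  define \<gamma> where "\<gamma> = 1 / (2 * (real l + 1))"
  \<comment> \<open>Equal to \<open>k / \<gamma>\<close>, the bound on the number of coordinates
    fixed by a restriction.\<close>
  define K where "K = 2 * k * (l + 1)"
  \<comment> \<open>Exponents \<open>K\<close> for the fixed coordinates, \<open>k\<close> for the
    original density, and 1 for the half lost by passing from \<open>G\<close> to
    \<open>C\<close>.\<close>
  define M where "M = K + k + 1"
  define r where "r = h * K"
  \<comment> \<open>The two squares let \<open>sqrt m\<close> dominate the number of removed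
    dictators, first in passing from \<open>G\<close> to \<open>C\<close> and then after planting,
    so that each time at least half of the family survives.\<close>
  define m1 where "m1 = Max {mp, 3, 2 * card V, (2 * h * K)\<^sup>2, (rp * 2 ^ (l + 2))\<^sup>2, 2 ^ (l + 2)}"
  \<comment> \<open>The first summand outweighs the bad coordinates, the next two those in some
    \<open>R j\<close> or \<open>F j\<close>; \<open>l + 1\<close> leaves room for the planted ones
    and a strict inequality.\<close>
  define N where "N = 20 * h * h * (M + 2 * l) + h * k + h * K + l + 1"
  have \<gamma>: "0 < \<gamma>" "\<gamma> \<le> 1 / 2" "(1 - \<gamma>) * (real l + 1) = real l + 1 / 2" by (auto simp: \<gamma>_def field_simps)
  have K: "real k / \<gamma> \<le> real K" by (simp add: \<gamma>_def K_def algebra_simps)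
  show ?thesis
  proof (rule exI[of _ r], rule exI[of _ m1], rule exI[of _ N], intro allI impI)
    fix m n and R :: "nat \<Rightarrow> nat set" and A :: "nat \<Rightarrow> (nat \<Rightarrow> nat) set"
    assume m: "m1 \<le> m" and n: "real N * ln (real m) \<le> real n"
      and hyp: "\<forall>j<h. R j \<subseteq> {1..n} \<and> card (R j) \<le> k \<and> uncapturable m ({1..n} - R j) r (1 / real m ^ k) (A j)"
    have m_ge: "mp \<le> m" "3 \<le> m" "2 * card V \<le> m" "(2 * h * K)\<^sup>2 \<le> m" "(rp * 2 ^ (l + 2))\<^sup>2 \<le> m" "2 ^ (l + 2) \<le> m"
      using m by (simp_all add: m1_def)
    have sqrt_ge: "real c \<le> sqrt (real m)" if "c\<^sup>2 \<le> m" for c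
      using that by (intro real_le_rsqrt) (simp flip: of_nat_power)
    have m0: "0 < real m" "1 \<le> real m" using m_ge(2) by auto
    define I where "I j = {1..n} - R j" for j
    have finI: "finite (I j)" for j by (simp add: I_def)
    have "\<And>j. j < h \<Longrightarrow> finite (I j) \<and> uncapturable m (I j) r (1 / real m ^ k) (A j)"
      using hyp by (simp add: I_def)
    then obtain F b where Fb: "\<And>j. j < h \<Longrightarrow> F j \<subseteq> I j \<and> card (F j) \<le> K \<and>
      real m ^ card (I j) \<le> real (card (core A I F b j)) * real m powr ((1 - \<gamma>) * card (F j)) * real m ^ k \<and>
      (\<forall>B b'. B \<subseteq> I j - F j \<longrightarrow> real (card {x \<in> core A I F b j. \<forall>i\<in>B. x i = b' i}) * real m powr ((1 - \<gamma>) * card B)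
         \<le> real (card (core A I F b j)))"
      using ex_global_cores[of m \<gamma> k K h r I A] m_ge(2) \<gamma>(1) K by (auto simp: r_def)
    define G where "G = core A I F b"
    have finF: "finite (F j)" if "j < h" for j using Fb[OF that] finI finite_subset by blast
    have A: "A j \<subseteq> cube m (I j)" if "j < h" for j using hyp that by (simp add: uncapturable_def I_def)
    have G: "G j \<subseteq> cube m (I j)" "finite (G j)" if "j < h" for j
    proof -
      show "G j \<subseteq> cube m (I j)" using A[OF that] by (auto simp: G_def core_def)
      then show "finite (G j)" using finite_cube[OF finI] finite_subset by blast
    qed
    have densG: "real m ^ card (I j) \<le> real (card (G j)) * real m ^ card (F j) * real m ^ k" if "j < h" for j
    proof -
      have "real m powr ((1 - \<gamma>) * card (F j)) \<le> real m powr card (F j)"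
        using m0 \<gamma> by (intro powr_mono) (auto simp: mult_left_le_one_le)
      then have "real (card (G j)) * real m powr ((1 - \<gamma>) * card (F j)) * real m ^ k \<le> real (card (G j)) * real m ^ card (F j) * real m ^ k"
        using m0 by (intro mult_right_mono mult_left_mono) (auto simp: powr_realpow)
      then show ?thesis using Fb[OF that] unfolding G_def by linarith
    qed
    have glob: "real (card {x \<in> G j. \<forall>i\<in>B. x i = b' i}) * real m powr ((1 - \<gamma>) * card B) \<le> real (card (G j))"
      if "j < h" "B \<subseteq> I j - F j" for j B b'
      using Fb[OF that(1)] that(2) unfolding G_def by blast
    \<comment> \<open>\<open>core\<close> keeps later families away from the values fixed for
      earlier ones. This is the opposite direction: family \<open>j\<close> must avoid the values
      fixed for later families. On \<open>F j\<close> itself it has no freedom, but there the later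
      families already avoid \<open>b j\<close>.\<close>
    define X where "X j = (\<Union>j'\<in>{j<..<h}. (\<lambda>i. (i, b j' i)) ` (F j' \<inter> (I j - F j)))" for j
    define C where "C j = {x \<in> G j. \<forall>(i, a)\<in>X j. x i \<noteq> a}" for j
    have cardC: "real (card (G j)) / 2 \<le> real (card (C j))" if j: "j < h" for j
    proof -
      have finX: "finite (X j)" using finF by (auto simp: X_def)
      have "card (X j) \<le> (\<Sum>j'\<in>{j<..<h}. card ((\<lambda>i. (i, b j' i)) ` (F j' \<inter> (I j - F j))))"
        unfolding X_def by (rule card_UN_le) simp
      also have "\<dots> \<le> (\<Sum>j'\<in>{j<..<h}. K)"
      proof (rule sum_mono)
        fix j' assume "j' \<in> {j<..<h}"
        then have j': "j' < h" by simp
        have "card ((\<lambda>i. (i, b j' i)) ` (F j' \<inter> (I j - F j))) \<le> card (F j' \<inter> (I j - F j))"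
          using finF[OF j'] by (intro card_image_le) simp
        also have "\<dots> \<le> card (F j')" using finF[OF j'] by (intro card_mono) auto
        finally show "card ((\<lambda>i. (i, b j' i)) ` (F j' \<inter> (I j - F j))) \<le> K" using Fb[OF j'] by linarith
      qed
      also have "\<dots> \<le> h * K" using j by simp
      finally have cX: "card (X j) \<le> h * K" .
      show ?thesis unfolding C_def
      proof (rule card_avoiding_ge[OF G(2)[OF j] finX, of "real (card (G j)) / sqrt (real m)"])
        fix i a assume "(i, a) \<in> X j"
        then have "{i} \<subseteq> I j - F j" by (auto simp: X_def)
        from glob[OF j this, of "\<lambda>_. a"]
        have "real (card {x \<in> G j. x i = a}) * real m powr (1 - \<gamma>) \<le> real (card (G j))" by simp
        moreover have "sqrt (real m) \<le> real m powr (1 - \<gamma>)"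
          using m0 \<gamma> by (simp add: powr_half_sqrt[symmetric] powr_mono)
        then have "real (card {x \<in> G j. x i = a}) * sqrt (real m) \<le> real (card {x \<in> G j. x i = a}) * real m powr (1 - \<gamma>)"
          by (intro mult_left_mono) auto
        ultimately show "real (card {x \<in> G j. x i = a}) \<le> real (card (G j)) / sqrt (real m)"
          using m0 by (simp add: pos_le_divide_eq)
      next
        have "real (card (X j)) \<le> real (h * K)" using cX by (simp only: of_nat_le_iff)
        then have "2 * real (card (X j)) \<le> real (2 * h * K)" by simp
        also have "\<dots> \<le> sqrt (real m)" by (rule sqrt_ge[OF m_ge(4)])
        finally have "2 * real (card (X j)) * real (card (G j)) \<le> sqrt (real m) * real (card (G j))"
          by (intro mult_right_mono) auto
        then show "real (card (X j)) * (real (card (G j)) / sqrt (real m)) \<le> real (card (G j)) / 2"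
          using m0 by (simp add: field_simps)
      qed
    qed
    define J where "J = {1..n} - ((\<Union>j<h. R j) \<union> (\<Union>j<h. F j))"
    have J: "finite J" "\<And>j. j < h \<Longrightarrow> J \<subseteq> I j - F j" by (auto simp: J_def I_def)
    have cardJ: "20 * real h * real h * real (M + 2 * l) * ln (real m) + real l < real (card J)"
    proof -
      have "exp 1 \<le> real m" using exp_le m_ge(2) by linarith
      then have ln1: "1 \<le> ln (real m)" using m0 by (subst ln_ge_iff) auto
      have finRF: "finite ((\<Union>j<h. R j) \<union> (\<Union>j<h. F j))"
        using hyp finF finite_subset[of _ "{1..n}"] by auto
      have "card ((\<Union>j<h. R j) \<union> (\<Union>j<h. F j)) \<le> card (\<Union>j<h. R j) + card (\<Union>j<h. F j)" by (rule card_Un_le)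
      also have "\<dots> \<le> (\<Sum>j<h. card (R j)) + (\<Sum>j<h. card (F j))" by (intro add_mono card_UN_le) auto
      also have "\<dots> \<le> (\<Sum>j<h. k) + (\<Sum>j<h. K)" using hyp Fb by (intro add_mono sum_mono) auto
      finally have "card ((\<Union>j<h. R j) \<union> (\<Union>j<h. F j)) \<le> h * k + h * K" by simp
      moreover have "card {1..n} - card ((\<Union>j<h. R j) \<union> (\<Union>j<h. F j)) \<le> card J"
        unfolding J_def by (rule diff_card_le_card_Diff[OF finRF])
      ultimately have "n \<le> card J + (h * k + h * K)" by simp
      then have "real n \<le> real (card J) + real (h * k + h * K)" by (simp only: of_nat_add[symmetric] of_nat_le_iff)
      moreover have "real (h * k + h * K + l + 1) * 1 \<le> real (h * k + h * K + l + 1) * ln (real m)"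
        using ln1 by (intro mult_left_mono) auto
      moreover have "real N * ln (real m) = 20 * real h * real h * real (M + 2 * l) * ln (real m) + real (h * k + h * K + l + 1) * ln (real m)"
        by (simp add: N_def algebra_simps)
      ultimately show ?thesis using n by simp
    qed
    have densC: "finite (I j) \<and> C j \<subseteq> cube m (I j) \<and> J \<subseteq> I j \<and> real m ^ card (I j) \<le> real (card (C j)) * real m ^ M" if j: "j < h" for j
    proof -
      have "real m ^ card (F j) \<le> real m ^ K" using Fb[OF j] m0 by (intro power_increasing) auto
      then have "real (card (G j)) * real m ^ card (F j) * real m ^ k \<le> (real m * real (card (C j))) * real m ^ K * real m ^ k"
        using cardC[OF j] m_ge(2) mult_mono[of 2 "real m" "real (card (C j))" "real (card (C j))"]
        by (intro mult_right_mono mult_mono) auto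
      also have "\<dots> = real (card (C j)) * real m ^ M" by (simp add: M_def power_add)
      finally show ?thesis using densG[OF j] G(1)[OF j] J(2)[OF j] finI by (auto simp: C_def)
    qed
    obtain \<Phi> val where \<Phi>: "inj_on \<Phi> {..<l}" "\<Phi> ` {..<l} \<subseteq> J" and val: "\<And>q. q < l \<Longrightarrow> inj_on (val q) V"
      and planted: "\<And>j. j < h \<Longrightarrow> card (C j) \<le> card {x \<in> C j. \<forall>q<l. x (\<Phi> q) = val q (vtx j q)} * (2 * m) ^ l"
      using ex_planted_coordinates[of m V h l vtx I C J M, OF m_ge(2) finV m_ge(3) vtxV densC J(1) cardJ] by blast
    define B where "B j = {x \<in> C j. \<forall>q<l. x (\<Phi> q) = val q (vtx j q)}" for j
    define S where "S j = F j \<union> \<Phi> ` {..<l}" for j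
    define A' where "A' j = (\<lambda>x. restrict x (I j - S j)) ` B j" for j
    have cond: "finite (I j - S j) \<and> A' j \<subseteq> cube m (I j - S j) \<and>
      (\<forall>E\<subseteq>(I j - S j) \<times> {1..m}. card E \<le> rp \<longrightarrow>
        1 / real m ^ (k + 1) \<le> real (card {x \<in> A' j. \<forall>(i, a)\<in>E. x i \<noteq> a}) / real m ^ card (I j - S j))" if j: "j < h" for j
    proof -
      have B: "B j \<subseteq> G j" "B j \<subseteq> cube m (I j)" using G(1)[OF j] by (auto simp: B_def C_def)
      have finB: "finite (B j)" using B(1) G(2)[OF j] finite_subset by blast
      have SI: "S j \<subseteq> I j" using Fb[OF j] \<Phi>(2) J(2)[OF j] by (auto simp: S_def)
      \<comment> \<open>A reference member; \<open>B j\<close> is not yet known to be nonempty, so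
        agreement with \<open>x0\<close> is claimed only for members of \<open>B j\<close>.\<close>
      define x0 where "x0 = (SOME x. x \<in> B j)"
      have agree: "x i = x0 i" if x: "x \<in> B j" and i: "i \<in> S j" for x i
      proof -
        have "x0 \<in> B j" unfolding x0_def using x by (rule someI[of "\<lambda>x. x \<in> B j"])
        then show ?thesis using x i by (auto simp: S_def B_def C_def G_def core_def)
      qed
      have restr: "inj_on (\<lambda>x. restrict x (I j - S j)) (B j)" "(\<lambda>x. restrict x (I j - S j)) ` B j \<subseteq> cube m (I j - S j)"
        by (rule card_agreeing_le[OF finI B(2) SI, of x0], erule (1) agree)+
      have c\<Phi>: "card (\<Phi> ` {..<l}) = l" using \<Phi>(1) by (simp add: card_image)
      have disj: "F j \<inter> \<Phi> ` {..<l} = {}" using \<Phi>(2) J(2)[OF j] by blast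
      then have cardS: "card (S j) = card (F j) + l"
        unfolding S_def using finF[OF j] c\<Phi> by (simp add: card_Un_disjoint)
      have GB: "real (card (G j)) \<le> 2 * (real (card (B j)) * (2 ^ l * real m ^ l))"
      proof -
        have "real (card (C j)) \<le> real (card (B j) * (2 * m) ^ l)" using planted[OF j] by (simp only: B_def of_nat_le_iff)
        then show ?thesis using cardC[OF j] by (simp add: power_mult_distrib)
      qed
      have "1 / real m ^ (k + 1) \<le> real (card {x \<in> A' j. \<forall>(i, a)\<in>Y. x i \<noteq> a}) / real m ^ card (I j - S j)"
        if Y: "Y \<subseteq> (I j - S j) \<times> {1..m}" "card Y \<le> rp" for Y
      proof -
        have finY: "finite Y" using Y(1) finI finite_subset[of Y "(I j - S j) \<times> {1..m}"] by auto
        define B' where "B' = {x \<in> B j. \<forall>(i, a)\<in>Y. x i \<noteq> a}"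
        have "{x \<in> A' j. \<forall>(i, a)\<in>Y. x i \<noteq> a} = (\<lambda>x. restrict x (I j - S j)) ` B'"
          unfolding A'_def B'_def using Y(1) by fastforce
        then have cA': "card {x \<in> A' j. \<forall>(i, a)\<in>Y. x i \<noteq> a} = card B'"
          using restr(1) by (simp add: card_image inj_on_subset B'_def)
        have "real (card (B j)) / 2 \<le> real (card B')"
          unfolding B'_def
        proof (rule card_avoiding_ge[OF finB finY, of "real (card (G j)) / (real m ^ l * sqrt (real m))"])
          fix i a assume "(i, a) \<in> Y"
          then have i: "i \<in> I j" "i \<notin> S j" using Y(1) by auto
          \<comment> \<open>Members of \<open>B j\<close> with a prescribed value at
            \<open>i\<close> are members of \<open>G j\<close> with \<open>l + 1\<close> prescribed
            values outside \<open>F j\<close>, to which globalness applies.\<close>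
          define Q where "Q = insert i (\<Phi> ` {..<l})"
          have Q: "Q \<subseteq> I j - F j" using i \<Phi>(2) J(2)[OF j] by (auto simp: Q_def S_def)
          have cQ: "card Q = l + 1" using i c\<Phi> by (simp add: Q_def S_def)
          have "{x \<in> B j. x i = a} \<subseteq> {x \<in> G j. \<forall>i'\<in>Q. x i' = (if i' = i then a else x0 i')}"
            using B(1) agree by (auto simp: Q_def S_def)
          then have "card {x \<in> B j. x i = a} \<le> card {x \<in> G j. \<forall>i'\<in>Q. x i' = (if i' = i then a else x0 i')}"
            using G(2)[OF j] by (intro card_mono) auto
          then have "real (card {x \<in> B j. x i = a}) * real m powr ((1 - \<gamma>) * card Q)
            \<le> real (card {x \<in> G j. \<forall>i'\<in>Q. x i' = (if i' = i then a else x0 i')}) * real m powr ((1 - \<gamma>) * card Q)"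
            by (intro mult_right_mono) auto
          also have "\<dots> \<le> real (card (G j))" by (rule glob[OF j Q])
          also have "real m powr ((1 - \<gamma>) * card Q) = real m ^ l * sqrt (real m)"
          proof -
            have "(1 - \<gamma>) * real (card Q) = real l + 1 / 2" using \<gamma>(3) by (simp add: cQ add.commute)
            then show ?thesis using m0 by (simp add: powr_add powr_realpow powr_half_sqrt)
          qed
          finally show "real (card {x \<in> B j. x i = a}) \<le> real (card (G j)) / (real m ^ l * sqrt (real m))"
            using m0 by (simp add: pos_le_divide_eq)
        next
          have "real (card Y) * 2 ^ (l + 2) \<le> real (rp * 2 ^ (l + 2))"
            using Y(2) by simp
          also have "\<dots> \<le> sqrt (real m)" by (rule sqrt_ge[OF m_ge(5)])
          finally have Y_le: "real (card Y) * 2 ^ (l + 2) \<le> sqrt (real m)" .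
          have "real (card Y) * real (card (G j)) \<le> real (card Y) * (2 * (real (card (B j)) * (2 ^ l * real m ^ l)))"
            by (intro mult_left_mono GB) simp
          also have "\<dots> = (real (card Y) * 2 ^ (l + 2)) * (real (card (B j)) * real m ^ l) / 2" by (simp add: power_add)
          also have "\<dots> \<le> sqrt (real m) * (real (card (B j)) * real m ^ l) / 2"
            by (intro divide_right_mono mult_right_mono Y_le) auto
          finally show "real (card Y) * (real (card (G j)) / (real m ^ l * sqrt (real m))) \<le> real (card (B j)) / 2"
            using m0 by (simp add: field_simps)
        qed
        then have G_le: "real (card (G j)) \<le> 2 ^ (l + 2) * real (card B') * real m ^ l"
        proof -
          have "real (card (B j)) * (2 ^ l * real m ^ l) \<le> (2 * real (card B')) * (2 ^ l * real m ^ l)"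
            using \<open>real (card (B j)) / 2 \<le> real (card B')\<close> by (intro mult_right_mono) auto
          then show ?thesis using GB by (simp add: power_add mult_ac)
        qed
        have split: "real m ^ card (I j) = real m ^ card (I j - S j) * (real m ^ card (F j) * real m ^ l)"
        proof -
          have "card (I j) = card (I j - S j) + card (S j)"
            using SI finI[of j] by (simp add: card_Diff_subset finite_subset card_mono)
          then show ?thesis by (simp add: power_add cardS)
        qed
        have "real m ^ card (I j - S j) * (real m ^ card (F j) * real m ^ l)
          \<le> (2 ^ (l + 2) * real (card B') * real m ^ l) * real m ^ card (F j) * real m ^ k"
          unfolding split[symmetric] by (rule order.trans[OF densG[OF j]]) (intro mult_right_mono G_le; simp)
        then have "real m ^ card (I j - S j) * (real m ^ card (F j) * real m ^ l)
          \<le> (2 ^ (l + 2) * real (card B') * real m ^ k) * (real m ^ card (F j) * real m ^ l)"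
          by (simp add: mult_ac)
        then have "real m ^ card (I j - S j) \<le> 2 ^ (l + 2) * real (card B') * real m ^ k"
          using m0 by (simp only: mult_le_cancel_right_pos mult_pos_pos zero_less_power)
        \<comment> \<open>The constant \<open>2 ^ (l + 2)\<close> is absorbed into one factor
          \<open>m\<close>; hence the exponent \<open>k + 1\<close> in the application of
          \<open>ex_pairwise_disagreeing\<close>.\<close>
        also have "\<dots> \<le> real m * real (card B') * real m ^ k"
        proof -
          have "real (2 ^ (l + 2)) \<le> real m" using m_ge(6) by (simp only: of_nat_le_iff)
          then show ?thesis by (intro mult_right_mono) auto
        qed
        finally have "real m ^ card (I j - S j) \<le> real (card B') * real m ^ (k + 1)" by (simp add: mult_ac)
        then show ?thesis unfolding cA' using m0 by (simp add: field_simps)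
      qed
      then show ?thesis using finI restr(2) by (simp add: A'_def)
    qed
    have "\<exists>x'. (\<forall>j<h. x' j \<in> A' j) \<and>
      (\<forall>j<h. \<forall>j'<h. j \<noteq> j' \<longrightarrow> (\<forall>i\<in>(I j - S j) \<inter> (I j' - S j'). x' j i \<noteq> x' j' i))"
      by (rule pairwise[OF m_ge(1)], intro allI impI, erule cond)
    then obtain x' where x': "\<forall>j<h. x' j \<in> A' j"
      and x'_ne: "\<forall>j<h. \<forall>j'<h. j \<noteq> j' \<longrightarrow> (\<forall>i\<in>(I j - S j) \<inter> (I j' - S j'). x' j i \<noteq> x' j' i)"
      by (elim exE conjE)
    have "\<forall>j. \<exists>x. j < h \<longrightarrow> x \<in> B j \<and> x' j = restrict x (I j - S j)" using x' by (auto simp: A'_def)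
    then obtain x where x: "\<And>j. j < h \<Longrightarrow> x j \<in> B j \<and> x' j = restrict (x j) (I j - S j)" by metis
    let ?I = "{1..n} - (\<Union>j<h. R j)"
    have II: "?I \<subseteq> I j" if "j < h" for j using that by (auto simp: I_def)
    have xG: "x j \<in> G j" if "j < h" for j using x[OF that] by (simp add: B_def C_def)
    have ne: "x j i \<noteq> x j' i" if jj: "j < j'" "j' < h" and i: "i \<in> ?I" "i \<notin> \<Phi> ` {..<l}" for j j' i
    proof -
      have j: "j < h" using jj by simp
      have iI: "i \<in> I j" "i \<in> I j'" using i II[OF j] II[OF jj(2)] by auto
      \<comment> \<open>Disagreement comes from the core of the later family, from the removal of
        \<open>X j\<close>, or from \<open>pairwise\<close>, in this order.\<close>
      consider "i \<in> F j" | "i \<notin> F j" "i \<in> F j'" | "i \<notin> F j" "i \<notin> F j'" by blast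
      then show ?thesis
      proof cases
        case 1
        then have "x j i = b j i" using xG[OF j] by (simp add: G_def core_def)
        moreover have "x j' i \<noteq> b j i" using xG[OF jj(2)] jj(1) 1 iI by (simp add: G_def core_def)
        ultimately show ?thesis by simp
      next
        case 2
        then have "x j' i = b j' i" using xG[OF jj(2)] by (simp add: G_def core_def)
        moreover have "(i, b j' i) \<in> X j" using 2 iI jj by (auto simp: X_def)
        then have "x j i \<noteq> b j' i" using x[OF j] by (auto simp: B_def C_def)
        ultimately show ?thesis by simp
      next
        case 3
        then have "i \<in> (I j - S j) \<inter> (I j' - S j')" using iI i by (auto simp: S_def)
        then show ?thesis using x'_ne[rule_format, of j j' i] x[OF j] x[OF jj(2)] jj j by auto
      qed
    qed
    have agree_iff: "x j i = x j' i \<longleftrightarrow> (\<exists>q<l. i = \<Phi> q \<and> E j \<inter> E j' \<inter> U q \<noteq> {})"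
      if j: "j < h" "j' < h" "j \<noteq> j'" and i: "i \<in> ?I" for j j' i
    proof (cases "i \<in> \<Phi> ` {..<l}")
      case True
      then obtain q where q: "q < l" "i = \<Phi> q" by blast
      have "x j i = val q (vtx j q)" "x j' i = val q (vtx j' q)" using x j q by (auto simp: B_def)
      then have "x j i = x j' i \<longleftrightarrow> vtx j q = vtx j' q"
        using val[OF q(1)] vtxV[OF j(1) q(1)] vtxV[OF j(2) q(1)] by (simp add: inj_on_eq_iff)
      also have "\<dots> \<longleftrightarrow> E j \<inter> E j' \<inter> U q \<noteq> {}"
      proof -
        have "E j \<inter> E j' \<inter> U q = (E j \<inter> U q) \<inter> (E j' \<inter> U q)" by blast
        then have "E j \<inter> E j' \<inter> U q = {vtx j q} \<inter> {vtx j' q}"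
          unfolding vtx[OF j(1) q(1)] vtx[OF j(2) q(1)] .
        then show ?thesis by (simp add: eq_commute)
      qed
      also have "\<dots> \<longleftrightarrow> (\<exists>q<l. i = \<Phi> q \<and> E j \<inter> E j' \<inter> U q \<noteq> {})"
        using q \<Phi>(1) by (auto simp: inj_on_def)
      finally show ?thesis .
    next
      case False
      then have "x j i \<noteq> x j' i" using ne[of j j' i] ne[of j' j i] j i by (metis linorder_neqE_nat)
      then show ?thesis using False by auto
    qed
    show "\<exists>x. (\<forall>j<h. x j \<in> A j) \<and> realises m ?I l U h E (\<lambda>j. restrict (x j) ?I)"
    proof (intro exI[of _ x] conjI allI impI)
      show "x j \<in> A j" if "j < h" for j using xG[OF that] by (simp add: G_def core_def)
      have "restrict (x j) ?I \<in> cube m ?I" if "j < h" for j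
      proof -
        have "x j \<in> cube m (I j)" using xG[OF that] G(1)[OF that] by blast
        then show ?thesis using II[OF that] by (auto simp: cube_def PiE_def Pi_def)
      qed
      moreover have "\<Phi> ` {..<l} \<subseteq> ?I" using \<Phi>(2) by (auto simp: J_def)
      ultimately show "realises m ?I l U h E (\<lambda>j. restrict (x j) ?I)"
        unfolding realises_def using \<Phi>(1) agree_iff by (intro conjI exI[of _ \<Phi>]) auto
    qed
  qed
qed

end
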